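(* Let $R$ be a commutative unital ring, $(A,\mu_1)$ a graded chain complex, $(B,\nu)$ an $A_\infty$ algebra over $R$, $f:B\to A$ and $g:A\to B$ chain maps, and $h:B\to B$ a chain homotopy with $g\circ f-id_B=d_B\circ h+h\circ d_B$. Equip $A$ with the transferred $A_\infty$ algebra structure $\mu$, let $k:(A,\mu)\to(B,\nu)$ be the transferred morphism of $A_\infty$ algebras (with $k_1=g$), and let $K:A\to B$ be the induced morphism of $A_\infty$ modules over $k$. If $I$ is an $A_\infty$ inner product on $B$, then $I$ has the same Massey inner product sets as the pulled back $A_\infty$ inner product $K^\sharp(I)$ on $A$; that is, for all $s,t\ge0$ with $s+t\ge1$ and any $(a_1,\dots,a_{s+t+2})\in A^{\times s}\times A\times A^{\times t}\times A$, the $(s,t)^{th}$ Massey inner product sets satisfy $$\langle a_1,\dots,a_{s+t+2}\rangle_{K^\sharp(I)}=\langle g(a_1),\dots,g(a_{s+t+2})\rangle_I .$$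
   Context: Shift and $A_\infty$ algebras. For a graded $R$-module $A=\bigoplus_{k\ge0}A_k$, $\underline A$ is $A$ shifted down by one: $|\underline a|=|a|-1$; $\mathfrak s:A\to\underline A$, $a\mapsto\underline a$. An $A_\infty$ algebra has maps $\mu_k:A^{\otimes k}\to A$ ($k\ge1$) of degree $2-k$ whose shifts $\underline{\mu_k}=\mathfrak s\circ\mu_k\circ(\mathfrak s^{-1})^{\otimes k}$ (of degree $1$) satisfy, for all $n\ge1$, $\sum_{k+\ell-1=n}\sum_{i+j+1=k}\underline{\mu_k}\circ(id^{\otimes i}\otimes\underline{\mu_\ell}\otimes id^{\otimes j})=0$. All signs are given by the Koszul rule in shifted degrees; underlines denote shifted versions of maps and elements. $d=\mu_1$. Elements are homogeneous. A morphism $f:(A,\mu)\to(B,\nu)$ of $A_\infty$ algebras consists of maps $f_k:A^{\otimes k}\to B$ ($k\ge1$) of degree $1-k$ whose shifts (of degree $0$) satisfy, for all $n\ge 1$, $\sum_{k+\ell-1=n}\sum_{i+j+1=k}\underline{f_k}(id^{\otimes i}\otimes\underline{\mu_\ell}\otimes id^{\otimes j})=\sum_{\ell_1+\dots+\ell_k=n}\underline{\nu_k}(\underline{f_{\ell_1}}\otimes\dots\otimes\underline{f_{\ell_k}})$. Transfer. With $d_A=\mu_1$, $d_B=\nu_1$ and $f,g,h$ as in the claim, define $p_2=\nu_2$ and, for $n>2$, $\underline{p_n}=\sum_{\ell\ge2,\ r_1,\dots,r_\ell\ge1,\ r_1+\dots+r_\ell=n}\underline{\nu_\ell}\big((\underline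 h\circ\underline{p_{r_1}})\otimes\dots\otimes(\underline h\circ\underline{p_{r_\ell}})\big)$, where by convention $h\circ p_1:=id_B$. Put $\mu_n=f\circ p_n\circ g^{\otimes n}$ for $n>1$ (and $\mu_1$ the given differential), $k_1=g$ and $k_n=h\circ p_n\circ g^{\otimes n}$ for $n>1$. By the (known) homotopy transfer theorem, $(A,\mu_1,\mu_2,\dots)$ is an $A_\infty$ algebra and $k:(A,\mu)\to(B,\nu)$ is a morphism of $A_\infty$ algebras. $A_\infty$ modules. An $A_\infty$ module $M$ over $A$ has maps $\beta_{k,\ell}:A^{\otimes k}\otimes M\otimes A^{\otimes\ell}\to M$ ($k,\ell\ge0$) of degree $1-k-\ell$ whose shifts (of degree $1$) satisfy, for all $r,s\ge0$, $\sum_{k+\ell-1=r}\sum_{i+j+1=k}\underline{\beta_{k,s}}(id^{\otimes i}\otimes\underline{\mu_\ell}\otimes id^{\otimes j}\otimes id_{\underline M}\otimes id^{\otimes s})+\sum_{k+i=r,\,\ell+j=s}\underline{\beta_{i,j}}(id^{\otimes i}\otimes\underline{\beta_{k,\ell}}\otimes id^{\otimes j})+\sum_{k+\ell-1=s}\sum_{i+j+1=k}\underline{\beta_{r,k}}(id^{\otimes r}\otimes id_{\underline M}\otimes id^{\otimes i}\otimes\underline{\mu_\ell}\otimes id^{\otimes j})=0$. The differential of $M$ is $d=\beta_{0,0}$. For a family $F$ of maps $F_{k,\ell}:A^{\otimes k}\otimes M\otimes A^{\otimes\ell}\to N$ of degree $|F|-k-\ell$, let $\underline{(F\circ\beta)_{r,s}}$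 be the expression of the previous display with the outer maps $\underline{\beta_{k,s}},\underline{\beta_{i,j}},\underline{\beta_{r,k}}$ replaced by $\underline{F_{k,s}},\underline{F_{i,j}},\underline{F_{r,k}}$. If $f:A\to B$ is a morphism of $A_\infty$ algebras, $(M,\beta)$ a module over $A$ and $(N,\gamma)$ a module over $B$, then $F$ is a morphism of $A_\infty$ modules (of degree $|F|$) over $f$ if for all $r,s\ge0$, $\underline{(F\circ\beta)_{r,s}}=(-1)^{|F|}\sum_{k+k_1+\dots+k_i=r}\sum_{\ell+\ell_1+\dots+\ell_j=s}\underline{\gamma_{i,j}}(\underline{f_{k_1}}\otimes\dots\otimes\underline{f_{k_i}}\otimes\underline{F_{k,\ell}}\otimes\underline{f_{\ell_1}}\otimes\dots\otimes\underline{f_{\ell_j}})$. Every $A_\infty$ algebra is an $A_\infty$ module over itself with $\beta_{k,\ell}=\mu_{k+\ell+1}$; a morphism $k:A\to B$ of $A_\infty$ algebras induces a morphism $K:A\to B$ of $A_\infty$ modules (of degree $0$) over $k$, given by $K_{i,j}=k_{i+j+1}$. Dual module and inner products. $M^*=Hom(M,R)$ is an $A_\infty$ module over $A$ via $\underline{\beta'_{k,\ell}}(\underline{a_1},\dots,\underline{a_k},\underline{m^*},\underline{\tilde a_1},\dots,\underline{\tilde a_\ell})(\underline{\tilde m})=-(-1)^{\varepsilon}\,\underline{m^*}(\underline{\beta_{\ell,k}}(\underline{\tilde a_1},\dots,\underline{\tilde a_\ell},\underline{\tilde m},\underline{a_1},\dots,\underline{a_k}))$, with $\varepsilon=(|\underline{a_1}|+\dots+|\underline{a_k}|)(|\underline{m^*}|+|\underline{\tilde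 a_1}|+\dots+|\underline{\tilde a_\ell}|+|\underline{\tilde m}|)+|\underline{m^*}|$; elements of the shift of $M^*$ are evaluated on $\underline M$ by $\underline{m^*}(\underline m)=m^*(m)$. An $A_\infty$ inner product on $M$ is a morphism $I:M\to M^*$ of $A_\infty$ modules over $id_A$. An $A_\infty$ inner product on an $A_\infty$ algebra $B$ is one on $B$ as a module over itself. Pullback. The pulled back $A_\infty$ inner product $K^\sharp(I)$ on $A$ is $\underline{K^\sharp(I)_{u,v}}(\underline{a_1},\dots,\underline{a_u},\underline m,\underline{\tilde a_1},\dots,\underline{\tilde a_v})(\underline{\tilde m})=\sum(-1)^{\varepsilon}\big(\underline{I_{i,j}}(\underline{k_{r_1}}\otimes\dots\otimes\underline{k_{r_i}}\otimes\underline{K_{r,s}}\otimes\underline{k_{s_1}}\otimes\dots\otimes\underline{k_{s_j}})(\underline{a_{u-p+1}},\dots,\underline{a_u},\underline m,\underline{\tilde a_1},\dots,\underline{\tilde a_q})\big)\big(\underline{K_{v-q,u-p}}(\underline{\tilde a_{q+1}},\dots,\underline{\tilde a_v},\underline{\tilde m},\underline{a_1},\dots,\underline{a_{u-p}})\big)$, summed over $0\le p\le u$, $0\le q\le v$, $r+r_1+\dots+r_i=p$, $s+s_1+\dots+s_j=q$, with $(-1)^\varepsilon$ the Koszul sign. Cyclic defining systems (for an $A_\infty$ inner product $I$ on a module $M$ over $A$; here applied with $M=A$ over $A$ and with $B$ over $B$). Fix $k,\ell\ge0$, put $n=k+\ell+2$ and let $(x_1,\dots,x_n)\in A^{\times k}\times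 M\times A^{\times\ell}\times M$. Entries are regarded as elements of $M$ or of $A$ as follows. A cyclic triangular system consists of a family $(x_{i,j})_{1\le i\le j\le n-1}$ and a family $(x'_{i,j})$ indexed by pairs $i\preceq j$ in the linear order $k+2\prec\dots\prec n\prec1\prec\dots\prec k$ (corner entries of both families included), with $x_{i,i}=x_i$, $x'_{i,i}=x_i$; $x_{i,j}\in M$ if $i\le k+1\le j$ and $x_{i,j}\in A$ otherwise; $x'_{i,j}\in M$ if $i\preceq n\preceq j$ and $x'_{i,j}\in A$ otherwise; the shifted degree $|\underline{x_{i,j}}|$ (resp. $|\underline{x'_{i,j}}|$) equals $\sum|\underline{x_m}|$ over $m$ from $i$ to $j$ in the respective order; and $x_{i,j}=x'_{i,j}$ whenever $1\le i\le j\le k$ or $k+2\le i\le j\le k+\ell+1$. The staircase product $\mathcal S^{i,j}$ of either family is defined by letting $\underline{\mathcal S^{i,j}}$ be the sum, over all ways of cutting the interval from $i$ to $j$ (in the respective order) into $t\ge2$ consecutive nonempty subintervals $[u_1,v_1],\dots,[u_t,v_t]$, of $\underline{\mu_t}$ (if all entries are in $A$) or $\underline{\beta_{r,s}}$ with $r+s+1=t$ (if the $(r+1)$-st entry is in $M$) applied to the shifted entries with indices $(u_1,v_1),\dots,(u_t,v_t)$. The system is a cyclic defining system if $d(x_{i,j})=-\mathcal S^{i,j}(\{x_{\bullet\bullet}\})$ and $d(x'_{i,j})=-\mathcal S^{i,j}(\{x'_{\bullet\bullet}\})$ for all $(i,j)$, corners included. Massey inner product. The staircase inner product of a cyclic defining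 system is $\mathcal I=\sum(-1)^{\varepsilon}\,\underline{I_{r,s}}(\underline{x_{u_1,v_1}},\dots,\underline{x_{u_{r+s+1},v_{r+s+1}}})(\underline{x'_{q+1,p-1}})\in R$, summed over all $1\le p\le k+1\le q\le k+\ell+1$ and all ways of cutting $[p,q]$ into consecutive nonempty subintervals $[u_1,v_1],\dots,[u_{r+s+1},v_{r+s+1}]$, where the $(r+1)$-st is the one containing $k+1$; for $p=1$, $p-1$ means $k+\ell+2$; and $\varepsilon=(|\underline{x_1}|+\dots+|\underline{x_{p-1}}|)(|\underline{x_p}|+\dots+|\underline{x_n}|)$. For $k+\ell\ge1$ the $(k,\ell)^{th}$ Massey inner product set $\langle x_1,\dots,x_n\rangle_I\subseteq R$ is the set of all values $\mathcal I$ over all cyclic defining systems for $(x_1,\dots,x_n)$ (the empty set if there are none).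
   Formalization: The entries a_i are assumed to be cycles, μ_1(a_i)=0; otherwise the left-hand set is empty while the right-hand one need not be (e.g. B=0, A=Z→Z via the identity in degrees 0 and 1, I=0, a=(1,0,0): ∅ versus {0}). *)

theory Defs
  imports Complex_Main "HOL-Library.Function_Algebras"
begin

section \<open>Graded modules and homogeneous elements\<close>

text \<open>
  A graded module is a type with an internal direct sum decomposition indexed by the integers.
  A homogeneous element is a pair (degree, element), so that the zero element, too, carries a
  definite degree.  A homogeneous (multi)linear map is given by its values on homogeneous elements.
\<close>

locale graded_module = module scale
  for scale :: "'r::comm_ring_1 \<Rightarrow> 'a::ab_group_add \<Rightarrow> 'a" +
  fixes G :: "int \<Rightarrow> 'a set"
  assumes subspace_G: "subspace (G d)"
    and G_neg: "d < 0 \<Longrightarrow> G d = {0}"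
    and direct_sum: "\<exists>!c. (\<forall>d. c d \<in> G d) \<and> finite {d. c d \<noteq> 0} \<and> x = (\<Sum>d | c d \<noteq> 0. c d)"

definition homog :: "(int \<Rightarrow> 'a set) \<Rightarrow> (int \<times> 'a) set" where
  "homog G = {(d, x). x \<in> G d}"

definition graded_hom ::
  "('r::comm_ring_1 \<Rightarrow> 'a::ab_group_add \<Rightarrow> 'a) \<Rightarrow> (int \<Rightarrow> 'a set) \<Rightarrow>
   ('r \<Rightarrow> 'b::ab_group_add \<Rightarrow> 'b) \<Rightarrow> (int \<Rightarrow> 'b set) \<Rightarrow> int \<Rightarrow> ('a \<Rightarrow> 'b) \<Rightarrow> bool" where
  "graded_hom sA A sB B \<delta> \<phi> \<longleftrightarrow> module_hom sA sB \<phi> \<and> (\<forall>d. \<phi> ` A d \<subseteq> B (d + \<delta>))"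

definition homog_linear ::
  "('r::comm_ring_1 \<Rightarrow> 'a::ab_group_add \<Rightarrow> 'a) \<Rightarrow> (int \<Rightarrow> 'a set) \<Rightarrow>
   ('r \<Rightarrow> 'b::ab_group_add \<Rightarrow> 'b) \<Rightarrow> (int \<times> 'a \<Rightarrow> 'b) \<Rightarrow> bool" where
  "homog_linear sA A sB \<phi> \<longleftrightarrow>
     (\<forall>d. \<forall>x\<in>A d. \<forall>y\<in>A d. \<forall>r.
        \<phi> (d, x + y) = \<phi> (d, x) + \<phi> (d, y) \<and> \<phi> (d, sA r x) = sB r (\<phi> (d, x)))"

definition chain_complex ::
  "('r::comm_ring_1 \<Rightarrow> 'a::ab_group_add \<Rightarrow> 'a) \<Rightarrow> (int \<Rightarrow> 'a set) \<Rightarrow> ('a \<Rightarrow> 'a) \<Rightarrow> bool" where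
  "chain_complex sA A d \<longleftrightarrow>
     graded_module sA A \<and> graded_hom sA A sA A 1 d \<and> (\<forall>x. d (d x) = 0)"


section \<open>Signs and the shift\<close>

definition ksign :: "int \<Rightarrow> 'a::ab_group_add \<Rightarrow> 'a" where
  "ksign e x = (if even e then x else - x)"

definition sdeg :: "int \<times> 'a \<Rightarrow> int" where
  "sdeg x = fst x - 1"

definition sdegs :: "(int \<times> 'a) list \<Rightarrow> int" where
  "sdegs xs = (\<Sum>x\<leftarrow>xs. sdeg x)"

text \<open>
  Koszul exponent of the \<open>n\<close>-fold tensor power of the inverse shift (a map of degree 1), applied
  to shifted elements whose unshifted degrees are \<open>ds\<close>: the \<open>i\<close>-th element is passed by all
  inverse shifts to the right of the \<open>i\<close>-th one.
\<close>

definition shift_exp :: "int list \<Rightarrow> int" where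
  "shift_exp ds = (\<Sum>i<length ds. int (length ds - 1 - i) * (ds ! i - 1))"

text \<open>
  The underlined version of a family of maps \<open>\<phi>\<close>, where the length of the argument list selects
  the member of the family.  An element and its shift are the same element of the underlying
  module.  The function \<open>shifted_el \<delta>\<close> also records the (unshifted) degree of the value of an
  underlined map of degree \<open>\<delta>\<close>.
\<close>

definition shifted :: "((int \<times> 'a) list \<Rightarrow> 'b::ab_group_add) \<Rightarrow> (int \<times> 'a) list \<Rightarrow> 'b" where
  "shifted \<phi> xs = ksign (shift_exp (map fst xs)) (\<phi> xs)"

definition shifted_el ::
  "int \<Rightarrow> ((int \<times> 'a) list \<Rightarrow> 'b::ab_group_add) \<Rightarrow> (int \<times> 'a) list \<Rightarrow> int \<times> 'b" where
  "shifted_el \<delta> \<phi> xs = (sdegs xs + \<delta> + 1, shifted \<phi> xs)"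

text \<open>The same for families of maps with one distinguished module argument.\<close>

type_synonym ('a, 'm, 'n) mod_maps =
  "(int \<times> 'a) list \<Rightarrow> int \<times> 'm \<Rightarrow> (int \<times> 'a) list \<Rightarrow> 'n"

definition mshifted :: "('a, 'm, 'n::ab_group_add) mod_maps \<Rightarrow> ('a, 'm, 'n) mod_maps" where
  "mshifted F as m bs = ksign (shift_exp (map fst as @ fst m # map fst bs)) (F as m bs)"

definition mshifted_el ::
  "int \<Rightarrow> ('a, 'm, 'n::ab_group_add) mod_maps \<Rightarrow> ('a, 'm, int \<times> 'n) mod_maps" where
  "mshifted_el \<delta> F as m bs = (sdegs as + sdeg m + sdegs bs + \<delta> + 1, mshifted F as m bs)"

text \<open>
  Passing to the underlined version multiplies each value by a sign depending only on the degrees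
  of the arguments; it is therefore its own inverse.
\<close>

abbreviation "unshifted \<equiv> shifted"
abbreviation "munshifted \<equiv> mshifted"


section \<open>Decompositions of lists\<close>

definition splits2 :: "'a list \<Rightarrow> ('a list \<times> 'a list) set" where
  "splits2 xs = {(ys, zs). ys @ zs = xs}"

definition splits3 :: "'a list \<Rightarrow> ('a list \<times> 'a list \<times> 'a list) set" where
  "splits3 xs = {(us, vs, ws). us @ vs @ ws = xs \<and> vs \<noteq> []}"

definition cuts :: "'a list \<Rightarrow> 'a list list set" where
  "cuts xs = {yss. concat yss = xs \<and> [] \<notin> set yss}"

definition cuts2 :: "'a list \<Rightarrow> 'a list list set" where
  "cuts2 xs = {yss \<in> cuts xs. 2 \<le> length yss}"

definition pointed_cuts :: "'a \<Rightarrow> 'a list \<Rightarrow> ('a list list \<times> 'a list \<times> 'a list list) set" where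
  "pointed_cuts c xs = {(uss, vs, wss). uss @ vs # wss \<in> cuts xs \<and> c \<in> set vs}"

lemma finite_splits2: "finite (splits2 xs)"
proof (rule finite_subset)
  show "splits2 xs \<subseteq> (\<lambda>i. (take i xs, drop i xs)) ` {..length xs}"
  proof
    fix p assume "p \<in> splits2 xs"
    then obtain ys zs where "p = (ys, zs)" "xs = ys @ zs"
      by (auto simp: splits2_def)
    then show "p \<in> (\<lambda>i. (take i xs, drop i xs)) ` {..length xs}"
      by (intro image_eqI[of _ _ "length ys"]) auto
  qed
qed simp

lemma finite_splits3: "finite (splits3 xs)"
proof (rule finite_subset)
  show "splits3 xs \<subseteq> (\<lambda>(i, j). (take i xs, take j (drop i xs), drop j (drop i xs))) `
          ({..length xs} \<times> {..length xs})"
  proof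
    fix p assume "p \<in> splits3 xs"
    then obtain us vs ws where "p = (us, vs, ws)" "xs = us @ vs @ ws"
      by (auto simp: splits3_def)
    then show "p \<in> (\<lambda>(i, j). (take i xs, take j (drop i xs), drop j (drop i xs))) `
                 ({..length xs} \<times> {..length xs})"
      by (intro image_eqI[of _ _ "(length us, length vs)"]) auto
  qed
qed simp

lemma length_le_concat: "[] \<notin> set yss \<Longrightarrow> length yss \<le> length (concat yss)"
proof (induction yss)
  case (Cons ys yss)
  have "0 < length ys" using Cons.prems by (cases ys) auto
  moreover have "length yss \<le> length (concat yss)" using Cons by simp
  ultimately show ?case
    unfolding concat.simps length_append list.size by linarith
qed simp

lemma finite_cuts: "finite (cuts xs)"
proof (rule finite_subset)
  let ?P = "{ys. set ys \<subseteq> set xs \<and> length ys \<le> length xs}"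
  show "cuts xs \<subseteq> {yss. set yss \<subseteq> ?P \<and> length yss \<le> length xs}"
  proof
    fix yss assume "yss \<in> cuts xs"
    then have "concat yss = xs" "[] \<notin> set yss"
      by (auto simp: cuts_def)
    moreover have "length ys \<le> length (concat yss)" if "ys \<in> set yss" for ys
      using that by (induction yss) auto
    ultimately show "yss \<in> {yss. set yss \<subseteq> ?P \<and> length yss \<le> length xs}"
      using length_le_concat[of yss] by auto
  qed
  show "finite {yss. set yss \<subseteq> ?P \<and> length yss \<le> length xs}"
    by (intro finite_lists_length_le) auto
qed

lemma length_cuts2_less:
  assumes "yss \<in> cuts2 xs" and "ys \<in> set yss"
  shows "length ys < length xs"
proof -
  obtain us ws where yss: "yss = us @ ys # ws"
    using assms(2) by (meson split_list)
  have xs: "xs = concat us @ ys @ concat ws" and ne: "[] \<notin> set us" "[] \<notin> set ws"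
    and "us \<noteq> [] \<or> ws \<noteq> []"
    using assms(1) by (auto simp: yss cuts2_def cuts_def)
  then have "0 < length us + length ws" by auto
  with length_le_concat[OF ne(1)] length_le_concat[OF ne(2)] show ?thesis
    unfolding xs length_append by linarith
qed


section \<open>A-infinity algebras\<close>

locale ainf_algebra = graded_module scale G
  for scale :: "'r::comm_ring_1 \<Rightarrow> 'a::ab_group_add \<Rightarrow> 'a" and G +
  fixes \<mu> :: "(int \<times> 'a) list \<Rightarrow> 'a"
  assumes multilinear:
      "us \<in> lists (homog G) \<Longrightarrow> ws \<in> lists (homog G) \<Longrightarrow>
       homog_linear scale G scale (\<lambda>x. \<mu> (us @ x # ws))"
    and degree:
      "xs \<in> lists (homog G) \<Longrightarrow> xs \<noteq> [] \<Longrightarrow> \<mu> xs \<in> G (sum_list (map fst xs) + 2 - int (length xs))"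
    and relations:
      "xs \<in> lists (homog G) \<Longrightarrow> xs \<noteq> [] \<Longrightarrow>
       (\<Sum>(us, vs, ws)\<in>splits3 xs. ksign (sdegs us) (shifted \<mu> (us @ shifted_el 1 \<mu> vs # ws))) = 0"


section \<open>Homotopy transfer\<close>

text \<open>
  The underlined maps \<open>p\<^sub>n\<close>.  For \<open>n = 2\<close> the only summand is the cut into two singletons, so
  that \<open>p\<^sub>2 = \<nu>\<^sub>2\<close>; singletons implement the convention \<open>h \<circ> p\<^sub>1 = id\<close>.
\<close>

function shifted_p ::
  "((int \<times> 'b) list \<Rightarrow> 'b::ab_group_add) \<Rightarrow> ('b \<Rightarrow> 'b) \<Rightarrow> (int \<times> 'b) list \<Rightarrow> 'b" where
  "shifted_p \<nu> h xs =
     (\<Sum>yss\<in>cuts2 xs.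
        shifted \<nu> (map (\<lambda>ys. if length ys = 1 then hd ys
                             else (sdegs ys + 1, h (shifted_p \<nu> h ys))) yss))"
  by auto
termination
  by (relation "measure (\<lambda>(\<nu>, h, xs). length xs)") (auto dest: length_cuts2_less)

declare shifted_p.simps [simp del]

definition transfer_p ::
  "((int \<times> 'b) list \<Rightarrow> 'b::ab_group_add) \<Rightarrow> ('b \<Rightarrow> 'b) \<Rightarrow> (int \<times> 'b) list \<Rightarrow> 'b" where
  "transfer_p \<nu> h = unshifted (shifted_p \<nu> h)"

definition transfer_mu ::
  "('a \<Rightarrow> 'a) \<Rightarrow> ((int \<times> 'b) list \<Rightarrow> 'b::ab_group_add) \<Rightarrow> ('b \<Rightarrow> 'a) \<Rightarrow> ('a \<Rightarrow> 'b) \<Rightarrow> ('b \<Rightarrow> 'b) \<Rightarrow>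
   (int \<times> 'a) list \<Rightarrow> 'a" where
  "transfer_mu d \<nu> f g h xs =
     (if length xs = 1 then d (snd (hd xs)) else f (transfer_p \<nu> h (map (apsnd g) xs)))"

definition transfer_k ::
  "((int \<times> 'b) list \<Rightarrow> 'b::ab_group_add) \<Rightarrow> ('a \<Rightarrow> 'b) \<Rightarrow> ('b \<Rightarrow> 'b) \<Rightarrow> (int \<times> 'a) list \<Rightarrow> 'b" where
  "transfer_k \<nu> g h xs =
     (if length xs = 1 then g (snd (hd xs)) else h (transfer_p \<nu> h (map (apsnd g) xs)))"


section \<open>Modules, duals and inner products\<close>

text \<open>
  For \<open>\<phi> = \<mu>\<close> this is an algebra as a module over itself; for a morphism \<open>\<phi> = k\<close> of
  algebras it is the induced morphism \<open>K\<close> of modules.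
\<close>

definition as_module :: "((int \<times> 'a) list \<Rightarrow> 'b) \<Rightarrow> ('a, 'a, 'b) mod_maps" where
  "as_module \<phi> as m bs = \<phi> (as @ m # bs)"

text \<open>The underlined components of \<open>F \<circ> \<beta>\<close>.\<close>

definition shifted_comp ::
  "((int \<times> 'a) list \<Rightarrow> 'a::ab_group_add) \<Rightarrow> ('a, 'm::ab_group_add, 'm) mod_maps \<Rightarrow>
   ('a, 'm, 'n::ab_group_add) mod_maps \<Rightarrow> ('a, 'm, 'n) mod_maps" where
  "shifted_comp \<mu> \<beta> F as m bs =
     (\<Sum>(us, vs, ws)\<in>splits3 as.
        ksign (sdegs us) (mshifted F (us @ shifted_el 1 \<mu> vs # ws) m bs))
   + (\<Sum>(us, vs)\<in>splits2 as. \<Sum>(ws, zs)\<in>splits2 bs.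
        ksign (sdegs us) (mshifted F us (mshifted_el 1 \<beta> vs m ws) zs))
   + (\<Sum>(us, vs, ws)\<in>splits3 bs.
        ksign (sdegs as + sdeg m + sdegs us) (mshifted F as m (us @ shifted_el 1 \<mu> vs # ws)))"

text \<open>
  \<open>F\<close> is a morphism of degree \<open>e\<close> over \<open>f\<close> from the module \<open>(M, \<beta>)\<close> over \<open>(A, \<mu>)\<close> to the
  module \<open>N\<close> with structure maps \<open>\<gamma>\<close>.  The factor with exponent \<open>e * sdegs us\<close> is the Koszul
  sign of \<open>F\<close> passing the arguments \<open>us\<close>.
\<close>

definition ainf_module_morphism ::
  "('r::comm_ring_1 \<Rightarrow> 'a::ab_group_add \<Rightarrow> 'a) \<Rightarrow> (int \<Rightarrow> 'a set) \<Rightarrow> ((int \<times> 'a) list \<Rightarrow> 'a) \<Rightarrow>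
   ('r \<Rightarrow> 'm::ab_group_add \<Rightarrow> 'm) \<Rightarrow> (int \<Rightarrow> 'm set) \<Rightarrow> ('a, 'm, 'm) mod_maps \<Rightarrow>
   ((int \<times> 'a) list \<Rightarrow> 'b::ab_group_add) \<Rightarrow>
   ('r \<Rightarrow> 'n::ab_group_add \<Rightarrow> 'n) \<Rightarrow> (int \<Rightarrow> 'n set) \<Rightarrow> ('b, 'n, 'n) mod_maps \<Rightarrow>
   int \<Rightarrow> ('a, 'm, 'n) mod_maps \<Rightarrow> bool" where
  "ainf_module_morphism sA A \<mu> sM M \<beta> f sN N \<gamma> e F \<longleftrightarrow>
     (\<forall>us\<in>lists (homog A). \<forall>ws\<in>lists (homog A). \<forall>m\<in>homog M. \<forall>bs\<in>lists (homog A).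
        homog_linear sA A sN (\<lambda>x. F (us @ x # ws) m bs) \<and>
        homog_linear sA A sN (\<lambda>x. F bs m (us @ x # ws))) \<and>
     (\<forall>as\<in>lists (homog A). \<forall>bs\<in>lists (homog A). homog_linear sM M sN (\<lambda>m. F as m bs)) \<and>
     (\<forall>as\<in>lists (homog A). \<forall>m\<in>homog M. \<forall>bs\<in>lists (homog A).
        F as m bs \<in> N (sum_list (map fst as) + fst m + sum_list (map fst bs)
                          + e - int (length as) - int (length bs)) \<and>
        shifted_comp \<mu> \<beta> F as m bs =
          ksign e (\<Sum>(us, vs)\<in>splits2 as. \<Sum>uss\<in>cuts us. \<Sum>(ws, zs)\<in>splits2 bs. \<Sum>zss\<in>cuts zs.
            ksign (e * sdegs us)
              (mshifted \<gamma> (map (shifted_el 0 f) uss) (mshifted_el e F vs m ws)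
                         (map (shifted_el 0 f) zss))))"

definition ainf_id :: "(int \<times> 'a) list \<Rightarrow> 'a::ab_group_add" where
  "ainf_id xs = (if length xs = 1 then snd (hd xs) else 0)"

text \<open>
  A homogeneous element of degree \<open>D\<close> of the dual is a linear map to \<open>R\<close> which vanishes on the
  homogeneous elements of degrees other than \<open>- D\<close>.  It is evaluated on pairs (degree, element);
  pairs that are not homogeneous elements are sent to 0, so that equality of functions is equality
  of elements of the dual.
\<close>

definition dual_grading ::
  "('r::comm_ring_1 \<Rightarrow> 'm::ab_group_add \<Rightarrow> 'm) \<Rightarrow> (int \<Rightarrow> 'm set) \<Rightarrow> int \<Rightarrow> (int \<times> 'm \<Rightarrow> 'r) set" where
  "dual_grading sM M D =
     {\<phi>. homog_linear sM M (*) \<phi> \<and> (\<forall>z. \<phi> z \<noteq> 0 \<longrightarrow> z \<in> homog M \<and> fst z = - D)}"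

definition dual_scale :: "'r::comm_ring_1 \<Rightarrow> (int \<times> 'm \<Rightarrow> 'r) \<Rightarrow> int \<times> 'm \<Rightarrow> 'r" where
  "dual_scale r \<phi> z = r * \<phi> z"

definition dual_module ::
  "(int \<Rightarrow> 'm set) \<Rightarrow> ('a, 'm::ab_group_add, 'm) mod_maps \<Rightarrow>
   ('a, int \<times> 'm \<Rightarrow> 'r::comm_ring_1, int \<times> 'm \<Rightarrow> 'r) mod_maps" where
  "dual_module M \<beta> = munshifted (\<lambda>as \<phi> bs m.
     if m \<in> homog M then
       - ksign (sdegs as * (sdeg \<phi> + sdegs bs + sdeg m) + sdeg \<phi>)
           ((snd \<phi>) (mshifted_el 1 \<beta> bs m as))
     else 0)"

definition ainf_inner_product ::
  "('r::comm_ring_1 \<Rightarrow> 'a::ab_group_add \<Rightarrow> 'a) \<Rightarrow> (int \<Rightarrow> 'a set) \<Rightarrow> ((int \<times> 'a) list \<Rightarrow> 'a) \<Rightarrow>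
   ('r \<Rightarrow> 'm::ab_group_add \<Rightarrow> 'm) \<Rightarrow> (int \<Rightarrow> 'm set) \<Rightarrow> ('a, 'm, 'm) mod_maps \<Rightarrow>
   int \<Rightarrow> ('a, 'm, int \<times> 'm \<Rightarrow> 'r) mod_maps \<Rightarrow> bool" where
  "ainf_inner_product sA A \<mu> sM M \<beta> e I \<longleftrightarrow>
     ainf_module_morphism sA A \<mu> sM M \<beta> ainf_id
       dual_scale (dual_grading sM M) (dual_module M \<beta>) e I"

text \<open>
  In the pullback, \<open>as\<^sub>1\<close> consists of the arguments that are moved behind \<open>m'\<close>; the exponent is
  the Koszul sign of this move.
\<close>

definition pullback ::
  "(int \<Rightarrow> 'm set) \<Rightarrow> ((int \<times> 'a) list \<Rightarrow> 'b::ab_group_add) \<Rightarrow>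
   ('a, 'm, 'n::ab_group_add) mod_maps \<Rightarrow> ('b, 'n, int \<times> 'n \<Rightarrow> 'r::comm_ring_1) mod_maps \<Rightarrow>
   ('a, 'm, int \<times> 'm \<Rightarrow> 'r) mod_maps" where
  "pullback M k K I = munshifted (\<lambda>as m bs m'.
     if m' \<in> homog M then
       (\<Sum>(as\<^sub>1, as\<^sub>2)\<in>splits2 as. \<Sum>(bs\<^sub>1, bs\<^sub>2)\<in>splits2 bs.
        \<Sum>(us, vs)\<in>splits2 as\<^sub>2. \<Sum>uss\<in>cuts us. \<Sum>(ws, zs)\<in>splits2 bs\<^sub>1. \<Sum>zss\<in>cuts zs.
          ksign (sdegs as\<^sub>1 * (sdegs as\<^sub>2 + sdeg m + sdegs bs + sdeg m'))
            (mshifted I (map (shifted_el 0 k) uss) (mshifted_el 0 K vs m ws)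
                        (map (shifted_el 0 k) zss)
              (mshifted_el 0 K bs\<^sub>2 m' as\<^sub>1)))
     else 0)"


section \<open>Massey inner products\<close>

text \<open>
  All of the following is for an algebra as a module over itself, so that all entries lie in the
  algebra and all products in the staircase product are given by \<open>\<mu>\<close>.

  The tuple \<open>(x\<^sub>1, \<dots>, x\<^sub>n)\<close> is a list \<open>xs\<close>, hence \<open>x\<^sub>i\<close> is \<open>xs ! (i - 1)\<close>.  The two linear orders
  on indices are given by lists, and an interval by the list of its members.
\<close>

definition index_order :: "nat \<Rightarrow> nat \<Rightarrow> nat list" where
  "index_order k l = [1..<k + l + 2]"

definition index_order' :: "nat \<Rightarrow> nat \<Rightarrow> nat list" where
  "index_order' k l = [k + 2..<k + l + 3] @ [1..<k + 1]"

definition intervals :: "nat list \<Rightarrow> nat list set" where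
  "intervals ord = {seg. seg \<noteq> [] \<and> (\<exists>us ws. ord = us @ seg @ ws)}"

definition entry :: "(nat \<Rightarrow> nat \<Rightarrow> 'c) \<Rightarrow> nat list \<Rightarrow> 'c" where
  "entry x seg = x (hd seg) (last seg)"

definition triangular_family ::
  "(int \<Rightarrow> 'a set) \<Rightarrow> nat list \<Rightarrow> (int \<times> 'a) list \<Rightarrow> (nat \<Rightarrow> nat \<Rightarrow> int \<times> 'a) \<Rightarrow> bool" where
  "triangular_family A ord xs x \<longleftrightarrow>
     (\<forall>i\<in>set ord. x i i = xs ! (i - 1)) \<and>
     (\<forall>seg\<in>intervals ord. entry x seg \<in> homog A \<and>
        sdeg (entry x seg) = (\<Sum>m\<leftarrow>seg. sdeg (xs ! (m - 1))))"

definition cyclic_triangular_system ::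
  "(int \<Rightarrow> 'a set) \<Rightarrow> nat \<Rightarrow> nat \<Rightarrow> (int \<times> 'a) list \<Rightarrow>
   (nat \<Rightarrow> nat \<Rightarrow> int \<times> 'a) \<Rightarrow> (nat \<Rightarrow> nat \<Rightarrow> int \<times> 'a) \<Rightarrow> bool" where
  "cyclic_triangular_system A k l xs x x' \<longleftrightarrow>
     triangular_family A (index_order k l) xs x \<and>
     triangular_family A (index_order' k l) xs x' \<and>
     (\<forall>i j. 1 \<le> i \<and> i \<le> j \<and> j \<le> k \<longrightarrow> x i j = x' i j) \<and>
     (\<forall>i j. k + 2 \<le> i \<and> i \<le> j \<and> j \<le> k + l + 1 \<longrightarrow> x i j = x' i j)"

definition staircase_product ::
  "((int \<times> 'a) list \<Rightarrow> 'a::ab_group_add) \<Rightarrow> (nat \<Rightarrow> nat \<Rightarrow> int \<times> 'a) \<Rightarrow> nat list \<Rightarrow> 'a" where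
  "staircase_product \<mu> x seg = (\<Sum>segs\<in>cuts2 seg. shifted \<mu> (map (entry x) segs))"

text \<open>
  The intervals include the singletons, whose staircase product is the empty sum.  A defining
  system can therefore exist only if every entry of the tuple is a cycle.
\<close>

definition cyclic_defining_system ::
  "(int \<Rightarrow> 'a::ab_group_add set) \<Rightarrow> ((int \<times> 'a) list \<Rightarrow> 'a) \<Rightarrow> nat \<Rightarrow> nat \<Rightarrow> (int \<times> 'a) list \<Rightarrow>
   (nat \<Rightarrow> nat \<Rightarrow> int \<times> 'a) \<Rightarrow> (nat \<Rightarrow> nat \<Rightarrow> int \<times> 'a) \<Rightarrow> bool" where
  "cyclic_defining_system A \<mu> k l xs x x' \<longleftrightarrow>
     cyclic_triangular_system A k l xs x x' \<and>
     (\<forall>seg\<in>intervals (index_order k l). \<mu> [entry x seg] = - staircase_product \<mu> x seg) \<and>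
     (\<forall>seg\<in>intervals (index_order' k l). \<mu> [entry x' seg] = - staircase_product \<mu> x' seg)"

definition staircase_inner_product ::
  "('a, 'a, int \<times> 'a \<Rightarrow> 'r::comm_ring_1) mod_maps \<Rightarrow> nat \<Rightarrow> nat \<Rightarrow> (int \<times> 'a) list \<Rightarrow>
   (nat \<Rightarrow> nat \<Rightarrow> int \<times> 'a) \<Rightarrow> (nat \<Rightarrow> nat \<Rightarrow> int \<times> 'a) \<Rightarrow> 'r" where
  "staircase_inner_product I k l xs x x' =
     (\<Sum>p = 1..k + 1. \<Sum>q = k + 1..k + l + 1. \<Sum>(uss, vs, wss)\<in>pointed_cuts (k + 1) [p..<q + 1].
        ksign (sdegs (take (p - 1) xs) * sdegs (drop (p - 1) xs))
          (mshifted I (map (entry x) uss) (entry x vs) (map (entry x) wss)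
            (x' (q + 1) (if p = 1 then k + l + 2 else p - 1))))"

definition massey_inner_product_set ::
  "(int \<Rightarrow> 'a::ab_group_add set) \<Rightarrow> ((int \<times> 'a) list \<Rightarrow> 'a) \<Rightarrow>
   ('a, 'a, int \<times> 'a \<Rightarrow> 'r::comm_ring_1) mod_maps \<Rightarrow> nat \<Rightarrow> nat \<Rightarrow> (int \<times> 'a) list \<Rightarrow> 'r set" where
  "massey_inner_product_set A \<mu> I k l xs =
     {staircase_inner_product I k l xs x x' | x x'. cyclic_defining_system A \<mu> k l xs x x'}"

end

theory Submission
  imports Defs "HOL-Library.Multiset"
begin

text \<open>
  A cyclic defining system assigns an entry to every interval of either linear order; since the two
  families agree on common intervals, it is a single function on intervals satisfying a
  Maurer--Cartan equation.

  Summing the maps \<open>k\<close> over all cuts of an interval turns a family \<open>x\<close> in \<open>A\<close> into a family \<open>y\<close> in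
  \<open>B\<close> which obeys the recursion \<open>y J = g (x J) + h (S J)\<close>, where \<open>S J\<close> is the staircase product of \<open>y\<close>
  at \<open>J\<close>, while the staircase product of \<open>x\<close> for the transferred structure is \<open>f (S J)\<close>. The homotopy
  identity then shows directly that \<open>y\<close> is a defining system, and expanding the pullback shows
  that both staircase inner products agree. This gives one inclusion.

  For the other one, a given family \<open>y\<close> in \<open>B\<close> is made to satisfy the recursion, one interval after the
  other. At the interval \<open>J\<close> put \<open>x J = f (y J)\<close>, so that the recursion asks for \<open>y J\<close> to be replaced
  by \<open>g (f (y J)) + h (S J)\<close>, which is \<open>y J\<close> plus the differential of \<open>z = h (y J)\<close>. This change
  extends to an infinitesimal gauge transformation generated by \<open>z\<close>. As \<open>z\<close> sits at one interval and
  disjoint intervals cannot both contain it, there are no terms of higher order: the new family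
  satisfies the Maurer--Cartan equation exactly, and since the inner product is a morphism of
  modules, the staircase inner product does not change.
\<close>


section \<open>Signs and cuts of lists\<close>

text \<open>The overview takes for granted that a gauge step does no harm elsewhere. Intervals are
  treated by increasing length, and one-letter intervals are settled from the start. A step at
  \<open>seg\<close> changes the family only at intervals containing \<open>seg\<close>, hence at
  none that is already settled, and at \<open>seg\<close> itself the change is just the differential
  of \<open>z\<close>, because a cut of \<open>seg\<close> into several blocks consists of shorter
  intervals. The equation for \<open>x\<close> at \<open>seg\<close> comes for free, as
  \<open>f\<close> is a chain map.

  The obstacle that shapes the proof is the signs. The entries of the inner product form a cyclic
  word, and one block runs across its end, so that a Koszul sign taken along the linear word has to
  be compared with one taken after a rotation. Words are therefore kept as lists of blocks, with one
  sign attached to the whole word. Then the structure relations and the morphism equation can be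
  used as they stand for words with \<open>z\<close> inserted, and what remains is the regrouping of
  sums over nested cuts, each regrouping being one bijection.\<close>

lemma ksign_ksign: "ksign a (ksign b x) = ksign (a + b) x"
  by (auto simp: ksign_def)

lemma ksign_0 [simp]: "ksign a 0 = 0"
  by (auto simp: ksign_def)

lemma ksign_add: "ksign a (x + y) = ksign a x + ksign a y"
  by (auto simp: ksign_def)

lemma ksign_minus: "ksign a (- x) = - ksign a x"
  by (auto simp: ksign_def)

lemma ksign_sum: "ksign a (sum F S) = (\<Sum>x\<in>S. ksign a (F x))"
  by (auto simp: ksign_def sum_negf)

lemma ksign_parity: "even a = even b \<Longrightarrow> ksign a x = ksign b x"
  by (auto simp: ksign_def)

lemma ksign_apply: "ksign a \<phi> z = ksign a (\<phi> z)"
  by (auto simp: ksign_def fun_Compl_def)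

lemma sum_fun_apply: "(\<Sum>x\<in>S. F x) z = (\<Sum>x\<in>S. F x z)"
  for F :: "_ \<Rightarrow> _ \<Rightarrow> _ :: comm_monoid_add"
  by (induction S rule: infinite_finite_induct) auto

section \<open>Decompositions of a word into blocks, with uncut ends\<close>

definition block_of :: "'c list \<Rightarrow> ('c list \<times> 'c \<times> 'c list) set" where
  "block_of xs = {(a, V, b). a @ V # b = xs}"

definition prefix_cuts :: "'c list \<Rightarrow> ('c list list \<times> 'c list) set" where
  "prefix_cuts xs = {(uss, ys). concat uss @ ys = xs \<and> [] \<notin> set uss}"

definition suffix_cuts :: "'c list \<Rightarrow> ('c list \<times> 'c list list) set" where
  "suffix_cuts xs = {(ys, uss). ys @ concat uss = xs \<and> [] \<notin> set uss}"

text \<open>The uncut ends \<open>ys\<close> and \<open>zs\<close> may be empty. They are the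
  letters absorbed by the two neighbouring blocks, which contain the module letters of a cyclic
  word.\<close>

definition inner_cuts :: "'c list \<Rightarrow> ('c list \<times> 'c list list \<times> 'c list) set" where
  "inner_cuts xs = {(ys, uss, zs). ys @ concat uss @ zs = xs \<and> [] \<notin> set uss}"

lemma finite_block_of: "finite (block_of xs)"
proof (rule finite_imageD)
  show "finite ((\<lambda>(a, V, b). (a, [V], b)) ` block_of xs)"
    by (rule finite_subset[OF _ finite_splits3[of xs]]) (auto simp: block_of_def splits3_def)
qed (auto simp: inj_on_def)

lemma finite_inner_cuts: "finite (inner_cuts xs)"
proof (rule finite_subset)
  show "inner_cuts xs \<subseteq> (\<Union>p\<in>splits2 xs. \<Union>q\<in>splits2 (snd p).
      (\<lambda>uss. (fst p, uss, snd q)) ` cuts (fst q))"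
    by (auto simp: inner_cuts_def splits2_def cuts_def image_iff)
qed (simp add: finite_splits2 finite_cuts)

lemma finite_prefix_cuts: "finite (prefix_cuts xs)"
proof (rule finite_subset)
  show "prefix_cuts xs \<subseteq> snd ` inner_cuts xs"
    by (force simp: prefix_cuts_def inner_cuts_def)
qed (simp add: finite_inner_cuts)

lemma finite_suffix_cuts: "finite (suffix_cuts xs)"
proof (rule finite_subset)
  show "suffix_cuts xs \<subseteq> (\<lambda>(X, us, Y). (X, us)) ` inner_cuts xs"
    by (force simp: suffix_cuts_def inner_cuts_def)
qed (simp add: finite_inner_cuts)

lemmas finite_decompositions =
  finite_splits2 finite_splits3 finite_cuts finite_block_of finite_inner_cuts
  finite_prefix_cuts finite_suffix_cuts

lemma all_empty_nonempty: "[] \<notin> set zs \<Longrightarrow> (\<forall>x\<in>set zs. x = []) \<longleftrightarrow> zs = []"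
  by (cases zs) auto

text \<open>Merging a run \<open>vs\<close> of blocks of a cut gives a coarser cut with a chosen
  block \<open>V = concat vs\<close>; a cut of the chosen block restores the finer cut. This turns
  structure relations summed over all cuts into sums over the cuts of one block in a fixed
  surrounding.\<close>

lemma sum_cuts_splits3:
  "(\<Sum>full\<in>cuts J. \<Sum>(a, vs, b)\<in>splits3 full. F a vs b) =
   (\<Sum>yss\<in>cuts J. \<Sum>(a, V, b)\<in>block_of yss. \<Sum>vs\<in>cuts V. F a vs b)"
  unfolding split_def
  apply (simp add: sum.Sigma finite_decompositions split_def)
  apply (rule sum.reindex_bij_witness
     [of _ "\<lambda>(yss, (a, V, b), vs). (a @ vs @ b, (a, vs, b))"
           "\<lambda>(full, (a, vs, b)). (a @ concat vs # b, (a, concat vs, b), vs)"])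
  by (auto simp: cuts_def splits3_def block_of_def all_empty_nonempty)

lemma sum_inner_cuts_splits3:
  "(\<Sum>(X, uss, Y)\<in>inner_cuts J. \<Sum>(a, vs, b)\<in>splits3 uss. F X a vs b Y) =
   (\<Sum>(X, uss, Y)\<in>inner_cuts J. \<Sum>(a, V, b)\<in>block_of uss. \<Sum>vs\<in>cuts V. F X a vs b Y)"
  unfolding split_def
  apply (simp add: sum.Sigma finite_decompositions split_def)
  apply (rule sum.reindex_bij_witness
     [of _ "\<lambda>((X, yss, Y), (a, V, b), vs). ((X, a @ vs @ b, Y), (a, vs, b))"
           "\<lambda>((X, full, Y), (a, vs, b)). ((X, a @ concat vs # b, Y), (a, concat vs, b), vs)"])
  by (auto simp: inner_cuts_def cuts_def splits3_def block_of_def all_empty_nonempty)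

text \<open>The blocks behind the split point together with the uncut end \<open>Y\<close> form a
  cut of the end \<open>Z\<close> that a smaller inner cut leaves over. Letters absorbed by the
  neighbouring block can thus be cut in a second stage.\<close>

lemma sum_inner_cuts_prefix:
  "(\<Sum>(X, uss, Y)\<in>inner_cuts J. \<Sum>(us, vs)\<in>splits2 uss. F X us vs Y) =
   (\<Sum>(X, us, Z)\<in>inner_cuts J. \<Sum>(vs, Y)\<in>prefix_cuts Z. F X us vs Y)"
  unfolding split_def
  apply (simp add: sum.Sigma finite_decompositions split_def)
  apply (rule sum.reindex_bij_witness
     [of _ "\<lambda>((X, us, Z), (vs, Y)). ((X, us @ vs, Y), (us, vs))"
           "\<lambda>((X, uss, Y), (us, vs)). ((X, us, concat vs @ Y), (vs, Y))"])
  by (auto simp: inner_cuts_def splits2_def prefix_cuts_def)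

lemma sum_inner_cuts_suffix:
  "(\<Sum>(X, uss, Y)\<in>inner_cuts J. \<Sum>(us, vs)\<in>splits2 uss. F X us vs Y) =
   (\<Sum>(Z, vs, Y)\<in>inner_cuts J. \<Sum>(X, us)\<in>suffix_cuts Z. F X us vs Y)"
  unfolding split_def
  apply (simp add: sum.Sigma finite_decompositions split_def)
  apply (rule sum.reindex_bij_witness
     [of _ "\<lambda>((Z, vs, Y), (X, us)). ((X, us @ vs, Y), (us, vs))"
           "\<lambda>((X, uss, Y), (us, vs)). ((X @ concat us, vs, Y), (X, us))"])
  by (auto simp: inner_cuts_def splits2_def suffix_cuts_def)

lemma in_listset_cuts:
  "zsss \<in> listset (map cuts yss) \<longleftrightarrow> map concat zsss = yss \<and> (\<forall>zss\<in>set zsss. [] \<notin> set zss)"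
proof (induction yss arbitrary: zsss)
  case (Cons ys yss)
  then show ?case by (cases zsss) (auto simp: set_Cons_def cuts_def)
qed auto

lemma finite_listset_cuts: "finite (listset (map cuts yss))"
proof (induction yss)
  case (Cons ys yss)
  have "set_Cons (cuts ys) (listset (map cuts yss)) =
      (\<lambda>(x, xs). x # xs) ` (cuts ys \<times> listset (map cuts yss))"
    by (auto simp: set_Cons_def)
  then show ?case using Cons by (simp add: finite_cuts)
qed simp

lemma concat_concat_map: "concat (concat zsss) = concat (map concat zsss)"
  by (induction zsss) auto

text \<open>Associativity of bracketing: a grouping \<open>uss\<close> of the blocks of a fine cut
  is a coarse cut \<open>map concat uss\<close> with a cut of each coarse block. The fine cut is
  recovered as \<open>concat uss\<close>.\<close>

lemma refine_cuts_iff: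
  "uss \<in> cuts us \<and> [] \<notin> set us \<longleftrightarrow>
   us = concat uss \<and> [] \<notin> set (map concat uss) \<and> uss \<in> listset (map cuts (map concat uss))"
proof -
  have "[] \<in> set (map concat uss) \<longleftrightarrow> [] \<in> set uss" if "\<forall>zss\<in>set uss. [] \<notin> set zss"
    using that by (auto simp: image_iff all_empty_nonempty intro: bexI[of _ "[]"])
  then show ?thesis
    by (auto simp only: in_listset_cuts cuts_def) auto
qed

lemma refine_cuts_dest:
  "uss \<in> listset (map cuts us) \<Longrightarrow> us = map concat uss"
  by (simp add: in_listset_cuts)

lemma sum_inner_cuts_refine:
  "(\<Sum>(X, us, Y)\<in>inner_cuts J. \<Sum>uss\<in>cuts us. F X uss Y) =
   (\<Sum>(X, us, Y)\<in>inner_cuts J. \<Sum>uss\<in>listset (map cuts us). F X uss Y)"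
  (is "?l = ?r")
proof -
  let ?S = "SIGMA p:inner_cuts J. cuts (fst (snd p))"
  let ?T = "SIGMA p:inner_cuts J. listset (map cuts (fst (snd p)))"
  have "?l = (\<Sum>q\<in>?S. F (fst (fst q)) (snd q) (snd (snd (fst q))))"
    by (simp add: sum.Sigma finite_decompositions split_def)
  also have "\<dots> = (\<Sum>q\<in>?T. F (fst (fst q)) (snd q) (snd (snd (fst q))))"
  proof (rule sum.reindex_bij_witness
     [of _ "\<lambda>((X, us, Y), uss). ((X, concat uss, Y), uss)"
           "\<lambda>((X, us, Y), uss). ((X, map concat uss, Y), uss)"], goal_cases)
    case (2 q)
    then obtain X us Y uss where q: "q = ((X, us, Y), uss)" "(X, us, Y) \<in> inner_cuts J" "uss \<in> cuts us"
      by force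
    with refine_cuts_iff[of uss us] show ?case
      by (auto simp add: inner_cuts_def concat_concat_map[symmetric] simp del: map_map)
  next
    case (4 q)
    then obtain X us Y uss where q: "q = ((X, us, Y), uss)" "(X, us, Y) \<in> inner_cuts J"
        "uss \<in> listset (map cuts us)"
      by force
    with refine_cuts_dest[OF q(3)] refine_cuts_iff[of uss "concat uss"] show ?case
      by (simp add: inner_cuts_def concat_concat_map del: map_map)
  qed (auto simp: cuts_def dest: refine_cuts_dest)
  also have "\<dots> = ?r"
    by (simp add: sum.Sigma finite_decompositions finite_listset_cuts split_def)
  finally show ?thesis .
qed

lemma finite_cuts2: "finite (cuts2 xs)"
  by (rule finite_subset[OF _ finite_cuts]) (auto simp: cuts2_def)

text \<open>\<open>uss\<close> and \<open>map concat uss\<close> have the same length, so at least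
  two groups of blocks means at least two coarse blocks.\<close>

lemma sum_cuts2_refine:
  "(\<Sum>us\<in>cuts J. \<Sum>uss\<in>cuts2 us. F uss) =
   (\<Sum>us\<in>cuts2 J. \<Sum>uss\<in>listset (map cuts us). F uss)"
  (is "?l = ?r")
proof -
  let ?S = "SIGMA us:cuts J. cuts2 us"
  let ?T = "SIGMA us:cuts2 J. listset (map cuts us)"
  have "?l = (\<Sum>q\<in>?S. F (snd q))"
    by (simp add: sum.Sigma finite_cuts finite_cuts2 split_def)
  also have "\<dots> = (\<Sum>q\<in>?T. F (snd q))"
  proof (rule sum.reindex_bij_witness
     [of _ "\<lambda>(us, uss). (concat uss, uss)" "\<lambda>(us, uss). (map concat uss, uss)"], goal_cases)
    case (2 q)
    then obtain us uss where q: "q = (us, uss)" "us \<in> cuts J" "uss \<in> cuts2 us"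
      by force
    with refine_cuts_iff[of uss us] show ?case
      by (simp add: cuts_def cuts2_def concat_concat_map[symmetric] del: map_map)
  next
    case (4 q)
    then obtain us uss where q: "q = (us, uss)" "us \<in> cuts2 J" "uss \<in> listset (map cuts us)"
      by force
    with refine_cuts_dest[OF q(3)] refine_cuts_iff[of uss "concat uss"] show ?case
      by (simp add: cuts_def cuts2_def concat_concat_map del: map_map)
  qed (auto simp: cuts_def cuts2_def dest: refine_cuts_dest)
  also have "\<dots> = ?r"
    by (simp add: sum.Sigma finite_cuts2 finite_listset_cuts split_def)
  finally show ?thesis .
qed

lemma cuts_pointedE:
  assumes "vs \<in> cuts (X @ c # Y)" "c \<notin> set X" "c \<notin> set Y"
  obtains us P Q ws where "vs = us @ (P @ c # Q) # ws" "(us, P) \<in> prefix_cuts X"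
    "(Q, ws) \<in> suffix_cuts Y"
proof -
  have "c \<in> set (concat vs)" using assms(1) by (simp add: cuts_def)
  then obtain b where "b \<in> set vs" "c \<in> set b" by auto
  then obtain us ws P Q where vs: "vs = us @ (P @ c # Q) # ws"
    by (metis split_list)
  then have "(concat us @ P) @ c # (Q @ concat ws) = X @ c # Y"
    using assms(1) by (simp add: cuts_def)
  moreover from this have "c \<notin> set (concat us @ P)" "c \<notin> set (Q @ concat ws)"
    using assms(2,3) by (metis append_Cons_eq_iff)+
  ultimately have "concat us @ P = X" "Q @ concat ws = Y"
    using assms(2,3) append_Cons_eq_iff[of c X Y "concat us @ P" "Q @ concat ws"] by auto
  with assms(1) show thesis
    by (intro that[OF vs]) (auto simp: vs cuts_def prefix_cuts_def suffix_cuts_def)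
qed

text \<open>A letter that occurs once lies in exactly one block. What this block takes from
  \<open>X\<close> and from \<open>Y\<close> are the uncut ends of a prefix cut and of a suffix
  cut.\<close>

lemma sum_cuts_pointed:
  assumes "c \<notin> set X" "c \<notin> set Y"
  shows "(\<Sum>vs\<in>cuts (X @ c # Y). F vs) =
    (\<Sum>(us, P)\<in>prefix_cuts X. \<Sum>(Q, ws)\<in>suffix_cuts Y. F (us @ (P @ c # Q) # ws))"
proof -
  let ?j = "\<lambda>((us, P), (Q, ws)). us @ (P @ c # Q) # ws"
  have "(\<Sum>(us, P)\<in>prefix_cuts X. \<Sum>(Q, ws)\<in>suffix_cuts Y. F (us @ (P @ c # Q) # ws)) =
    (\<Sum>p\<in>prefix_cuts X \<times> suffix_cuts Y. F (?j p))"
    by (simp add: sum.cartesian_product split_def)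
  also have "\<dots> = sum F (?j ` (prefix_cuts X \<times> suffix_cuts Y))"
  proof -
    have "inj_on ?j (prefix_cuts X \<times> suffix_cuts Y)"
    proof (rule inj_onI)
      fix p p' assume p: "p \<in> prefix_cuts X \<times> suffix_cuts Y" "p' \<in> prefix_cuts X \<times> suffix_cuts Y"
        "?j p = ?j p'"
      obtain us P Q ws us' P' Q' ws' where pp': "p = ((us, P), (Q, ws))" "p' = ((us', P'), (Q', ws'))"
        by (metis prod.exhaust)
      with p have mem: "(us, P) \<in> prefix_cuts X" "(us', P') \<in> prefix_cuts X"
          "(Q, ws) \<in> suffix_cuts Y" "(Q', ws') \<in> suffix_cuts Y"
        and eq: "us @ (P @ c # Q) # ws = us' @ (P' @ c # Q') # ws'"
        by auto
      have c: "c \<notin> set (concat us) \<union> set P \<union> set (concat us') \<union> set P'"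
          "c \<notin> set Q \<union> set (concat ws) \<union> set Q' \<union> set (concat ws')"
        using mem assms unfolding prefix_cuts_def suffix_cuts_def
        by (metis (mono_tags, lifting) UnE case_prodD mem_Collect_eq set_append UnI1 UnI2)+
      \<comment> \<open>The longer of the two lists of leading blocks would contain the block with
        \<open>c\<close>, although all its letters come from \<open>X\<close>.\<close>
      have "\<not> length us < length us'"
      proof
        assume "length us < length us'"
        then have "us' ! length us = P @ c # Q"
          using arg_cong[OF eq, of "\<lambda>l. l ! length us"] by (simp add: nth_append)
        with \<open>length us < length us'\<close> have "P @ c # Q \<in> set us'" by (metis nth_mem)
        with c show False by auto
      qed
      moreover have "\<not> length us' < length us"
      proof
        assume "length us' < length us"
        then have "us ! length us' = P' @ c # Q'"
          using arg_cong[OF eq, of "\<lambda>l. l ! length us'"] by (simp add: nth_append)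
        with \<open>length us' < length us\<close> have "P' @ c # Q' \<in> set us" by (metis nth_mem)
        with c show False by auto
      qed
      ultimately have "length us = length us'" by simp
      with eq have "us = us'" "P @ c # Q = P' @ c # Q'" "ws = ws'" by auto
      moreover from this have "P = P'" "Q = Q'"
        using append_Cons_eq_iff[of c P Q P' Q'] c by auto
      ultimately show "p = p'" by (simp add: pp')
    qed
    then show "(\<Sum>p\<in>prefix_cuts X \<times> suffix_cuts Y. F (?j p)) = sum F (?j ` (prefix_cuts X \<times> suffix_cuts Y))"
      by (simp add: sum.reindex)
  qed
  also have "?j ` (prefix_cuts X \<times> suffix_cuts Y) = cuts (X @ c # Y)"
  proof
    show "cuts (X @ c # Y) \<subseteq> ?j ` (prefix_cuts X \<times> suffix_cuts Y)"
    proof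
      fix vs assume "vs \<in> cuts (X @ c # Y)"
      from cuts_pointedE[OF this assms] obtain us P Q ws where "vs = us @ (P @ c # Q) # ws"
        "(us, P) \<in> prefix_cuts X" "(Q, ws) \<in> suffix_cuts Y" .
      then show "vs \<in> ?j ` (prefix_cuts X \<times> suffix_cuts Y)"
        by (intro image_eqI[of _ _ "((us, P), (Q, ws))"]) auto
    qed
  qed (auto simp: prefix_cuts_def suffix_cuts_def cuts_def)
  finally show ?thesis by simp
qed

lemma sum_block_of_Cons:
  "(\<Sum>(a, V, b)\<in>block_of (x # xs). F a V b) =
    F [] x xs + (\<Sum>(a, V, b)\<in>block_of xs. F (x # a) V b)"
proof -
  have "block_of (x # xs) = insert ([], x, xs) ((\<lambda>(a, V, b). (x # a, V, b)) ` block_of xs)"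
  proof -
    have "(a, V, b) \<in> block_of (x # xs) \<longleftrightarrow>
        (a, V, b) \<in> insert ([], x, xs) ((\<lambda>(a, V, b). (x # a, V, b)) ` block_of xs)" for a V b
      by (cases a) (auto simp: block_of_def image_iff)
    then show ?thesis by auto
  qed
  moreover have "inj_on (\<lambda>(a, V, b). (x # a, V, b)) (block_of xs)"
    by (auto simp: inj_on_def)
  moreover have "([], x, xs) \<notin> (\<lambda>(a, V, b). (x # a, V, b)) ` block_of xs"
    by auto
  ultimately show ?thesis
    by (simp add: finite_block_of sum.reindex split_def)
qed

lemma sum_block_of_Nil: "(\<Sum>(a, V, b)\<in>block_of []. F a V b) = 0"
  by (rule sum.neutral) (auto simp: block_of_def)

lemma sum_block_of_append:
  "(\<Sum>(a, V, b)\<in>block_of (xs @ ys). F a V b) =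
    (\<Sum>(a, V, b)\<in>block_of xs. F a V (b @ ys)) + (\<Sum>(a, V, b)\<in>block_of ys. F (xs @ a) V b)"
  by (induction xs arbitrary: F) (simp_all add: sum_block_of_Cons sum_block_of_Nil add.assoc)

text \<open>This holds for any \<open>f\<close>, injective or not: a decomposition of a given list
  is determined by the lengths of its pieces, and these survive \<open>map\<close>.\<close>

lemma sum_splits3_map:
  "(\<Sum>(a, vs, b)\<in>splits3 (map f xs). F a vs b) =
    (\<Sum>(a, vs, b)\<in>splits3 xs. F (map f a) (map f vs) (map f b))"
proof -
  have "splits3 (map f xs) = (\<lambda>(a, vs, b). (map f a, map f vs, map f b)) ` splits3 xs"
    by (force simp: splits3_def append_eq_map_conv image_iff)
  moreover have "inj_on (\<lambda>(a, vs, b). (map f a, map f vs, map f b)) (splits3 xs)"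
    by (rule inj_onI) (auto simp: splits3_def append_eq_append_conv dest!: map_eq_imp_length_eq)
  ultimately show ?thesis
    by (simp add: sum.reindex split_def)
qed

lemma sum_splits2_map:
  "(\<Sum>(a, b)\<in>splits2 (map f xs). F a b) = (\<Sum>(a, b)\<in>splits2 xs. F (map f a) (map f b))"
proof -
  have "splits2 (map f xs) = (\<lambda>(a, b). (map f a, map f b)) ` splits2 xs"
    by (force simp: splits2_def append_eq_map_conv image_iff)
  moreover have "inj_on (\<lambda>(a, b). (map f a, map f b)) (splits2 xs)"
    by (rule inj_onI) (auto simp: splits2_def append_eq_append_conv dest!: map_eq_imp_length_eq)
  ultimately show ?thesis
    by (simp add: sum.reindex split_def)
qed

lemma cuts_map: "cuts (map f xs) = map (map f) ` cuts xs"
proof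
  show "cuts (map f xs) \<subseteq> map (map f) ` cuts xs"
  proof
    fix yss assume "yss \<in> cuts (map f xs)"
    then show "yss \<in> map (map f) ` cuts xs"
    proof (induction yss arbitrary: xs)
      case (Cons ys yss)
      then obtain us vs where xs: "xs = us @ vs" "ys = map f us" "concat yss = map f vs"
        by (auto simp: cuts_def append_eq_map_conv)
      then have "yss \<in> cuts (map f vs)" using Cons.prems by (simp add: cuts_def)
      then obtain zss where "zss \<in> cuts vs" "yss = map (map f) zss" using Cons.IH by auto
      with xs Cons.prems show ?case
        by (intro image_eqI[of _ _ "us # zss"]) (auto simp: cuts_def)
    qed (auto simp: cuts_def)
  qed
qed (auto simp: cuts_def map_concat)

lemma inj_on_map_map_cuts: "inj_on (map (map f)) (cuts xs)"
proof (rule inj_onI)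
  fix yss zss assume "yss \<in> cuts xs" "zss \<in> cuts xs" "map (map f) yss = map (map f) zss"
  then show "yss = zss"
  proof (induction yss arbitrary: xs zss)
    case (Cons ys yss)
    then obtain zs zss' where z: "zss = zs # zss'" "map f ys = map f zs"
        "map (map f) yss = map (map f) zss'"
      by auto
    with Cons.prems have "ys @ concat yss = zs @ concat zss'" "length ys = length zs"
      by (auto simp: cuts_def dest: map_eq_imp_length_eq)
    then have "ys = zs" "concat yss = concat zss'" by auto
    moreover have "yss = zss'"
      by (rule Cons.IH[of "concat yss"]) (use Cons.prems z \<open>concat yss = concat zss'\<close> in \<open>auto simp: cuts_def\<close>)
    ultimately show ?case using z by simp
  qed auto
qed

lemma sum_cuts_map: "(\<Sum>yss\<in>cuts (map f xs). F yss) = (\<Sum>yss\<in>cuts xs. F (map (map f) yss))"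
  unfolding cuts_map by (simp add: sum.reindex inj_on_map_map_cuts)

lemma sum_cuts2_map: "(\<Sum>yss\<in>cuts2 (map f xs). F yss) = (\<Sum>yss\<in>cuts2 xs. F (map (map f) yss))"
proof -
  have "cuts2 (map f xs) = map (map f) ` cuts2 xs"
    by (auto simp: cuts2_def cuts_map)
  moreover have "inj_on (map (map f)) (cuts2 xs)"
    by (rule inj_on_subset[OF inj_on_map_map_cuts]) (auto simp: cuts2_def)
  ultimately show ?thesis by (simp add: sum.reindex)
qed

lemma cuts_eq_insert: "J \<noteq> [] \<Longrightarrow> cuts J = insert [J] (cuts2 J)"
proof -
  assume "J \<noteq> []"
  have "yss = [J]" if "yss \<in> cuts J" "\<not> 2 \<le> length yss" for yss
    using that \<open>J \<noteq> []\<close> by (cases yss; cases "tl yss") (auto simp: cuts_def)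
  with \<open>J \<noteq> []\<close> show ?thesis by (auto simp: cuts2_def) (auto simp: cuts_def)
qed

lemma sum_cuts_insert:
  "J \<noteq> [] \<Longrightarrow> (\<Sum>yss\<in>cuts J. F yss) = F [J] + (\<Sum>yss\<in>cuts2 J. F yss)"
proof -
  assume "J \<noteq> []"
  then show ?thesis
    by (simp only: cuts_eq_insert[OF \<open>J \<noteq> []\<close>]) (subst sum.insert[OF finite_cuts2], auto simp: cuts2_def)
qed


section \<open>Additivity on homogeneous components\<close>

text \<open>The structure maps are given on homogeneous elements, so sums make sense only within one
  homogeneous component.\<close>

definition additive_on :: "'b set \<Rightarrow> ('b::ab_group_add \<Rightarrow> 'c::ab_group_add) \<Rightarrow> bool" where
  "additive_on S \<psi> \<longleftrightarrow> (\<forall>x\<in>S. \<forall>y\<in>S. \<psi> (x + y) = \<psi> x + \<psi> y)"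

lemma additive_on_ksign: "additive_on S \<psi> \<Longrightarrow> additive_on S (\<lambda>x. ksign e (\<psi> x))"
  by (simp add: additive_on_def ksign_add)

context graded_module
begin

lemmas G_zero = subspace_0[OF subspace_G]
  and G_add = subspace_add[OF subspace_G]
  and G_neg' = subspace_neg[OF subspace_G]
  and G_sum = subspace_sum[OF subspace_G]

lemma G_ksign: "x \<in> G d \<Longrightarrow> ksign e x \<in> G d"
  by (simp add: ksign_def G_neg')

lemma additive_on_zero: "additive_on (G d) \<psi> \<Longrightarrow> \<psi> 0 = 0"
  using G_zero[of d] unfolding additive_on_def by (metis add_cancel_right_right)

lemma additive_on_minus: "additive_on (G d) \<psi> \<Longrightarrow> x \<in> G d \<Longrightarrow> \<psi> (- x) = - \<psi> x"
  using additive_on_zero[of d \<psi>] G_neg'[of x d] unfolding additive_on_def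
  by (metis add.right_inverse add_eq_0_iff)

lemma additive_on_apply_ksign:
  "additive_on (G d) \<psi> \<Longrightarrow> x \<in> G d \<Longrightarrow> \<psi> (ksign e x) = ksign e (\<psi> x)"
  by (simp add: ksign_def additive_on_minus)

lemma additive_on_sum:
  assumes "additive_on (G d) \<psi>" "\<And>i. i \<in> S \<Longrightarrow> F i \<in> G d"
  shows "\<psi> (sum F S) = (\<Sum>i\<in>S. \<psi> (F i))"
  using assms(2)
proof (induction S rule: infinite_finite_induct)
  case (insert i S)
  then have "sum F S \<in> G d" "F i \<in> G d" by (auto intro: G_sum)
  with insert assms(1) show ?case by (simp add: additive_on_def)
qed (simp_all add: additive_on_zero[OF assms(1)])

end

lemma sdegs_append [simp]: "sdegs (xs @ ys) = sdegs xs + sdegs ys"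
  by (simp add: sdegs_def)

lemma sdegs_Cons [simp]: "sdegs (x # xs) = sdeg x + sdegs xs"
  by (simp add: sdegs_def)

lemma sdegs_Nil [simp]: "sdegs [] = 0"
  by (simp add: sdegs_def)

lemma sdegs_eq: "sdegs xs = sum_list (map fst xs) - int (length xs)"
  by (induction xs) (auto simp: sdeg_def)

lemma shifted_single [simp]: "shifted \<phi> [x] = \<phi> [x]"
  by (simp add: shifted_def shift_exp_def ksign_def)

context ainf_algebra
begin

lemma shifted_additive:
  assumes "us \<in> lists (homog G)" "ws \<in> lists (homog G)"
  shows "additive_on (G d) (\<lambda>x. shifted \<mu> (us @ (d, x) # ws))"
  using multilinear[OF assms]
  by (simp add: additive_on_def shifted_def homog_linear_def ksign_add)

lemma shifted_in_G:
  assumes "xs \<in> lists (homog G)" "xs \<noteq> []"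
  shows "shifted \<mu> xs \<in> G (sdegs xs + 2)"
  using degree[OF assms] unfolding shifted_def sdegs_eq by (intro G_ksign) (simp add: algebra_simps)

end

text \<open>Blocks are words in abstract indices, and \<open>w i\<close> is the shifted degree of
  the entry at \<open>i\<close>. An entry at the interval \<open>J\<close> then has shifted degree
  \<open>weight w J\<close> and lies in degree \<open>weight w J + 1\<close>.\<close>

definition weight :: "('i \<Rightarrow> int) \<Rightarrow> 'i list \<Rightarrow> int" where
  "weight w J = sum_list (map w J)"

lemma weight_simps [simp]:
  "weight w [] = 0" "weight w (x # xs) = w x + weight w xs"
  "weight w (xs @ ys) = weight w xs + weight w ys"
  by (simp_all add: weight_def)

definition el :: "('i \<Rightarrow> int) \<Rightarrow> ('i list \<Rightarrow> 'b) \<Rightarrow> 'i list \<Rightarrow> int \<times> 'b" where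
  "el w v J = (weight w J + 1, v J)"

lemma sdeg_el [simp]: "sdeg (el w v J) = weight w J"
  by (simp add: el_def sdeg_def)

lemma sdegs_map_el [simp]: "sdegs (map (el w v) bs) = weight w (concat bs)"
  by (induction bs) auto


section \<open>Gauge transformations supported at one interval\<close>

text \<open>The set of words is kept abstract, closed under nonempty factors, so that both linear
  orders are covered at once. Distinct letters ensure that a cut contains the block
  \<open>seg\<close> at most once. The generator \<open>z\<close> has one degree less than an entry
  at \<open>seg\<close>.\<close>

locale perturbation = ainf_algebra scale G \<nu>
  for scale :: "'r::comm_ring_1 \<Rightarrow> 'b::ab_group_add \<Rightarrow> 'b" and G and \<nu> +
  fixes w :: "'i \<Rightarrow> int" and Blocks :: "'i list set" and v :: "'i list \<Rightarrow> 'b"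
    and seg :: "'i list" and z :: 'b
  assumes v_deg: "J \<in> Blocks \<Longrightarrow> v J \<in> G (weight w J + 1)"
    and z_deg: "z \<in> G (weight w seg)"
    and seg_nonempty: "seg \<noteq> []"
    and Blocks_sub: "a @ J @ b \<in> Blocks \<Longrightarrow> J \<noteq> [] \<Longrightarrow> J \<in> Blocks"
    and Blocks_distinct: "J \<in> Blocks \<Longrightarrow> distinct J"
    and Blocks_nonempty: "[] \<notin> Blocks"
    and mc: "J \<in> Blocks \<Longrightarrow> (\<Sum>vs\<in>cuts J. shifted \<nu> (map (el w v) vs)) = 0"
begin

definition vz :: "'i list \<Rightarrow> int \<times> 'b" where
  "vz J = (if J = seg then (weight w seg, z) else el w v J)"

definition before :: "'i list list \<Rightarrow> int" where
  "before full = weight w (concat (takeWhile (\<lambda>b. b \<noteq> seg) full))"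

text \<open>
  The Koszul sign of an odd operator moved from the front of a word to the block \<open>seg\<close>; words not
  containing this block are discarded. With this sign the terms of the structure relations add up
  to the linear term \<open>Dz\<close> of the gauge transformation.
\<close>

definition mark :: "int \<Rightarrow> 'i list list \<Rightarrow> 'c::ab_group_add \<Rightarrow> 'c" where
  "mark e full x = (if seg \<in> set full then ksign (e + before full) x else 0)"

text \<open>The differential of \<open>z\<close> twisted by the Maurer--Cartan element
  \<open>v\<close>: the sum of \<open>\<nu> (v, ..., v, z, v, ..., v)\<close> over all positions of
  \<open>z\<close>, with the Koszul sign of the entries in front of it.\<close>

definition Dz :: "'i list \<Rightarrow> 'b" where
  "Dz V = (\<Sum>vs\<in>cuts V. mark 0 vs (shifted \<nu> (map vz vs)))"

definition v' :: "'i list \<Rightarrow> 'b" where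
  "v' J = v J + Dz J"

lemma cuts_Blocks: "vs \<in> cuts V \<Longrightarrow> V \<in> Blocks \<Longrightarrow> set vs \<subseteq> Blocks"
proof
  fix J assume "vs \<in> cuts V" "V \<in> Blocks" "J \<in> set vs"
  then obtain a b where "vs = a @ J # b" by (meson split_list)
  with \<open>vs \<in> cuts V\<close> have "V = concat a @ J @ concat b" "J \<noteq> []" by (auto simp: cuts_def)
  with \<open>V \<in> Blocks\<close> show "J \<in> Blocks" using Blocks_sub by metis
qed

lemma el_homog: "J \<in> Blocks \<Longrightarrow> el w v J \<in> homog G"
  using v_deg by (simp add: el_def homog_def)

lemma vz_homog: "J \<in> Blocks \<Longrightarrow> vz J \<in> homog G"
  using el_homog z_deg by (simp add: vz_def homog_def)

lemma map_el_homog: "set bs \<subseteq> Blocks \<Longrightarrow> map (el w v) bs \<in> lists (homog G)"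
  by (auto simp: in_lists_conv_set intro: el_homog)

lemma map_vz_homog: "set bs \<subseteq> Blocks \<Longrightarrow> map vz bs \<in> lists (homog G)"
  by (auto simp: in_lists_conv_set intro: vz_homog)

lemma map_vz_eq: "seg \<notin> set bs \<Longrightarrow> map vz bs = map (el w v) bs"
  by (induction bs) (auto simp: vz_def)

lemma seg_notin_disjoint:
  assumes "seg \<in> set bs" "set (concat bs) \<inter> set (concat cs) = {}"
  shows "seg \<notin> set cs"
proof
  assume "seg \<in> set cs"
  with assms(1) have "hd seg \<in> set (concat bs)" "hd seg \<in> set (concat cs)"
    using seg_nonempty by (auto intro!: bexI[of _ seg])
  with assms(2) show False by blast
qed

text \<open>As \<open>seg\<close> is nonempty and the letters are distinct, the block
  \<open>seg\<close> occurs at most once; the degree drops by one or not at all.\<close>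

lemma sdegs_map_vz:
  "distinct (concat bs) \<Longrightarrow>
   sdegs (map vz bs) = weight w (concat bs) - (if seg \<in> set bs then 1 else 0)"
proof (induction bs)
  case (Cons b bs)
  have "sdeg (vz b) = weight w b - (if b = seg then 1 else 0)"
    by (simp add: vz_def sdeg_def el_def)
  moreover have "seg \<notin> set bs" if "b = seg"
    using Cons.prems that seg_nonempty by (cases seg) auto
  ultimately show ?case using Cons by auto
qed simp

lemma before_append:
  "before (xs @ ys) = (if seg \<in> set xs then before xs else weight w (concat xs) + before ys)"
  unfolding before_def by (auto simp: takeWhile_append)

lemma cut_value_in_G:
  assumes "V \<in> Blocks" "vs \<in> cuts V"
  shows "shifted \<nu> (map vz vs) \<in> G (weight w V + 2 - (if seg \<in> set vs then 1 else 0))"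
proof -
  have "vs \<noteq> []" "concat vs = V" using assms Blocks_nonempty by (auto simp: cuts_def)
  moreover have "distinct (concat vs)" using assms Blocks_distinct by (auto simp: cuts_def)
  ultimately show ?thesis
    using shifted_in_G[OF map_vz_homog[OF cuts_Blocks[OF assms(2,1)]]] sdegs_map_vz[of vs]
    by (simp add: algebra_simps split: if_splits)
qed

lemma Dz_in_G:
  assumes "V \<in> Blocks"
  shows "Dz V \<in> G (weight w V + 1)"
  unfolding Dz_def
proof (rule G_sum)
  fix vs assume "vs \<in> cuts V"
  from cut_value_in_G[OF assms this] show "mark 0 vs (shifted \<nu> (map vz vs)) \<in> G (weight w V + 1)"
    by (auto simp: mark_def G_zero algebra_simps intro: G_ksign)
qed

lemma Dz_eq_0: "(\<And>a b. V \<noteq> a @ seg @ b) \<Longrightarrow> Dz V = 0"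
  unfolding Dz_def
proof (rule sum.neutral, rule ballI)
  fix vs assume no: "\<And>a b. V \<noteq> a @ seg @ b" and vs: "vs \<in> cuts V"
  have "seg \<notin> set vs"
  proof
    assume "seg \<in> set vs"
    then obtain a b where "vs = a @ seg # b" by (meson split_list)
    with vs no[of "concat a" "concat b"] show False by (auto simp: cuts_def)
  qed
  then show "mark 0 vs (shifted \<nu> (map vz vs)) = 0" by (simp add: mark_def)
qed

lemma Dz_eq_0_disjoint: "set seg \<inter> set V = {} \<Longrightarrow> Dz V = 0"
  by (rule Dz_eq_0) (use seg_nonempty in \<open>cases seg; auto\<close>)

lemma v'_in_G: "J \<in> Blocks \<Longrightarrow> v' J \<in> G (weight w J + 1)"
  by (simp add: v'_def v_deg Dz_in_G G_add)

text \<open>\<open>\<Psi>\<close> is the surrounding operation on entries in which \<open>z\<close>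
  may have been inserted, \<open>\<Phi>\<close> the one on the entries of \<open>v\<close>. If
  \<open>z\<close> sits in \<open>f1\<close> or \<open>f2\<close>, the inner sum is the
  Maurer--Cartan expression of \<open>V\<close> and vanishes, as does \<open>Dz V\<close>. Otherwise
  only cuts of \<open>V\<close> containing the block \<open>seg\<close> survive; the weight of
  \<open>f1\<close> occurs both in the sign of \<open>mark\<close> and in the Koszul factor and
  cancels, leaving the sign inside \<open>Dz V\<close>.\<close>

lemma block_sum:
  assumes V: "V \<in> Blocks" and dist: "distinct (concat f1 @ V @ concat f2)"
    and add: "\<And>d. additive_on (G d) (\<lambda>x. \<Psi> (d, x))" "\<And>d. additive_on (G d) (\<lambda>x. \<Phi> (d, x))"
    and eq: "seg \<notin> set f1 \<Longrightarrow> seg \<notin> set f2 \<Longrightarrow> \<Psi> = \<Phi>"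
  shows "(\<Sum>vs\<in>cuts V. mark e (f1 @ vs @ f2)
             (ksign (sdegs (map vz f1)) (\<Psi> (shifted_el 1 \<nu> (map vz vs))))) =
         ksign e (\<Phi> (weight w V + 1, Dz V))"
proof (cases "seg \<in> set f1 \<or> seg \<in> set f2")
  case True
  have notin: "seg \<notin> set vs" if "vs \<in> cuts V" for vs
    using that True dist seg_notin_disjoint[of f1 vs] seg_notin_disjoint[of f2 vs]
    by (auto simp: cuts_def)
  have "set seg \<inter> set V = {}" using True dist by auto
  then have "Dz V = 0" by (rule Dz_eq_0_disjoint)
  let ?e = "e + (if seg \<in> set f1 then before f1 else weight w (concat f1) + (weight w V + before f2)) +
     sdegs (map vz f1)"
  have "(\<Sum>vs\<in>cuts V. mark e (f1 @ vs @ f2)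
             (ksign (sdegs (map vz f1)) (\<Psi> (shifted_el 1 \<nu> (map vz vs))))) =
    (\<Sum>vs\<in>cuts V. ksign ?e (\<Psi> (weight w V + 2, shifted \<nu> (map (el w v) vs))))"
  proof (rule sum.cong[OF refl])
    fix vs assume vs: "vs \<in> cuts V"
    then have "concat vs = V" by (simp add: cuts_def)
    with notin[OF vs] show "mark e (f1 @ vs @ f2)
             (ksign (sdegs (map vz f1)) (\<Psi> (shifted_el 1 \<nu> (map vz vs)))) =
        ksign ?e (\<Psi> (weight w V + 2, shifted \<nu> (map (el w v) vs)))"
      using True by (auto simp: mark_def before_append map_vz_eq shifted_el_def ksign_ksign add.commute)
  qed
  also have "\<dots> = ksign ?e (\<Psi> (weight w V + 2, \<Sum>vs\<in>cuts V. shifted \<nu> (map (el w v) vs)))"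
  proof (subst additive_on_sum[OF add(1)])
    fix vs assume "vs \<in> cuts V"
    from cut_value_in_G[OF V this] notin[OF this]
    show "shifted \<nu> (map (el w v) vs) \<in> G (weight w V + 2)" by (simp add: map_vz_eq)
  qed (simp add: ksign_sum)
  also have "\<dots> = 0" by (simp add: mc[OF V] additive_on_zero[OF add(1)])
  also have "\<dots> = ksign e (\<Phi> (weight w V + 1, Dz V))"
    by (simp add: \<open>Dz V = 0\<close> additive_on_zero[OF add(2)])
  finally show ?thesis .
next
  case False
  then have "\<Psi> = \<Phi>" by (simp add: eq)
  have "ksign e (\<Phi> (weight w V + 1, Dz V)) =
    (\<Sum>vs\<in>cuts V. ksign e (\<Phi> (weight w V + 1, mark 0 vs (shifted \<nu> (map vz vs)))))"
    unfolding Dz_def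
  proof (subst additive_on_sum[OF add(2)])
    fix vs assume "vs \<in> cuts V"
    from cut_value_in_G[OF V this] show "mark 0 vs (shifted \<nu> (map vz vs)) \<in> G (weight w V + 1)"
      by (auto simp: mark_def G_zero algebra_simps intro: G_ksign)
  qed (simp add: ksign_sum)
  also have "\<dots> = (\<Sum>vs\<in>cuts V. mark e (f1 @ vs @ f2)
             (ksign (sdegs (map vz f1)) (\<Psi> (shifted_el 1 \<nu> (map vz vs)))))"
  proof (rule sum.cong[OF refl])
    fix vs assume vs: "vs \<in> cuts V"
    show "ksign e (\<Phi> (weight w V + 1, mark 0 vs (shifted \<nu> (map vz vs)))) =
      mark e (f1 @ vs @ f2) (ksign (sdegs (map vz f1)) (\<Psi> (shifted_el 1 \<nu> (map vz vs))))"
    proof (cases "seg \<in> set vs")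
      case True
      have "distinct (concat vs)" "concat vs = V" using vs V Blocks_distinct by (auto simp: cuts_def)
      then have "sdegs (map vz vs) = weight w V - 1" using True by (simp add: sdegs_map_vz)
      moreover have "shifted \<nu> (map vz vs) \<in> G (weight w V + 1)"
        using cut_value_in_G[OF V vs] True by (simp add: add.commute)
      moreover have "sdegs (map vz f1) = weight w (concat f1)"
        using False by (simp add: map_vz_eq)
      ultimately show ?thesis using True False
        by (simp add: \<open>\<Psi> = \<Phi>\<close> mark_def before_append shifted_el_def ksign_ksign
            additive_on_apply_ksign[OF add(2)]) (rule ksign_parity, simp)
    next
      case notin: False
      then show ?thesis using False by (simp add: mark_def additive_on_zero[OF add(2)])
    qed
  qed
  finally show ?thesis by simp
qed

text \<open>
  The expansion is exact: disjoint blocks cannot both contain \<open>seg\<close>, so at most one block of a word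
  changes.
\<close>

lemma variation:
  assumes dist: "distinct (concat full)" and full: "set full \<subseteq> Blocks"
    and add: "\<And>a V b. full = a @ V # b \<Longrightarrow>
      additive_on (G (weight w V + 1)) (\<lambda>x. F (map (el w v) a @ (weight w V + 1, x) # map (el w v) b))"
  shows "F (map (el w v') full) = F (map (el w v) full) +
    (\<Sum>(a, V, b)\<in>block_of full. F (map (el w v) a @ (weight w V + 1, Dz V) # map (el w v) b))"
proof (cases "\<exists>V\<in>set full. \<exists>a b. V = a @ seg @ b")
  case False
  then have D0: "Dz V = 0" if "V \<in> set full" for V
    using that by (auto intro!: Dz_eq_0)
  then have "map (el w v') full = map (el w v) full"
    by (simp add: v'_def el_def)
  moreover have "(\<Sum>(a, V, b)\<in>block_of full. F (map (el w v) a @ (weight w V + 1, Dz V) # map (el w v) b)) = 0"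
  proof (rule sum.neutral, clarify)
    fix a V b assume "(a, V, b) \<in> block_of full"
    then have f: "full = a @ V # b" by (simp add: block_of_def)
    with D0 have "Dz V = 0" by simp
    then show "F (map (el w v) a @ (weight w V + 1, Dz V) # map (el w v) b) = 0"
      using additive_on_zero[OF add[OF f]] by simp
  qed
  ultimately show ?thesis by (simp only: add_0_right)
next
  case True
  then obtain V c d where V: "V \<in> set full" "V = c @ seg @ d" by blast
  then obtain a b where f: "full = a @ V # b" by (meson split_list)
  have D0: "Dz W = 0" if "W \<in> set a \<union> set b" for W
  proof (rule Dz_eq_0_disjoint)
    show "set seg \<inter> set W = {}" using that dist V unfolding f by auto
  qed
  have map_eq: "map (el w v') a = map (el w v) a" "map (el w v') b = map (el w v) b"
    using D0 by (auto simp: v'_def el_def)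
  have "F (map (el w v') full) = F (map (el w v) a @ (weight w V + 1, v V + Dz V) # map (el w v) b)"
    by (simp add: f map_eq) (simp add: el_def v'_def)
  also have "\<dots> = F (map (el w v) full) + F (map (el w v) a @ (weight w V + 1, Dz V) # map (el w v) b)"
    using add[OF f] full v_deg[of V] Dz_in_G[of V] by (simp add: f additive_on_def el_def)
  also have "F (map (el w v) a @ (weight w V + 1, Dz V) # map (el w v) b) =
    (\<Sum>(a, V, b)\<in>{(a, V, b)}. F (map (el w v) a @ (weight w V + 1, Dz V) # map (el w v) b))"
    by simp
  also have "\<dots> = (\<Sum>(a, V, b)\<in>block_of full. F (map (el w v) a @ (weight w V + 1, Dz V) # map (el w v) b))"
  proof (rule sum.mono_neutral_left[OF finite_block_of])
    show "{(a, V, b)} \<subseteq> block_of full" by (simp add: f block_of_def)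
    show "\<forall>p\<in>block_of full - {(a, V, b)}. (case p of (a, V, b) \<Rightarrow>
        F (map (el w v) a @ (weight w V + 1, Dz V) # map (el w v) b)) = 0"
    proof
      fix p assume p: "p \<in> block_of full - {(a, V, b)}"
      obtain a' V' b' where p': "p = (a', V', b')" by (cases p)
      with p have ne': "(a', V', b') \<noteq> (a, V, b)" and "(a', V', b') \<in> block_of full" by auto
      then have f': "full = a' @ V' # b'" by (simp add: block_of_def)
      have "V' \<in> set a \<union> set b"
        using f f' ne' dist V seg_nonempty
        by (auto simp: append_eq_append_conv2 append_eq_Cons_conv Cons_eq_append_conv)
      then have "Dz V' = 0" by (rule D0)
      then show "(case p of (a, V, b) \<Rightarrow>
          F (map (el w v) a @ (weight w V + 1, Dz V) # map (el w v) b)) = 0"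
        using additive_on_zero[OF add[OF f']] by (simp add: p')
    qed
  qed
  finally show ?thesis .
qed

end

section \<open>Regrouping sums over the two words between the module letters\<close>

lemma sum_swap_triples:
  "(\<Sum>(a, b, c)\<in>X. \<Sum>(d, e, f)\<in>Y. F a b c d e f) =
   (\<Sum>(d, e, f)\<in>Y. \<Sum>(a, b, c)\<in>X. F a b c d e f)"
  unfolding split_def by (rule sum.swap)

lemma sum_swap_triple_pair:
  "(\<Sum>(a, b, c)\<in>X. \<Sum>(d, e)\<in>Y. F a b c d e) = (\<Sum>(d, e)\<in>Y. \<Sum>(a, b, c)\<in>X. F a b c d e)"
  unfolding split_def by (rule sum.swap)

lemma sum_swap_pairs:
  "(\<Sum>(a, b)\<in>X. \<Sum>(d, e)\<in>Y. F a b d e) = (\<Sum>(d, e)\<in>Y. \<Sum>(a, b)\<in>X. F a b d e)"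
  unfolding split_def by (rule sum.swap)

text \<open>The module letter \<open>c\<close> stands between \<open>L\<close> and \<open>R\<close>.
  The blocks next to it, with the ends absorbed by its own block, become cuts of \<open>Z\<close>
  and \<open>Z'\<close>, which are the arguments of an operation around \<open>c\<close>.\<close>

lemma sum_inner_cuts_middle:
  "(\<Sum>(X, uss, Y)\<in>inner_cuts L. \<Sum>(P, wss, Q)\<in>inner_cuts R.
      \<Sum>(us, vs)\<in>splits2 uss. \<Sum>(ws, zs)\<in>splits2 wss. F X us vs Y P ws zs Q) =
   (\<Sum>(X, us, Z)\<in>inner_cuts L. \<Sum>(Z', zs, Q)\<in>inner_cuts R.
      \<Sum>(vs, Y)\<in>prefix_cuts Z. \<Sum>(P, ws)\<in>suffix_cuts Z'. F X us vs Y P ws zs Q)"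
proof -
  have "(\<Sum>(X, uss, Y)\<in>inner_cuts L. \<Sum>(P, wss, Q)\<in>inner_cuts R.
      \<Sum>(us, vs)\<in>splits2 uss. \<Sum>(ws, zs)\<in>splits2 wss. F X us vs Y P ws zs Q) =
    (\<Sum>(X, uss, Y)\<in>inner_cuts L. \<Sum>(us, vs)\<in>splits2 uss.
      \<Sum>(P, wss, Q)\<in>inner_cuts R. \<Sum>(ws, zs)\<in>splits2 wss. F X us vs Y P ws zs Q)"
    by (simp only: sum_swap_triple_pair)
  also have "\<dots> = (\<Sum>(X, us, Z)\<in>inner_cuts L. \<Sum>(vs, Y)\<in>prefix_cuts Z.
      \<Sum>(Z', zs, Q)\<in>inner_cuts R. \<Sum>(P, ws)\<in>suffix_cuts Z'. F X us vs Y P ws zs Q)"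
    by (simp only: sum_inner_cuts_prefix[where J = L] sum_inner_cuts_suffix[where J = R])
  finally show ?thesis by (simp only: sum_swap_triple_pair)
qed

text \<open>On the cycle the other module letter stands behind \<open>R\<close> and in front of
  \<open>L\<close>, so here the outer ends are collected: the operation around it takes a final part
  of \<open>R\<close> and an initial part of \<open>L\<close>.\<close>

lemma sum_inner_cuts_outer:
  "(\<Sum>(X, uss, Y)\<in>inner_cuts L. \<Sum>(P, wss, Q)\<in>inner_cuts R.
      \<Sum>(us, vs)\<in>splits2 uss. \<Sum>(ws, zs)\<in>splits2 wss. F X us vs Y P ws zs Q) =
   (\<Sum>(Z, vs, Y)\<in>inner_cuts L. \<Sum>(P, ws, Z')\<in>inner_cuts R.
      \<Sum>(zs, Q)\<in>prefix_cuts Z'. \<Sum>(X, us)\<in>suffix_cuts Z. F X us vs Y P ws zs Q)"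
proof -
  have "(\<Sum>(X, uss, Y)\<in>inner_cuts L. \<Sum>(P, wss, Q)\<in>inner_cuts R.
      \<Sum>(us, vs)\<in>splits2 uss. \<Sum>(ws, zs)\<in>splits2 wss. F X us vs Y P ws zs Q) =
    (\<Sum>(X, uss, Y)\<in>inner_cuts L. \<Sum>(us, vs)\<in>splits2 uss.
      \<Sum>(P, wss, Q)\<in>inner_cuts R. \<Sum>(ws, zs)\<in>splits2 wss. F X us vs Y P ws zs Q)"
    by (simp only: sum_swap_triple_pair)
  also have "\<dots> = (\<Sum>(Z, vs, Y)\<in>inner_cuts L. \<Sum>(X, us)\<in>suffix_cuts Z.
      \<Sum>(P, ws, Z')\<in>inner_cuts R. \<Sum>(zs, Q)\<in>prefix_cuts Z'. F X us vs Y P ws zs Q)"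
    by (simp only: sum_inner_cuts_suffix[where J = L] sum_inner_cuts_prefix[where J = R])
  also have "\<dots> = (\<Sum>(Z, vs, Y)\<in>inner_cuts L. \<Sum>(P, ws, Z')\<in>inner_cuts R.
      \<Sum>(X, us)\<in>suffix_cuts Z. \<Sum>(zs, Q)\<in>prefix_cuts Z'. F X us vs Y P ws zs Q)"
    by (simp only: sum_swap_triple_pair)
  also have "\<dots> = (\<Sum>(Z, vs, Y)\<in>inner_cuts L. \<Sum>(P, ws, Z')\<in>inner_cuts R.
      \<Sum>(zs, Q)\<in>prefix_cuts Z'. \<Sum>(X, us)\<in>suffix_cuts Z. F X us vs Y P ws zs Q)"
    by (subst sum_swap_pairs) (rule refl)
  finally show ?thesis .
qed

context ainf_algebra
begin

lemma mu_mu: "x \<in> homog G \<Longrightarrow> \<mu> [(fst x + 1, \<mu> [x])] = 0"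
proof -
  assume "x \<in> homog G"
  moreover have "splits3 [x] = {([], [x], [])}"
    by (auto simp: splits3_def append_eq_Cons_conv)
  ultimately show ?thesis
    using relations[of "[x]"] by (simp add: shifted_el_def ksign_def sdeg_def add.commute)
qed

text \<open>Sum the structure relations over all cuts of \<open>J\<close> and group the terms by the
  merged interval \<open>V\<close>. For \<open>V\<close> other than \<open>J\<close> the inner sum
  is a Maurer--Cartan expression assumed to vanish. The terms with \<open>V = J\<close> form
  \<open>\<mu>\<close> of the staircase product plus the differential applied twice to
  \<open>v J\<close>.\<close>

lemma obstruction_closed:
  fixes w :: "'i \<Rightarrow> int" and v :: "'i list \<Rightarrow> 'a"
  assumes J: "J \<noteq> []" and v: "\<And>a V b. J = a @ V @ b \<Longrightarrow> V \<noteq> [] \<Longrightarrow> v V \<in> G (weight w V + 1)"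
    and mc: "\<And>a V b. J = a @ V @ b \<Longrightarrow> V \<noteq> [] \<Longrightarrow> V \<noteq> J \<Longrightarrow>
      (\<Sum>vs\<in>cuts V. shifted \<mu> (map (el w v) vs)) = 0"
  shows "\<mu> [(weight w J + 2, \<Sum>vs\<in>cuts2 J. shifted \<mu> (map (el w v) vs))] = 0"
proof -
  have el: "el w v V \<in> homog G" if "full \<in> cuts J" "V \<in> set full" for full V
  proof -
    obtain a b where "full = a @ V # b" using \<open>V \<in> set full\<close> by (meson split_list)
    with that have "J = concat a @ V @ concat b" "V \<noteq> []" by (auto simp: cuts_def)
    from v[OF this] show ?thesis by (simp add: el_def homog_def)
  qed
  have els: "map (el w v) vs \<in> lists (homog G)" if "full \<in> cuts J" "set vs \<subseteq> set full" for full vs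
    using el that by (auto simp: in_lists_conv_set)
  have val: "shifted \<mu> (map (el w v) vs) \<in> G (weight w V + 2)"
    if "J = a @ V @ b" "V \<noteq> []" "vs \<in> cuts V" for a V b vs
  proof -
    have "el w v U \<in> homog G" if "U \<in> set vs" for U
    proof -
      obtain c d where "vs = c @ U # d" using \<open>U \<in> set vs\<close> by (meson split_list)
      with \<open>J = a @ V @ b\<close> \<open>vs \<in> cuts V\<close> have "J = (a @ concat c) @ U @ (concat d @ b)" "U \<noteq> []"
        by (auto simp: cuts_def)
      from v[OF this] show ?thesis by (simp add: el_def homog_def)
    qed
    then have "map (el w v) vs \<in> lists (homog G)" by (auto simp: in_lists_conv_set)
    moreover have "vs \<noteq> []" using that by (auto simp: cuts_def)
    ultimately show ?thesis
      using shifted_in_G[of "map (el w v) vs"] that by (simp add: cuts_def)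
  qed
  let ?F = "\<lambda>a vs b. ksign (sdegs (map (el w v) a))
      (shifted \<mu> (map (el w v) a @ shifted_el 1 \<mu> (map (el w v) vs) # map (el w v) b))"
  have "0 = (\<Sum>full\<in>cuts J. \<Sum>(a, vs, b)\<in>splits3 full. ?F a vs b)"
  proof (rule sum.neutral[symmetric], rule ballI)
    fix full assume f: "full \<in> cuts J"
    then have "full \<noteq> []" using J by (auto simp: cuts_def)
    then show "(\<Sum>(a, vs, b)\<in>splits3 full. ?F a vs b) = 0"
      using relations[OF els[OF f order_refl]] by (simp add: sum_splits3_map)
  qed
  also have "\<dots> = (\<Sum>yss\<in>cuts J. \<Sum>(a, V, b)\<in>block_of yss. \<Sum>vs\<in>cuts V. ?F a vs b)"
    by (rule sum_cuts_splits3)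
  also have "\<dots> = (\<Sum>vs\<in>cuts J. ?F [] vs []) +
      (\<Sum>yss\<in>cuts2 J. \<Sum>(a, V, b)\<in>block_of yss. \<Sum>vs\<in>cuts V. ?F a vs b)"
    by (subst sum_cuts_insert[OF J])
      (simp only: sum_block_of_Cons sum_block_of_Nil add_0_right)
  also have "(\<Sum>yss\<in>cuts2 J. \<Sum>(a, V, b)\<in>block_of yss. \<Sum>vs\<in>cuts V. ?F a vs b) = 0"
  proof (rule sum.neutral, rule ballI, rule sum.neutral, clarify)
    fix yss a V b assume yss: "yss \<in> cuts2 J" and "(a, V, b) \<in> block_of yss"
    then have yss': "yss = a @ V # b" "yss \<in> cuts J" by (auto simp: block_of_def cuts2_def)
    then have JV: "J = concat a @ V @ concat b" "V \<noteq> []" by (auto simp: cuts_def)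
    moreover have "V \<noteq> J" using length_cuts2_less[OF yss, of V] yss' by auto
    ultimately have mc0: "(\<Sum>vs\<in>cuts V. shifted \<mu> (map (el w v) vs)) = 0" by (rule mc)
    let ?\<psi> = "\<lambda>x. ksign (sdegs (map (el w v) a))
      (shifted \<mu> (map (el w v) a @ (weight w V + 2, x) # map (el w v) b))"
    have add: "additive_on (G (weight w V + 2)) ?\<psi>"
      using els[OF yss'(2)] yss'(1) by (intro additive_on_ksign shifted_additive) auto
    have "(\<Sum>vs\<in>cuts V. ?F a vs b) = (\<Sum>vs\<in>cuts V. ?\<psi> (shifted \<mu> (map (el w v) vs)))"
      by (rule sum.cong) (simp_all add: shifted_el_def cuts_def add.commute)
    also have "\<dots> = ?\<psi> (\<Sum>vs\<in>cuts V. shifted \<mu> (map (el w v) vs))"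
      by (rule additive_on_sum[OF add, symmetric]) (rule val[OF JV])
    also have "\<dots> = 0" by (simp only: mc0 additive_on_zero[OF add])
    finally show "(\<Sum>vs\<in>cuts V. ?F a vs b) = 0" .
  qed
  also have "(\<Sum>vs\<in>cuts J. ?F [] vs []) =
      (\<Sum>vs\<in>cuts J. \<mu> [(weight w J + 2, shifted \<mu> (map (el w v) vs))])"
    by (rule sum.cong) (simp_all add: shifted_el_def cuts_def add.commute ksign_def)
  also have "\<dots> = \<mu> [(weight w J + 2, \<mu> [el w v J])] +
      (\<Sum>vs\<in>cuts2 J. \<mu> [(weight w J + 2, shifted \<mu> (map (el w v) vs))])"
    by (simp add: sum_cuts_insert[OF J])
  also have "\<mu> [(weight w J + 2, \<mu> [el w v J])] = 0"
    using mu_mu[of "el w v J"] v[of "[]" J "[]"] J by (simp add: el_def homog_def add.commute)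
  also have "(\<Sum>vs\<in>cuts2 J. \<mu> [(weight w J + 2, shifted \<mu> (map (el w v) vs))]) =
      \<mu> [(weight w J + 2, \<Sum>vs\<in>cuts2 J. shifted \<mu> (map (el w v) vs))]"
    by (rule additive_on_sum[symmetric], use shifted_additive[of "[]" "[]" "weight w J + 2"] in simp)
       (rule val[of "[]" J "[]"], use J in \<open>auto simp: cuts2_def\<close>)
  finally show ?thesis by simp
qed

end


section \<open>Invariance of the staircase inner product\<close>

text \<open>
  The first word \<open>L\<close>, the module letter \<open>c\<close>, the second word \<open>R\<close> and the module letter \<open>n\<close> form a cyclic
  word. The last argument of \<open>C\<close> is the block containing \<open>n\<close>; the beginning \<open>L1\<close> of \<open>L\<close> which it
  absorbs corresponds to the entries before \<open>p\<close> in the staircase inner product.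
\<close>

definition cyclic_value where
  "cyclic_value C w L c R n v =
    (\<Sum>(L1, uss, Lb)\<in>inner_cuts L. \<Sum>(Ra, wss, R2)\<in>inner_cuts R.
      ksign (weight w L1 * (weight w (L @ c # R @ [n]) - weight w L1))
        (C (map (el w v) uss) (el w v (Lb @ c # Ra)) (map (el w v) wss) (el w v (R2 @ n # L1))))"

text \<open>
  \<open>C_closed\<close> is the module morphism equation of an inner product, evaluated at \<open>m'\<close>. The right-hand
  side of that equation is the last sum, in which the degree of the inner product cancels.
\<close>

locale cyclic_form = ainf_algebra scale G \<nu>
  for scale :: "'r::comm_ring_1 \<Rightarrow> 'b::ab_group_add \<Rightarrow> 'b" and G and \<nu> +
  fixes C :: "(int \<times> 'b) list \<Rightarrow> int \<times> 'b \<Rightarrow> (int \<times> 'b) list \<Rightarrow> int \<times> 'b \<Rightarrow> 'r"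
  assumes C_additive1: "us \<in> lists (homog G) \<Longrightarrow> ws \<in> lists (homog G) \<Longrightarrow> m \<in> homog G \<Longrightarrow>
      bs \<in> lists (homog G) \<Longrightarrow> m' \<in> homog G \<Longrightarrow> additive_on (G d) (\<lambda>x. C (us @ (d, x) # ws) m bs m')"
    and C_additive2: "as \<in> lists (homog G) \<Longrightarrow> bs \<in> lists (homog G) \<Longrightarrow> m' \<in> homog G \<Longrightarrow>
      additive_on (G d) (\<lambda>x. C as (d, x) bs m')"
    and C_additive3: "as \<in> lists (homog G) \<Longrightarrow> m \<in> homog G \<Longrightarrow> us \<in> lists (homog G) \<Longrightarrow>
      ws \<in> lists (homog G) \<Longrightarrow> m' \<in> homog G \<Longrightarrow> additive_on (G d) (\<lambda>x. C as m (us @ (d, x) # ws) m')"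
    and C_additive4: "as \<in> lists (homog G) \<Longrightarrow> m \<in> homog G \<Longrightarrow> bs \<in> lists (homog G) \<Longrightarrow>
      additive_on (G d) (\<lambda>x. C as m bs (d, x))"
    and C_closed: "as \<in> lists (homog G) \<Longrightarrow> m \<in> homog G \<Longrightarrow> bs \<in> lists (homog G) \<Longrightarrow> m' \<in> homog G \<Longrightarrow>
      (\<Sum>(us, vs, ws)\<in>splits3 as.
         ksign (sdegs us) (C (us @ shifted_el 1 \<nu> vs # ws) m bs m')) +
      (\<Sum>(us, vs)\<in>splits2 as. \<Sum>(ws, zs)\<in>splits2 bs.
         ksign (sdegs us) (C us (shifted_el 1 \<nu> (vs @ m # ws)) zs m')) +
      (\<Sum>(us, vs, ws)\<in>splits3 bs.
         ksign (sdegs as + sdeg m + sdegs us) (C as m (us @ shifted_el 1 \<nu> vs # ws) m')) +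
      (\<Sum>(us, vs)\<in>splits2 as. \<Sum>(ws, zs)\<in>splits2 bs.
         ksign (sdegs us * (sdegs vs + sdeg m + sdegs bs + sdeg m') + sdegs vs + sdeg m + sdegs ws)
           (C vs m ws (shifted_el 1 \<nu> (zs @ m' # us)))) = 0"

context perturbation
begin

lemma before_seg: "seg \<notin> set xs \<Longrightarrow> before (xs @ seg # ys) = weight w (concat xs)"
  by (simp add: before_append) (simp add: before_def)

text \<open>
  Here the inner operation is applied to the last block of a cyclic word. This block contains the
  end of the linear word and continues at its beginning, whence the rotation sign changes from that
  of \<open>P\<close> to that of \<open>L1\<close>.
\<close>

lemma rotated_block_sum:
  assumes N: "R2 @ n # L1 \<in> Blocks" and dist: "distinct (concat g @ R2 @ n # L1)"
    and add: "\<And>d. additive_on (G d) (\<lambda>x. \<Psi> (d, x))" "\<And>d. additive_on (G d) (\<lambda>x. \<Phi> (d, x))"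
    and eq: "seg \<notin> set g \<Longrightarrow> \<Psi> = \<Phi>"
    and T: "T = weight w (concat g) + weight w (R2 @ n # L1)"
  shows "(\<Sum>(zs, Q)\<in>prefix_cuts R2. \<Sum>(P, us)\<in>suffix_cuts L1.
      mark (weight w P * (T - weight w P)) (us @ g @ zs @ [Q @ n # P])
        (ksign (sdegs (map vz us) * (sdegs (map vz (g @ zs)) + sdeg (vz (Q @ n # P))) + sdegs (map vz g))
          (\<Psi> (shifted_el 1 \<nu> (map vz (zs @ (Q @ n # P) # us)))))) =
    ksign (weight w L1 * (T - weight w L1)) (\<Phi> (weight w (R2 @ n # L1) + 1, Dz (R2 @ n # L1)))"
    (is "?lhs = _")
proof -
  let ?N = "R2 @ n # L1"
  have n: "n \<notin> set R2" "n \<notin> set L1" using dist by auto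
  have cut: "zs @ (Q @ n # P) # us \<in> cuts ?N"
      "distinct (concat us @ concat g @ concat zs @ Q @ n # P)"
      "weight w L1 = weight w P + weight w (concat us)"
      "weight w R2 = weight w (concat zs) + weight w Q"
    if "(zs, Q) \<in> prefix_cuts R2" "(P, us) \<in> suffix_cuts L1" for zs Q P us
  proof -
    have RL: "R2 = concat zs @ Q" "L1 = P @ concat us" "[] \<notin> set zs" "[] \<notin> set us"
      using that by (auto simp: prefix_cuts_def suffix_cuts_def)
    then show "zs @ (Q @ n # P) # us \<in> cuts ?N" by (simp add: cuts_def)
    show "weight w L1 = weight w P + weight w (concat us)"
      "weight w R2 = weight w (concat zs) + weight w Q"
      by (simp_all add: RL)
    show "distinct (concat us @ concat g @ concat zs @ Q @ n # P)"
      using dist unfolding RL distinct_append set_append list.set distinct.simps by blast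
  qed
  show ?thesis
  proof (cases "seg \<in> set g")
    case True
    have notin: "seg \<notin> set vs" if "vs \<in> cuts ?N" for vs
      using that True dist by (intro seg_notin_disjoint[of g vs]) (auto simp: cuts_def)
    have "set seg \<inter> set ?N = {}" using True dist by auto
    then have D0: "Dz ?N = 0" by (rule Dz_eq_0_disjoint)
    \<comment> \<open>Here \<open>z\<close> lies in \<open>g\<close>, whose shifted degree is one
      less than its weight; hence the \<open>- 1\<close>. Up to parity the total exponent is the
      same for all cuts of the last block, so their Maurer--Cartan sum can be formed.\<close>
    let ?e = "weight w L1 * (T - weight w L1) + before g + weight w (concat g) - 1"
    let ?\<psi> = "\<lambda>x. ksign ?e (\<Psi> (weight w ?N + 2, x))"
    have add': "additive_on (G (weight w ?N + 2)) ?\<psi>"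
      by (intro additive_on_ksign add)
    have "?lhs = (\<Sum>(zs, Q)\<in>prefix_cuts R2. \<Sum>(P, us)\<in>suffix_cuts L1.
        ?\<psi> (shifted \<nu> (map (el w v) (zs @ (Q @ n # P) # us))))"
    proof (intro sum.cong refl, clarify, intro sum.cong refl, clarify)
      fix zs Q P us assume mem: "(zs, Q) \<in> prefix_cuts R2" "(P, us) \<in> suffix_cuts L1"
      note c = cut[OF mem]
      have ni: "seg \<notin> set zs" "seg \<noteq> Q @ n # P" "seg \<notin> set us"
        using notin[OF c(1)] by auto
      have "distinct (concat g)" using dist by simp
      from sdegs_map_vz[OF this] True have dg: "sdegs (map vz g) = weight w (concat g) - 1" by simp
      show "mark (weight w P * (T - weight w P)) (us @ g @ zs @ [Q @ n # P])
        (ksign (sdegs (map vz us) * (sdegs (map vz (g @ zs)) + sdeg (vz (Q @ n # P))) + sdegs (map vz g))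
          (\<Psi> (shifted_el 1 \<nu> (map vz (zs @ (Q @ n # P) # us))))) =
        ?\<psi> (shifted \<nu> (map (el w v) (zs @ (Q @ n # P) # us)))"
      proof -
        have "shifted_el 1 \<nu> (map vz (zs @ (Q @ n # P) # us)) =
            (weight w ?N + 2, shifted \<nu> (map (el w v) (zs @ (Q @ n # P) # us)))"
          using ni by (simp add: shifted_el_def map_vz_eq vz_def c algebra_simps)
        moreover have "sdegs (map vz us) = weight w (concat us)" "sdegs (map vz zs) = weight w (concat zs)"
            "sdeg (vz (Q @ n # P)) = weight w Q + w n + weight w P"
          using ni by (simp_all add: map_vz_eq vz_def)
        moreover have "before (us @ g @ zs @ [Q @ n # P]) = weight w (concat us) + before g"
          using ni True by (simp add: before_append)
        ultimately show ?thesis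
          using True by (simp add: mark_def ksign_ksign dg)
            (rule ksign_parity, simp add: c T, argo)
      qed
    qed
    also have "\<dots> = (\<Sum>vs\<in>cuts ?N. ?\<psi> (shifted \<nu> (map (el w v) vs)))"
      by (simp only: sum_cuts_pointed[OF n])
    also have "\<dots> = ?\<psi> (\<Sum>vs\<in>cuts ?N. shifted \<nu> (map (el w v) vs))"
    proof (rule additive_on_sum[OF add', symmetric])
      fix vs assume "vs \<in> cuts ?N"
      from cut_value_in_G[OF N this] notin[OF this]
      show "shifted \<nu> (map (el w v) vs) \<in> G (weight w ?N + 2)" by (simp add: map_vz_eq)
    qed
    also have "\<dots> = 0" by (simp only: mc[OF N] additive_on_zero[OF add'])
    finally show ?thesis by (simp add: D0 additive_on_zero[OF add(2)])
  next
    case False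
    then have "\<Psi> = \<Phi>" by (rule eq)
    let ?e = "weight w L1 * (T - weight w L1)"
    let ?\<psi> = "\<lambda>x. ksign ?e (\<Phi> (weight w ?N + 1, x))"
    have add': "additive_on (G (weight w ?N + 1)) ?\<psi>"
      by (intro additive_on_ksign add)
    have "?\<psi> (Dz ?N) = (\<Sum>vs\<in>cuts ?N. ?\<psi> (mark 0 vs (shifted \<nu> (map vz vs))))"
      unfolding Dz_def
    proof (rule additive_on_sum[OF add'])
      fix vs assume "vs \<in> cuts ?N"
      from cut_value_in_G[OF N this] show "mark 0 vs (shifted \<nu> (map vz vs)) \<in> G (weight w ?N + 1)"
        by (auto simp: mark_def G_zero algebra_simps intro: G_ksign)
    qed
    also have "\<dots> = (\<Sum>(zs, Q)\<in>prefix_cuts R2. \<Sum>(P, us)\<in>suffix_cuts L1.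
        ?\<psi> (mark 0 (zs @ (Q @ n # P) # us) (shifted \<nu> (map vz (zs @ (Q @ n # P) # us)))))"
      by (simp only: sum_cuts_pointed[OF n])
    also have "\<dots> = ?lhs"
    proof (intro sum.cong refl, clarify, intro sum.cong refl, clarify)
      fix zs Q P us assume mem: "(zs, Q) \<in> prefix_cuts R2" "(P, us) \<in> suffix_cuts L1"
      note c = cut[OF mem]
      let ?b = "zs @ (Q @ n # P) # us"
      show "?\<psi> (mark 0 ?b (shifted \<nu> (map vz ?b))) =
        mark (weight w P * (T - weight w P)) (us @ g @ zs @ [Q @ n # P])
        (ksign (sdegs (map vz us) * (sdegs (map vz (g @ zs)) + sdeg (vz (Q @ n # P))) + sdegs (map vz g))
          (\<Psi> (shifted_el 1 \<nu> (map vz ?b))))"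
      proof (cases "seg \<in> set ?b")
        case notin: False
        then show ?thesis using False
          by (simp add: mark_def additive_on_zero[OF add(2)])
      next
        case True
        have db: "distinct (concat ?b)" "distinct (concat us)" "distinct (concat zs)" using c(2) by auto
        have "shifted \<nu> (map vz ?b) \<in> G (weight w ?N + 1)"
          using cut_value_in_G[OF N c(1)] True by (simp add: algebra_simps)
        note ks = additive_on_apply_ksign[OF add(2) this]
        have el: "shifted_el 1 \<nu> (map vz ?b) = (weight w ?N + 1, shifted \<nu> (map vz ?b))"
          using sdegs_map_vz[OF db(1)] True
          by (simp add: shifted_el_def c algebra_simps del: map_append list.map set_append sdegs_append sdegs_Cons list.set)
        have dg: "sdegs (map vz g) = weight w (concat g)" using False by (simp add: map_vz_eq)
        have "set (concat us) \<inter> set (concat (zs @ [Q @ n # P])) = {}" using c(2) by (simp; blast)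
        then have "seg \<notin> set zs \<and> seg \<noteq> Q @ n # P" if "seg \<in> set us"
          using seg_notin_disjoint[OF that, of "zs @ [Q @ n # P]"] by auto
        moreover have "seg \<noteq> Q @ n # P" if "seg \<in> set zs"
          using seg_notin_disjoint[OF that, of "[Q @ n # P]"] c(2) by auto
        \<comment> \<open>The block replaced by \<open>z\<close> was cut off from \<open>L1\<close>,
          was cut off from \<open>R2\<close>, or contains \<open>n\<close>. The linear word runs
          through \<open>us\<close>, \<open>g\<close>, \<open>zs\<close> and the block of
          \<open>n\<close>, whereas the inner operation sees \<open>zs\<close>, the block of
          \<open>n\<close> and \<open>us\<close>; in each case the two values of
          \<open>before\<close> differ by what the rotation sign accounts for.\<close>
        ultimately consider (us) "seg \<in> set us" "seg \<notin> set zs" "seg \<noteq> Q @ n # P"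
          | (zs) "seg \<notin> set us" "seg \<in> set zs" "seg \<noteq> Q @ n # P"
          | (N) "seg \<notin> set us" "seg \<notin> set zs" "seg = Q @ n # P"
          using True by auto
        note cases = this
        have lhs: "?\<psi> (mark 0 ?b (shifted \<nu> (map vz ?b))) =
            ksign (?e + before ?b) (\<Phi> (weight w ?N + 1, shifted \<nu> (map vz ?b)))"
          by (simp only: mark_def True if_True add_0 ks ksign_ksign)
        have full: "seg \<in> set (us @ g @ zs @ [Q @ n # P])" using True by auto
        have rhs: "mark (weight w P * (T - weight w P)) (us @ g @ zs @ [Q @ n # P])
            (ksign (sdegs (map vz us) * (sdegs (map vz (g @ zs)) + sdeg (vz (Q @ n # P))) + sdegs (map vz g))
              (\<Psi> (shifted_el 1 \<nu> (map vz ?b)))) =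
          ksign (weight w P * (T - weight w P) + before (us @ g @ zs @ [Q @ n # P]) +
              (sdegs (map vz us) * (sdegs (map vz (g @ zs)) + sdeg (vz (Q @ n # P))) + sdegs (map vz g)))
            (\<Phi> (weight w ?N + 1, shifted \<nu> (map vz ?b)))"
          by (simp only: mark_def full if_True ksign_ksign el \<open>\<Psi> = \<Phi>\<close>)
        from cases have "even (?e + before ?b) = even (weight w P * (T - weight w P) + before (us @ g @ zs @ [Q @ n # P]) +
              (sdegs (map vz us) * (sdegs (map vz (g @ zs)) + sdeg (vz (Q @ n # P))) + sdegs (map vz g)))"
        proof cases
          case us
          have "sdegs (map vz us) = weight w (concat us) - 1" "sdegs (map vz zs) = weight w (concat zs)"
            "sdeg (vz (Q @ n # P)) = weight w Q + w n + weight w P"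
            using us sdegs_map_vz[OF db(2)] by (simp_all add: map_vz_eq vz_def)
          moreover have "before (us @ g @ zs @ [Q @ n # P]) = before us"
            "before ?b = weight w (concat zs) + weight w Q + w n + weight w P + before us"
            using us by (simp_all add: before_append) (simp add: before_def)
          ultimately show ?thesis
            by (simp add: c T dg) argo
        next
          case zs
          have "sdegs (map vz us) = weight w (concat us)" "sdegs (map vz zs) = weight w (concat zs) - 1"
            "sdeg (vz (Q @ n # P)) = weight w Q + w n + weight w P"
            using zs sdegs_map_vz[OF db(3)] by (simp_all add: map_vz_eq vz_def)
          moreover have "before (us @ g @ zs @ [Q @ n # P]) = weight w (concat us) + weight w (concat g) + before zs"
            "before ?b = before zs"
            using zs False by (simp_all add: before_append)
          ultimately show ?thesis
            by (simp add: c T dg) argo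
        next
          case N
          have "sdegs (map vz us) = weight w (concat us)" "sdegs (map vz zs) = weight w (concat zs)"
            by (simp_all only: map_vz_eq[OF N(1)] map_vz_eq[OF N(2)] sdegs_map_el)
          moreover have "sdeg (vz (Q @ n # P)) = weight w Q + w n + weight w P - 1"
            unfolding N(3)[symmetric] by (simp add: vz_def sdeg_def) (simp add: N(3))
          moreover have "before (us @ g @ zs @ [Q @ n # P]) =
              weight w (concat us) + weight w (concat g) + weight w (concat zs)"
            "before ?b = weight w (concat zs)"
            using before_seg[of "us @ g @ zs" "[]"] before_seg[of zs us] N(1,2) False
            unfolding N(3)[symmetric] by simp_all
          ultimately show ?thesis
            by (simp add: c T dg) argo
        qed
        then show ?thesis unfolding lhs rhs by (rule ksign_parity)
      qed
    qed
    finally show ?thesis by simp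
  qed
qed

text \<open>The change of the Maurer--Cartan expression is linear in \<open>Dz\<close>. Expanding
  \<open>Dz\<close> gives nested operations on words with \<open>z\<close> inserted once; grouped by
  the underlying fine cut, these are the structure relations for such words.\<close>

lemma mc_v':
  assumes J: "J \<in> Blocks"
  shows "(\<Sum>vs\<in>cuts J. shifted \<nu> (map (el w v') vs)) = 0"
proof -
  have ne: "J \<noteq> []" using J Blocks_nonempty by auto
  let ?F = "\<lambda>a vs b. mark 0 (a @ vs @ b) (ksign (sdegs (map vz a))
      (shifted \<nu> (map vz a @ shifted_el 1 \<nu> (map vz vs) # map vz b)))"
  have "(\<Sum>vs\<in>cuts J. shifted \<nu> (map (el w v') vs)) =
     (\<Sum>full\<in>cuts J. shifted \<nu> (map (el w v) full) + (\<Sum>(a, V, b)\<in>block_of full.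
       shifted \<nu> (map (el w v) a @ (weight w V + 1, Dz V) # map (el w v) b)))"
  proof (rule sum.cong[OF refl], rule variation)
    fix full assume f: "full \<in> cuts J"
    then show "distinct (concat full)" using Blocks_distinct[OF J] by (simp add: cuts_def)
    show full: "set full \<subseteq> Blocks" by (rule cuts_Blocks[OF f J])
    fix a V b assume "full = a @ V # b"
    with full show "additive_on (G (weight w V + 1))
        (\<lambda>x. shifted \<nu> (map (el w v) a @ (weight w V + 1, x) # map (el w v) b))"
      by (intro shifted_additive map_el_homog) auto
  qed
  also have "\<dots> = (\<Sum>full\<in>cuts J. \<Sum>(a, V, b)\<in>block_of full.
       shifted \<nu> (map (el w v) a @ (weight w V + 1, Dz V) # map (el w v) b))"
    by (simp add: sum.distrib mc[OF J])
  also have "\<dots> = (\<Sum>full\<in>cuts J. \<Sum>(a, V, b)\<in>block_of full. \<Sum>vs\<in>cuts V. ?F a vs b)"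
  proof (intro sum.cong refl, clarify)
    fix full a V b assume f: "full \<in> cuts J" and "(a, V, b) \<in> block_of full"
    then have full: "full = a @ V # b" by (simp add: block_of_def)
    have bl: "set full \<subseteq> Blocks" by (rule cuts_Blocks[OF f J])
    have "(\<Sum>vs\<in>cuts V. mark 0 (a @ vs @ b) (ksign (sdegs (map vz a))
        ((\<lambda>e. shifted \<nu> (map vz a @ e # map vz b)) (shifted_el 1 \<nu> (map vz vs))))) =
      ksign 0 ((\<lambda>e. shifted \<nu> (map (el w v) a @ e # map (el w v) b)) (weight w V + 1, Dz V))"
    proof (rule block_sum)
      show "V \<in> Blocks" using bl full by simp
      show "distinct (concat a @ V @ concat b)"
        using Blocks_distinct[OF J] f full by (simp add: cuts_def)
    qed (use bl full in \<open>auto intro!: shifted_additive map_el_homog map_vz_homog simp: map_vz_eq\<close>)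
    then show "shifted \<nu> (map (el w v) a @ (weight w V + 1, Dz V) # map (el w v) b) =
        (\<Sum>vs\<in>cuts V. ?F a vs b)" by (simp add: ksign_def)
  qed
  also have "\<dots> = (\<Sum>full\<in>cuts J. \<Sum>(a, vs, b)\<in>splits3 full. ?F a vs b)"
    by (rule sum_cuts_splits3[symmetric])
  also have "\<dots> = 0"
  proof (rule sum.neutral, rule ballI)
    fix full assume f: "full \<in> cuts J"
    have "(\<Sum>(a, vs, b)\<in>splits3 full. ?F a vs b) =
      mark 0 full (\<Sum>(a, vs, b)\<in>splits3 (map vz full).
         ksign (sdegs a) (shifted \<nu> (a @ shifted_el 1 \<nu> vs # b)))"
      unfolding sum_splits3_map
      by (auto simp: mark_def ksign_sum splits3_def intro!: sum.cong sum.neutral)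
    also have "\<dots> = 0"
    proof -
      have "full \<noteq> []" using f ne by (auto simp: cuts_def)
      then show ?thesis
      by (subst relations[OF map_vz_homog[OF cuts_Blocks[OF f J]]]) (simp_all add: mark_def)
    qed
    finally show "(\<Sum>(a, vs, b)\<in>splits3 full. ?F a vs b) = 0" .
  qed
  finally show ?thesis .
qed

end

lemma append_Cons_eq_append_cases:
  assumes "a @ V # b = xs @ ys"
  obtains b' where "xs = a @ V # b'" "b = b' @ ys" | a' where "ys = a' @ V # b" "a = xs @ a'"
proof -
  from assms obtain us where "a = xs @ us \<and> us @ V # b = ys \<or> a @ us = xs \<and> V # b = us @ ys"
    by (auto simp: append_eq_append_conv2)
  with that show thesis by (cases us) auto
qed

text \<open>The block of \<open>n\<close> runs across the end of the word and is an interval of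
  \<open>R @ n # L\<close>; all other blocks are intervals of \<open>L @ c # R\<close>.\<close>

lemma inner_cuts_Blocks:
  assumes closed: "\<forall>a J b. a @ J @ b \<in> Blocks \<longrightarrow> J \<noteq> [] \<longrightarrow> J \<in> Blocks"
    and word_Blocks: "L @ c # R \<in> Blocks" "R @ n # L \<in> Blocks"
    and L: "(L1, uss, Lb) \<in> inner_cuts L" and R: "(Ra, wss, R2) \<in> inner_cuts R"
  shows "set uss \<subseteq> Blocks" "Lb @ c # Ra \<in> Blocks" "set wss \<subseteq> Blocks" "R2 @ n # L1 \<in> Blocks"
proof -
  have eq: "L = L1 @ concat uss @ Lb" "R = Ra @ concat wss @ R2" "[] \<notin> set uss" "[] \<notin> set wss"
    using L R by (auto simp: inner_cuts_def)
  show "set uss \<subseteq> Blocks"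
  proof
    fix u assume "u \<in> set uss"
    then obtain a b where "uss = a @ u # b" by (meson split_list)
    then have "L @ c # R = (L1 @ concat a) @ u @ (concat b @ Lb @ c # R)" "u \<noteq> []"
      using eq by auto
    then show "u \<in> Blocks" using word_Blocks(1) closed by metis
  qed
  show "set wss \<subseteq> Blocks"
  proof
    fix u assume "u \<in> set wss"
    then obtain a b where "wss = a @ u # b" by (meson split_list)
    then have "L @ c # R = (L @ c # Ra @ concat a) @ u @ (concat b @ R2)" "u \<noteq> []"
      using eq by auto
    then show "u \<in> Blocks" using word_Blocks(1) closed by metis
  qed
  have "L @ c # R = (L1 @ concat uss) @ (Lb @ c # Ra) @ (concat wss @ R2)" by (simp add: eq)
  then show "Lb @ c # Ra \<in> Blocks" using word_Blocks(1) closed by (metis append_is_Nil_conv list.distinct(1))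
  have "R @ n # L = (Ra @ concat wss) @ (R2 @ n # L1) @ (concat uss @ Lb)" by (simp add: eq)
  then show "R2 @ n # L1 \<in> Blocks" using word_Blocks(2) closed by (metis append_is_Nil_conv list.distinct(1))
qed

locale cyclic_perturbation = perturbation scale G \<nu> w Blocks v seg z + cyclic_form scale G \<nu> C
  for scale :: "'r::comm_ring_1 \<Rightarrow> 'b::ab_group_add \<Rightarrow> 'b" and G and \<nu>
    and w :: "'i \<Rightarrow> int" and Blocks v seg z C +
  fixes L :: "'i list" and c :: 'i and R :: "'i list" and n :: 'i
  assumes distinct_word: "distinct (L @ c # R @ [n])"
    and word_Blocks: "L @ c # R \<in> Blocks" "R @ n # L \<in> Blocks"
begin

abbreviation "E \<equiv> el w v"

definition D :: "'i list \<Rightarrow> int \<times> 'b" where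
  "D V = (weight w V + 1, Dz V)"

abbreviation "rot L1 \<equiv> weight w L1 * (weight w (L @ c # R @ [n]) - weight w L1)"

lemma vz_eq: "J \<noteq> seg \<Longrightarrow> vz J = E J"
  by (simp add: vz_def)

lemma word_facts:
  assumes L: "(L1, uss, Lb) \<in> inner_cuts L" and R: "(Ra, wss, R2) \<in> inner_cuts R"
  shows "set uss \<subseteq> Blocks" "Lb @ c # Ra \<in> Blocks" "set wss \<subseteq> Blocks" "R2 @ n # L1 \<in> Blocks"
    "distinct (concat (uss @ (Lb @ c # Ra) # wss @ [R2 @ n # L1]))"
    "weight w (L @ c # R @ [n]) = weight w (concat (uss @ (Lb @ c # Ra) # wss)) + weight w (R2 @ n # L1)"
proof -
  have eq: "L = L1 @ concat uss @ Lb" "R = Ra @ concat wss @ R2"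
    using L R by (auto simp: inner_cuts_def)
  have "\<forall>a J b. a @ J @ b \<in> Blocks \<longrightarrow> J \<noteq> [] \<longrightarrow> J \<in> Blocks" using Blocks_sub by blast
  from inner_cuts_Blocks[OF this word_Blocks L R]
  show "set uss \<subseteq> Blocks" "Lb @ c # Ra \<in> Blocks" "set wss \<subseteq> Blocks" "R2 @ n # L1 \<in> Blocks"
    by blast+
  show "distinct (concat (uss @ (Lb @ c # Ra) # wss @ [R2 @ n # L1]))"
  proof -
    have "mset (concat (uss @ (Lb @ c # Ra) # wss @ [R2 @ n # L1])) = mset (L @ c # R @ [n])"
      by (simp add: eq)
    from mset_eq_imp_distinct_iff[OF this] show ?thesis using distinct_word by simp
  qed
  show "weight w (L @ c # R @ [n]) = weight w (concat (uss @ (Lb @ c # Ra) # wss)) + weight w (R2 @ n # L1)"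
    by (simp add: eq)
qed

lemma cyclic_variation:
  assumes L: "(L1, uss, Lb) \<in> inner_cuts L" and R: "(Ra, wss, R2) \<in> inner_cuts R"
  defines "M \<equiv> Lb @ c # Ra" and "N \<equiv> R2 @ n # L1"
  shows "C (map (el w v') uss) (el w v' M) (map (el w v') wss) (el w v' N) =
    C (map E uss) (E M) (map E wss) (E N) +
    ((\<Sum>(a, V, b)\<in>block_of uss. C (map E a @ D V # map E b) (E M) (map E wss) (E N)) +
     C (map E uss) (D M) (map E wss) (E N) +
     (\<Sum>(a, V, b)\<in>block_of wss. C (map E uss) (E M) (map E a @ D V # map E b) (E N)) +
     C (map E uss) (E M) (map E wss) (D N))"
proof -
  note facts = word_facts[OF L R, folded M_def N_def]
  let ?p = "length uss" and ?q = "length wss"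
  \<comment> \<open>\<open>variation\<close> speaks of a function of one list. \<open>?F\<close>
    reads a list with \<open>?p + ?q + 2\<close> entries as the four arguments of \<open>C\<close>,
    the module arguments having fixed positions.\<close>
  let ?F = "\<lambda>l. C (take ?p l) (l ! ?p) (take ?q (drop (Suc ?p) l)) (l ! (Suc ?p + ?q))"
  have hom: "map E uss \<in> lists (homog G)" "E M \<in> homog G" "map E wss \<in> lists (homog G)" "E N \<in> homog G"
    using facts map_el_homog el_homog by blast+
  have F: "?F (xs @ m # ys @ [m']) = C xs m ys m'" if "length xs = ?p" "length ys = ?q" for xs m ys m'
    using that by (simp add: nth_append)
  have "?F (map (el w v') (uss @ M # wss @ [N])) = ?F (map E (uss @ M # wss @ [N])) +
    (\<Sum>(a, V, b)\<in>block_of (uss @ M # wss @ [N]). ?F (map E a @ (weight w V + 1, Dz V) # map E b))"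
  proof (rule variation)
    show "distinct (concat (uss @ M # wss @ [N]))" by (rule facts)
    show "set (uss @ M # wss @ [N]) \<subseteq> Blocks" using facts by simp
    fix a V b assume eq: "uss @ M # wss @ [N] = a @ V # b"
    then consider b1 where "uss = a @ V # b1" "b = b1 @ M # wss @ [N]"
      | "a = uss" "V = M" "b = wss @ [N]"
      | a1 b1 where "wss = a1 @ V # b1" "a = uss @ M # a1" "b = b1 @ [N]"
      | "a = uss @ M # wss" "V = N" "b = []"
    proof (cases rule: append_Cons_eq_append_cases[OF eq[symmetric]])
      case (2 a')
      note a' = this
      show ?thesis
      proof (cases a')
        case Nil
        with a' show ?thesis using that(2) by simp
      next
        case (Cons m a2)
        with a' have "a2 @ V # b = wss @ [N]" "a = uss @ M # a2" by auto
        then show ?thesis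
          by (cases rule: append_Cons_eq_append_cases) (auto intro: that(3,4) simp: append_eq_Cons_conv Cons_eq_append_conv)
      qed
    qed (rule that(1))
    then show "additive_on (G (weight w V + 1)) (\<lambda>x. ?F (map E a @ (weight w V + 1, x) # map E b))"
    proof cases
      case 1
      then have "?F (map E a @ (d, x) # map E b) = C (map E a @ (d, x) # map E b1) (E M) (map E wss) (E N)"
        for d x using F[of "map E a @ (d, x) # map E b1" "map E wss"] by simp
      then show ?thesis using hom 1 by (auto intro!: C_additive1)
    next
      case 2
      then have "?F (map E a @ (d, x) # map E b) = C (map E uss) (d, x) (map E wss) (E N)"
        for d x using F[of "map E uss" "map E wss"] by simp
      then show ?thesis using hom 2 by (auto intro!: C_additive2)
    next
      case 3
      then have "?F (map E a @ (d, x) # map E b) = C (map E uss) (E M) (map E a1 @ (d, x) # map E b1) (E N)"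
        for d x using F[of "map E uss" "map E a1 @ (d, x) # map E b1" "E M" "E N"] by simp
      then show ?thesis using hom 3 by (auto intro!: C_additive3)
    next
      case 4
      then have "?F (map E a @ (d, x) # map E b) = C (map E uss) (E M) (map E wss) (d, x)"
        for d x using F[of "map E uss" "map E wss"] by simp
      then show ?thesis using hom 4 by (auto intro!: C_additive4)
    qed
  qed
  also have "(\<Sum>(a, V, b)\<in>block_of (uss @ M # wss @ [N]). ?F (map E a @ (weight w V + 1, Dz V) # map E b)) =
     (\<Sum>(a, V, b)\<in>block_of uss. C (map E a @ D V # map E b) (E M) (map E wss) (E N)) +
     C (map E uss) (D M) (map E wss) (E N) +
     (\<Sum>(a, V, b)\<in>block_of wss. C (map E uss) (E M) (map E a @ D V # map E b) (E N)) +
     C (map E uss) (E M) (map E wss) (D N)"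
  proof -
    have "(\<Sum>(a, V, b)\<in>block_of (uss @ M # wss @ [N]). ?F (map E a @ (weight w V + 1, Dz V) # map E b)) =
     (\<Sum>(a, V, b)\<in>block_of uss. ?F (map E a @ D V # map E (b @ M # wss @ [N]))) +
     (?F (map E (uss @ []) @ D M # map E (wss @ [N])) +
     ((\<Sum>(a, V, b)\<in>block_of wss. ?F (map E (uss @ M # a) @ D V # map E (b @ [N]))) +
     (?F (map E (uss @ M # wss @ []) @ D N # map E []) + 0)))"
      by (simp only: sum_block_of_append sum_block_of_Cons sum_block_of_Nil D_def)
    also have "(\<Sum>(a, V, b)\<in>block_of uss. ?F (map E a @ D V # map E (b @ M # wss @ [N]))) =
      (\<Sum>(a, V, b)\<in>block_of uss. C (map E a @ D V # map E b) (E M) (map E wss) (E N))"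
    proof (rule sum.cong[OF refl], clarify)
      fix a V b assume "(a, V, b) \<in> block_of uss"
      then have "length (map E a @ D V # map E b) = ?p" by (auto simp: block_of_def)
      from F[OF this, of "map E wss"]
      show "?F (map E a @ D V # map E (b @ M # wss @ [N])) = C (map E a @ D V # map E b) (E M) (map E wss) (E N)"
        by simp
    qed
    also have "(\<Sum>(a, V, b)\<in>block_of wss. ?F (map E (uss @ M # a) @ D V # map E (b @ [N]))) =
      (\<Sum>(a, V, b)\<in>block_of wss. C (map E uss) (E M) (map E a @ D V # map E b) (E N))"
    proof (rule sum.cong[OF refl], clarify)
      fix a V b assume "(a, V, b) \<in> block_of wss"
      then have "length (map E a @ D V # map E b) = ?q" by (auto simp: block_of_def)
      from F[OF _ this, of "map E uss"]
      show "?F (map E (uss @ M # a) @ D V # map E (b @ [N])) = C (map E uss) (E M) (map E a @ D V # map E b) (E N)"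
        by simp
    qed
    also have "?F (map E (uss @ []) @ D M # map E (wss @ [N])) = C (map E uss) (D M) (map E wss) (E N)"
      using F[of "map E uss" "map E wss" "D M" "E N"] by simp
    also have "?F (map E (uss @ M # wss @ []) @ D N # map E []) = C (map E uss) (E M) (map E wss) (D N)"
      using F[of "map E uss" "map E wss" "E M" "D N"] by simp
    finally show ?thesis by (simp add: add.assoc)
  qed
  also have "?F (map (el w v') (uss @ M # wss @ [N])) =
      C (map (el w v') uss) (el w v' M) (map (el w v') wss) (el w v' N)"
    using F[of "map (el w v') uss" "map (el w v') wss"] by simp
  also have "?F (map E (uss @ M # wss @ [N])) = C (map E uss) (E M) (map E wss) (E N)"
    using F[of "map E uss" "map E wss"] by simp
  finally show ?thesis .
qed

text \<open>This is \<open>C_closed\<close> for the entries \<open>vz\<close>, multiplied by the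
  sign of \<open>mark\<close>. However its blocks are grouped into arguments, the marked word is the
  same in all four sums, so the factor can be taken out.\<close>

lemma closed_at:
  assumes L: "(L1, uss, Lb) \<in> inner_cuts L" and R: "(Ra, wss, R2) \<in> inner_cuts R"
  defines "M \<equiv> Lb @ c # Ra" and "N \<equiv> R2 @ n # L1"
  shows "(\<Sum>(a, vs, b)\<in>splits3 uss. mark (rot L1) (a @ vs @ b @ M # wss @ [N])
      (ksign (sdegs (map vz a))
        (C (map vz a @ shifted_el 1 \<nu> (map vz vs) # map vz b) (vz M) (map vz wss) (vz N)))) +
    (\<Sum>(us, vs)\<in>splits2 uss. \<Sum>(ws, zs)\<in>splits2 wss. mark (rot L1) (us @ (vs @ M # ws) @ zs @ [N])
      (ksign (sdegs (map vz us))
        (C (map vz us) (shifted_el 1 \<nu> (map vz (vs @ M # ws))) (map vz zs) (vz N)))) +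
    (\<Sum>(a, vs, b)\<in>splits3 wss. mark (rot L1) ((uss @ M # a) @ vs @ b @ [N])
      (ksign (sdegs (map vz (uss @ M # a)))
        (C (map vz uss) (vz M) (map vz a @ shifted_el 1 \<nu> (map vz vs) # map vz b) (vz N)))) +
    (\<Sum>(us, vs)\<in>splits2 uss. \<Sum>(ws, zs)\<in>splits2 wss. mark (rot L1) (us @ (vs @ M # ws) @ zs @ [N])
      (ksign (sdegs (map vz us) * (sdegs (map vz ((vs @ M # ws) @ zs)) + sdeg (vz N)) +
          sdegs (map vz (vs @ M # ws)))
        (C (map vz vs) (vz M) (map vz ws) (shifted_el 1 \<nu> (map vz (zs @ N # us)))))) = 0"
    (is "?S1 + ?S2 + ?S3 + ?S4 = 0")
proof -
  note facts = word_facts[OF L R, folded M_def N_def]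
  let ?mk = "mark (rot L1) (uss @ M # wss @ [N]) :: 'r \<Rightarrow> 'r"
  have mk_sum: "?mk (sum F S) = (\<Sum>x\<in>S. ?mk (F x))" for F and S :: "'x set"
    by (simp add: mark_def ksign_sum)
  have mk_add: "?mk (x + y) = ?mk x + ?mk y" for x y
    by (simp add: mark_def ksign_add)
  have "?S1 = ?mk (\<Sum>(us, vs, ws)\<in>splits3 (map vz uss).
         ksign (sdegs us) (C (us @ shifted_el 1 \<nu> vs # ws) (vz M) (map vz wss) (vz N)))"
    unfolding sum_splits3_map mk_sum by (rule sum.cong) (auto simp: splits3_def)
  moreover have "?S2 = ?mk (\<Sum>(us, vs)\<in>splits2 (map vz uss). \<Sum>(ws, zs)\<in>splits2 (map vz wss).
         ksign (sdegs us) (C us (shifted_el 1 \<nu> (vs @ vz M # ws)) zs (vz N)))"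
    unfolding sum_splits2_map unfolding split_def mk_sum
    by (intro sum.cong refl) (auto simp: splits2_def)
  moreover have "?S3 = ?mk (\<Sum>(us, vs, ws)\<in>splits3 (map vz wss).
         ksign (sdegs (map vz uss) + sdeg (vz M) + sdegs us)
           (C (map vz uss) (vz M) (us @ shifted_el 1 \<nu> vs # ws) (vz N)))"
    unfolding sum_splits3_map mk_sum by (rule sum.cong) (auto simp: splits3_def add.assoc)
  moreover have "?S4 = ?mk (\<Sum>(us, vs)\<in>splits2 (map vz uss). \<Sum>(ws, zs)\<in>splits2 (map vz wss).
         ksign (sdegs us * (sdegs vs + sdeg (vz M) + sdegs (map vz wss) + sdeg (vz N)) +
             sdegs vs + sdeg (vz M) + sdegs ws)
           (C vs (vz M) ws (shifted_el 1 \<nu> (zs @ vz N # us))))"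
    unfolding sum_splits2_map unfolding split_def mk_sum
    by (intro sum.cong refl) (auto simp: splits2_def add.assoc)
  ultimately have "?S1 + ?S2 + ?S3 + ?S4 = ?mk 0"
    by (simp only: mk_add[symmetric] C_closed[OF map_vz_homog[OF facts(1)] vz_homog[OF facts(2)]
          map_vz_homog[OF facts(3)] vz_homog[OF facts(4)]])
  then show ?thesis by (simp add: mark_def)
qed

text \<open>The change of the value splits by the argument in which \<open>Dz\<close> appears: a
  block left of \<open>c\<close>, the block of \<open>c\<close>, a block right of it, or the block
  of \<open>n\<close>. These are matched with the four sums of \<open>closed_at\<close>, taken over
  all cuts of the cyclic word: an operation applied to a run of blocks is summed over all cuts of
  the merged block.\<close>

theorem cyclic_value_perturbation: "cyclic_value C w L c R n v' = cyclic_value C w L c R n v"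
proof -
  let ?M = "\<lambda>Lb Ra. Lb @ c # Ra" and ?N = "\<lambda>R2 L1. R2 @ n # L1"
  let ?v = "\<lambda>vs. shifted_el 1 \<nu> (map vz vs)"
  let ?T1 = "\<Sum>(L1, uss, Lb)\<in>inner_cuts L. \<Sum>(Ra, wss, R2)\<in>inner_cuts R.
    ksign (rot L1) (\<Sum>(a, V, b)\<in>block_of uss. C (map E a @ D V # map E b) (E (?M Lb Ra)) (map E wss) (E (?N R2 L1)))"
  let ?T2 = "\<Sum>(L1, uss, Lb)\<in>inner_cuts L. \<Sum>(Ra, wss, R2)\<in>inner_cuts R.
    ksign (rot L1) (C (map E uss) (D (?M Lb Ra)) (map E wss) (E (?N R2 L1)))"
  let ?T3 = "\<Sum>(L1, uss, Lb)\<in>inner_cuts L. \<Sum>(Ra, wss, R2)\<in>inner_cuts R.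
    ksign (rot L1) (\<Sum>(a, V, b)\<in>block_of wss. C (map E uss) (E (?M Lb Ra)) (map E a @ D V # map E b) (E (?N R2 L1)))"
  let ?T4 = "\<Sum>(L1, uss, Lb)\<in>inner_cuts L. \<Sum>(Ra, wss, R2)\<in>inner_cuts R.
    ksign (rot L1) (C (map E uss) (E (?M Lb Ra)) (map E wss) (D (?N R2 L1)))"
  have "cyclic_value C w L c R n v' =
    (\<Sum>(L1, uss, Lb)\<in>inner_cuts L. \<Sum>(Ra, wss, R2)\<in>inner_cuts R. ksign (rot L1)
     (C (map E uss) (E (?M Lb Ra)) (map E wss) (E (?N R2 L1)) +
    ((\<Sum>(a, V, b)\<in>block_of uss. C (map E a @ D V # map E b) (E (?M Lb Ra)) (map E wss) (E (?N R2 L1))) +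
     C (map E uss) (D (?M Lb Ra)) (map E wss) (E (?N R2 L1)) +
     (\<Sum>(a, V, b)\<in>block_of wss. C (map E uss) (E (?M Lb Ra)) (map E a @ D V # map E b) (E (?N R2 L1))) +
     C (map E uss) (E (?M Lb Ra)) (map E wss) (D (?N R2 L1)))))"
    unfolding cyclic_value_def
    by (intro sum.cong refl, clarify, intro sum.cong refl, clarify) (simp only: cyclic_variation)
  also have "\<dots> = cyclic_value C w L c R n v + (?T1 + ?T2 + ?T3 + ?T4)"
    unfolding cyclic_value_def by (simp add: split_def ksign_add sum.distrib)
  finally have main: "cyclic_value C w L c R n v' = cyclic_value C w L c R n v + (?T1 + ?T2 + ?T3 + ?T4)" .

  let ?S1 = "\<Sum>(L1, uss, Lb)\<in>inner_cuts L. \<Sum>(Ra, wss, R2)\<in>inner_cuts R.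
    (\<Sum>(a, vs, b)\<in>splits3 uss. mark (rot L1) (a @ vs @ b @ (?M Lb Ra) # wss @ [?N R2 L1])
      (ksign (sdegs (map vz a))
        (C (map vz a @ ?v vs # map vz b) (vz (?M Lb Ra)) (map vz wss) (vz (?N R2 L1)))))"
  let ?S2 = "\<Sum>(L1, uss, Lb)\<in>inner_cuts L. \<Sum>(Ra, wss, R2)\<in>inner_cuts R.
    (\<Sum>(us, vs)\<in>splits2 uss. \<Sum>(ws, zs)\<in>splits2 wss.
      mark (rot L1) (us @ (vs @ (?M Lb Ra) # ws) @ zs @ [?N R2 L1])
      (ksign (sdegs (map vz us))
        (C (map vz us) (shifted_el 1 \<nu> (map vz (vs @ (?M Lb Ra) # ws))) (map vz zs) (vz (?N R2 L1)))))"
  let ?S3 = "\<Sum>(L1, uss, Lb)\<in>inner_cuts L. \<Sum>(Ra, wss, R2)\<in>inner_cuts R.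
    (\<Sum>(a, vs, b)\<in>splits3 wss. mark (rot L1) ((uss @ (?M Lb Ra) # a) @ vs @ b @ [?N R2 L1])
      (ksign (sdegs (map vz (uss @ (?M Lb Ra) # a)))
        (C (map vz uss) (vz (?M Lb Ra)) (map vz a @ ?v vs # map vz b) (vz (?N R2 L1)))))"
  let ?S4 = "\<Sum>(L1, uss, Lb)\<in>inner_cuts L. \<Sum>(Ra, wss, R2)\<in>inner_cuts R.
    (\<Sum>(us, vs)\<in>splits2 uss. \<Sum>(ws, zs)\<in>splits2 wss.
      mark (rot L1) (us @ (vs @ (?M Lb Ra) # ws) @ zs @ [?N R2 L1])
      (ksign (sdegs (map vz us) * (sdegs (map vz ((vs @ (?M Lb Ra) # ws) @ zs)) + sdeg (vz (?N R2 L1))) +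
          sdegs (map vz (vs @ (?M Lb Ra) # ws)))
        (C (map vz vs) (vz (?M Lb Ra)) (map vz ws) (shifted_el 1 \<nu> (map vz (zs @ (?N R2 L1) # us))))))"
  have "?S1 + ?S2 + ?S3 + ?S4 = 0"
  proof -
    have "?S1 + ?S2 + ?S3 + ?S4 = (\<Sum>(L1, uss, Lb)\<in>inner_cuts L. \<Sum>(Ra, wss, R2)\<in>inner_cuts R. 0)"
      unfolding split_def sum.distrib[symmetric]
      by (intro sum.cong refl) (rule closed_at[unfolded split_def]; simp)
    then show ?thesis by simp
  qed
  moreover have "?S1 = ?T1"
  proof -
    have "?S1 = (\<Sum>(Ra, wss, R2)\<in>inner_cuts R. \<Sum>(L1, uss, Lb)\<in>inner_cuts L.
      (\<Sum>(a, vs, b)\<in>splits3 uss. mark (rot L1) (a @ vs @ b @ (?M Lb Ra) # wss @ [?N R2 L1])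
      (ksign (sdegs (map vz a))
        (C (map vz a @ ?v vs # map vz b) (vz (?M Lb Ra)) (map vz wss) (vz (?N R2 L1))))))"
      by (rule sum_swap_triples)
    also have "\<dots> = (\<Sum>(Ra, wss, R2)\<in>inner_cuts R. \<Sum>(L1, uss, Lb)\<in>inner_cuts L.
      \<Sum>(a, V, b)\<in>block_of uss. \<Sum>vs\<in>cuts V. mark (rot L1) (a @ vs @ b @ (?M Lb Ra) # wss @ [?N R2 L1])
      (ksign (sdegs (map vz a))
        (C (map vz a @ ?v vs # map vz b) (vz (?M Lb Ra)) (map vz wss) (vz (?N R2 L1)))))"
      by (simp only: sum_inner_cuts_splits3[where J = L])
    also have "\<dots> = (\<Sum>(Ra, wss, R2)\<in>inner_cuts R. \<Sum>(L1, uss, Lb)\<in>inner_cuts L.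
      \<Sum>(a, V, b)\<in>block_of uss. ksign (rot L1) (C (map E a @ D V # map E b) (E (?M Lb Ra)) (map E wss) (E (?N R2 L1))))"
    proof (intro sum.cong refl, clarify, intro sum.cong refl, clarify, intro sum.cong refl, clarify)
      fix Ra wss R2 L1 uss Lb a V b
      assume R: "(Ra, wss, R2) \<in> inner_cuts R" and L: "(L1, uss, Lb) \<in> inner_cuts L"
        and "(a, V, b) \<in> block_of uss"
      then have uss: "uss = a @ V # b" by (simp add: block_of_def)
      note facts = word_facts[OF L R]
      let ?f2 = "b @ (?M Lb Ra) # wss @ [?N R2 L1]"
      show "(\<Sum>vs\<in>cuts V. mark (rot L1) (a @ vs @ ?f2)
          (ksign (sdegs (map vz a)) (C (map vz a @ ?v vs # map vz b)
            (vz (?M Lb Ra)) (map vz wss) (vz (?N R2 L1))))) =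
        ksign (rot L1) (C (map E a @ D V # map E b) (E (?M Lb Ra)) (map E wss) (E (?N R2 L1)))"
        unfolding D_def
      proof (rule block_sum)
        show "V \<in> Blocks" using facts uss by simp
        show "distinct (concat a @ V @ concat ?f2)" using facts(5) by (simp add: uss)
        show "additive_on (G d) (\<lambda>x. C (map vz a @ (d, x) # map vz b) (vz (?M Lb Ra)) (map vz wss) (vz (?N R2 L1)))" for d
          by (rule C_additive1) (use facts uss in \<open>auto intro!: map_vz_homog vz_homog\<close>)
        show "additive_on (G d) (\<lambda>x. C (map E a @ (d, x) # map E b) (E (?M Lb Ra)) (map E wss) (E (?N R2 L1)))" for d
          by (rule C_additive1) (use facts uss in \<open>auto intro!: map_el_homog el_homog\<close>)
      qed (auto simp: map_vz_eq vz_eq)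
    qed
    also have "\<dots> = (\<Sum>(L1, uss, Lb)\<in>inner_cuts L. \<Sum>(Ra, wss, R2)\<in>inner_cuts R.
      \<Sum>(a, V, b)\<in>block_of uss. ksign (rot L1) (C (map E a @ D V # map E b) (E (?M Lb Ra)) (map E wss) (E (?N R2 L1))))"
      by (rule sum_swap_triples)
    finally show ?thesis by (simp add: ksign_sum split_def)
  qed
  moreover have "?S3 = ?T3"
  proof -
    have "?S3 = (\<Sum>(L1, uss, Lb)\<in>inner_cuts L. \<Sum>(Ra, wss, R2)\<in>inner_cuts R.
      \<Sum>(a, V, b)\<in>block_of wss. \<Sum>vs\<in>cuts V. mark (rot L1) ((uss @ (?M Lb Ra) # a) @ vs @ b @ [?N R2 L1])
      (ksign (sdegs (map vz (uss @ (?M Lb Ra) # a)))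
        (C (map vz uss) (vz (?M Lb Ra)) (map vz a @ ?v vs # map vz b) (vz (?N R2 L1)))))"
      by (simp only: sum_inner_cuts_splits3[where J = R])
    also have "\<dots> = (\<Sum>(L1, uss, Lb)\<in>inner_cuts L. \<Sum>(Ra, wss, R2)\<in>inner_cuts R.
      \<Sum>(a, V, b)\<in>block_of wss. ksign (rot L1) (C (map E uss) (E (?M Lb Ra)) (map E a @ D V # map E b) (E (?N R2 L1))))"
    proof (intro sum.cong refl, clarify, intro sum.cong refl, clarify, intro sum.cong refl, clarify)
      fix L1 uss Lb Ra wss R2 a V b
      assume L: "(L1, uss, Lb) \<in> inner_cuts L" and R: "(Ra, wss, R2) \<in> inner_cuts R"
        and "(a, V, b) \<in> block_of wss"
      then have wss: "wss = a @ V # b" by (simp add: block_of_def)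
      note facts = word_facts[OF L R]
      let ?f1 = "uss @ (?M Lb Ra) # a" and ?f2 = "b @ [?N R2 L1]"
      show "(\<Sum>vs\<in>cuts V. mark (rot L1) (?f1 @ vs @ ?f2)
          (ksign (sdegs (map vz ?f1)) (C (map vz uss) (vz (?M Lb Ra))
             (map vz a @ ?v vs # map vz b) (vz (?N R2 L1))))) =
        ksign (rot L1) (C (map E uss) (E (?M Lb Ra)) (map E a @ D V # map E b) (E (?N R2 L1)))"
        unfolding D_def
      proof (rule block_sum)
        show "V \<in> Blocks" using facts wss by simp
        show "distinct (concat ?f1 @ V @ concat ?f2)" using facts(5) by (simp add: wss)
        show "additive_on (G d) (\<lambda>x. C (map vz uss) (vz (?M Lb Ra)) (map vz a @ (d, x) # map vz b) (vz (?N R2 L1)))" for d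
          by (rule C_additive3) (use facts wss in \<open>auto intro!: map_vz_homog vz_homog\<close>)
        show "additive_on (G d) (\<lambda>x. C (map E uss) (E (?M Lb Ra)) (map E a @ (d, x) # map E b) (E (?N R2 L1)))" for d
          by (rule C_additive3) (use facts wss in \<open>auto intro!: map_el_homog el_homog\<close>)
      qed (auto simp: map_vz_eq vz_eq)
    qed
    finally show ?thesis by (simp add: ksign_sum split_def)
  qed
  moreover have "?S2 = ?T2"
  proof -
    have "?S2 = (\<Sum>(L1, us, X)\<in>inner_cuts L. \<Sum>(Y, zs, R2)\<in>inner_cuts R.
      \<Sum>(vs, Lb)\<in>prefix_cuts X. \<Sum>(Ra, ws)\<in>suffix_cuts Y.
      mark (rot L1) (us @ (vs @ (?M Lb Ra) # ws) @ zs @ [?N R2 L1])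
      (ksign (sdegs (map vz us))
        (C (map vz us) (shifted_el 1 \<nu> (map vz (vs @ (?M Lb Ra) # ws))) (map vz zs) (vz (?N R2 L1)))))"
      by (rule sum_inner_cuts_middle)
    also have "\<dots> = ?T2"
    proof (intro sum.cong refl, clarify, intro sum.cong refl, clarify)
      fix L1 us X Y zs R2
      assume L: "(L1, us, X) \<in> inner_cuts L" and R: "(Y, zs, R2) \<in> inner_cuts R"
      note facts = word_facts[OF L R]
      have cXY: "c \<notin> set X" "c \<notin> set Y" using facts(5) by auto
      have "(\<Sum>vs\<in>cuts (X @ c # Y). mark (rot L1) (us @ vs @ zs @ [?N R2 L1])
          (ksign (sdegs (map vz us)) (C (map vz us) (?v vs) (map vz zs) (vz (?N R2 L1))))) =
        ksign (rot L1) (C (map E us) (D (X @ c # Y)) (map E zs) (E (?N R2 L1)))"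
        unfolding D_def
      proof (rule block_sum)
        show "X @ c # Y \<in> Blocks" by (rule facts)
        show "distinct (concat us @ (X @ c # Y) @ concat (zs @ [?N R2 L1]))" using facts(5) by simp
        show "additive_on (G d) (\<lambda>x. C (map vz us) (d, x) (map vz zs) (vz (?N R2 L1)))" for d
          by (rule C_additive2) (use facts in \<open>auto intro!: map_vz_homog vz_homog\<close>)
        show "additive_on (G d) (\<lambda>x. C (map E us) (d, x) (map E zs) (E (?N R2 L1)))" for d
          by (rule C_additive2) (use facts in \<open>auto intro!: map_el_homog el_homog\<close>)
      qed (auto simp: map_vz_eq vz_eq)
      then show "(\<Sum>(vs, Lb)\<in>prefix_cuts X. \<Sum>(Ra, ws)\<in>suffix_cuts Y.
        mark (rot L1) (us @ (vs @ (?M Lb Ra) # ws) @ zs @ [?N R2 L1])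
        (ksign (sdegs (map vz us))
        (C (map vz us) (shifted_el 1 \<nu> (map vz (vs @ (?M Lb Ra) # ws))) (map vz zs) (vz (?N R2 L1))))) =
        ksign (rot L1) (C (map E us) (D (X @ c # Y)) (map E zs) (E (?N R2 L1)))"
        by (simp only: sum_cuts_pointed[OF cXY])
    qed
    finally show ?thesis .
  qed
  moreover have "?S4 = ?T4"
  proof -
    have "?S4 = (\<Sum>(Z, vs, Lb)\<in>inner_cuts L. \<Sum>(Ra, ws, Z')\<in>inner_cuts R.
      \<Sum>(zs, R2)\<in>prefix_cuts Z'. \<Sum>(L1, us)\<in>suffix_cuts Z.
      mark (rot L1) (us @ (vs @ (?M Lb Ra) # ws) @ zs @ [?N R2 L1])
      (ksign (sdegs (map vz us) * (sdegs (map vz ((vs @ (?M Lb Ra) # ws) @ zs)) + sdeg (vz (?N R2 L1))) +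
          sdegs (map vz (vs @ (?M Lb Ra) # ws)))
        (C (map vz vs) (vz (?M Lb Ra)) (map vz ws) (shifted_el 1 \<nu> (map vz (zs @ (?N R2 L1) # us))))))"
      by (rule sum_inner_cuts_outer)
    also have "\<dots> = ?T4"
    proof (intro sum.cong refl, clarify, intro sum.cong refl, clarify)
      fix Z vs Lb Ra ws Z'
      assume L: "(Z, vs, Lb) \<in> inner_cuts L" and R: "(Ra, ws, Z') \<in> inner_cuts R"
      note facts = word_facts[OF L R]
      show "(\<Sum>(zs, R2)\<in>prefix_cuts Z'. \<Sum>(L1, us)\<in>suffix_cuts Z.
        mark (rot L1) (us @ (vs @ (?M Lb Ra) # ws) @ zs @ [?N R2 L1])
        (ksign (sdegs (map vz us) * (sdegs (map vz ((vs @ (?M Lb Ra) # ws) @ zs)) + sdeg (vz (?N R2 L1))) +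
          sdegs (map vz (vs @ (?M Lb Ra) # ws)))
        (C (map vz vs) (vz (?M Lb Ra)) (map vz ws) (shifted_el 1 \<nu> (map vz (zs @ (?N R2 L1) # us)))))) =
        ksign (rot Z) (C (map E vs) (E (?M Lb Ra)) (map E ws) (D (Z' @ n # Z)))"
        unfolding D_def
      proof (rule rotated_block_sum)
        show "Z' @ n # Z \<in> Blocks" by (rule facts)
        show "distinct (concat (vs @ (?M Lb Ra) # ws) @ Z' @ n # Z)" using facts(5) by simp
        show "weight w (L @ c # R @ [n]) = weight w (concat (vs @ (?M Lb Ra) # ws)) + weight w (Z' @ n # Z)"
          by (rule facts)
        show "additive_on (G d) (\<lambda>x. C (map vz vs) (vz (?M Lb Ra)) (map vz ws) (d, x))" for d
          by (rule C_additive4) (use facts in \<open>auto intro!: map_vz_homog vz_homog\<close>)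
        show "additive_on (G d) (\<lambda>x. C (map E vs) (E (?M Lb Ra)) (map E ws) (d, x))" for d
          by (rule C_additive4) (use facts in \<open>auto intro!: map_el_homog el_homog\<close>)
      qed (auto simp: map_vz_eq vz_eq)
    qed
    finally show ?thesis .
  qed
  ultimately show ?thesis using main by simp
qed

end


section \<open>Inner products and their pullbacks\<close>

lemma mshifted_munshifted: "mshifted (munshifted F) as m bs = F as m bs"
  by (auto simp: mshifted_def ksign_def)

lemma mshifted_as_module: "mshifted (as_module \<phi>) as m bs = shifted \<phi> (as @ m # bs)"
  by (simp add: mshifted_def shifted_def as_module_def)

lemma mshifted_el_as_module: "mshifted_el \<delta> (as_module \<phi>) as m bs = shifted_el \<delta> \<phi> (as @ m # bs)"
  by (simp add: mshifted_el_def shifted_el_def mshifted_as_module add.assoc)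

context graded_module
begin

lemma zero_homog: "(d, 0) \<in> homog G"
  by (simp add: homog_def G_zero)

lemma shifted_el_ainf_id:
  "shifted_el 0 ainf_id ys = (if length ys = 1 then hd ys else (sdegs ys + 1, 0))"
  by (cases ys) (auto simp: shifted_el_def shifted_def ainf_id_def sdeg_def ksign_def shift_exp_def)

lemma map_ainf_id_homog:
  assumes "xs \<in> lists (homog G)" "xss \<in> cuts xs" "set yss \<subseteq> set xss"
  shows "map (shifted_el 0 ainf_id) yss \<in> lists (homog G)"
proof -
  have "shifted_el 0 ainf_id ys \<in> homog G" if "ys \<in> set yss" for ys
  proof (cases "length ys = 1")
    case True
    then obtain x where "ys = [x]" by (auto simp: length_Suc_conv)
    with that assms(3) have "[x] \<in> set xss" by auto
    with assms(2) have "x \<in> set xs" by (force simp: cuts_def)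
    with assms(1) \<open>ys = [x]\<close> show ?thesis by (auto simp: shifted_el_ainf_id)
  qed (simp add: shifted_el_ainf_id zero_homog)
  then show ?thesis by (auto simp: in_lists_conv_set)
qed

text \<open>The identity has no higher components. A cut with a block of several letters produces a
  zero entry, so only the cut into single letters survives.\<close>

lemma sum_cuts_ainf_id:
  assumes xs: "xs \<in> lists (homog G)"
    and T: "\<And>a d b. a \<in> lists (homog G) \<Longrightarrow> b \<in> lists (homog G) \<Longrightarrow> T (a @ (d, 0) # b) = 0"
  shows "(\<Sum>xss\<in>cuts xs. T (map (shifted_el 0 ainf_id) xss)) = T xs"
proof -
  let ?s = "map (\<lambda>x. [x]) xs"
  have "(\<Sum>xss\<in>cuts xs. T (map (shifted_el 0 ainf_id) xss)) =
      (\<Sum>xss\<in>{?s}. T (map (shifted_el 0 ainf_id) xss))"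
  proof (rule sum.mono_neutral_right[OF finite_cuts])
    show "{?s} \<subseteq> cuts xs" by (auto simp: cuts_def)
    show "\<forall>xss\<in>cuts xs - {?s}. T (map (shifted_el 0 ainf_id) xss) = 0"
    proof
      fix xss assume xss: "xss \<in> cuts xs - {?s}"
      have "\<exists>ys\<in>set xss. length ys \<noteq> 1"
      proof (rule ccontr)
        assume "\<not> ?thesis"
        then have "xss = map (\<lambda>x. [x]) (concat xss)"
          by (induction xss) (auto simp: length_Suc_conv)
        with xss show False by (simp add: cuts_def)
      qed
      then obtain a ys b where eq: "xss = a @ ys # b" and ys: "length ys \<noteq> 1"
        by (metis split_list)
      have "map (shifted_el 0 ainf_id) a \<in> lists (homog G)" "map (shifted_el 0 ainf_id) b \<in> lists (homog G)"
        by (rule map_ainf_id_homog[OF xs, of xss]; use xss eq in auto)+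
      from T[OF this] show "T (map (shifted_el 0 ainf_id) xss) = 0"
        using ys by (simp add: eq shifted_el_ainf_id)
    qed
  qed
  also have "\<dots> = T xs" by (simp add: comp_def shifted_el_ainf_id)
  finally show ?thesis .
qed

end

text \<open>Evaluated at \<open>m'\<close>, the right-hand side of the morphism equation is a sum
  over cuts mapped by the identity morphism, which collapses to single letters. The dual structure
  map then pairs \<open>I\<close> with \<open>\<nu>\<close> of \<open>zs @ m' # us\<close>, and its
  leading minus sign brings this sum to the other side.\<close>

lemma inner_product_cyclic_form:
  fixes sB :: "'r::comm_ring_1 \<Rightarrow> 'b::ab_group_add \<Rightarrow> 'b"
  assumes "ainf_algebra sB B \<nu>" "ainf_inner_product sB B \<nu> sB B (as_module \<nu>) e I"
  shows "cyclic_form sB B \<nu> (mshifted I)"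
proof -
  interpret ainf_algebra sB B \<nu> by fact
  have lin1: "homog_linear sB B dual_scale (\<lambda>x. I (us @ x # ws) m bs)"
    and lin3: "homog_linear sB B dual_scale (\<lambda>x. I bs m (us @ x # ws))"
    if "us \<in> lists (homog B)" "ws \<in> lists (homog B)" "m \<in> homog B" "bs \<in> lists (homog B)" for us ws m bs
    using assms(2) that unfolding ainf_inner_product_def ainf_module_morphism_def by blast+
  have lin2: "homog_linear sB B dual_scale (\<lambda>m. I as m bs)"
    if "as \<in> lists (homog B)" "bs \<in> lists (homog B)" for as bs
    using assms(2) that unfolding ainf_inner_product_def ainf_module_morphism_def by blast
  have lin4: "homog_linear sB B (*) (I as m bs)"
    if "as \<in> lists (homog B)" "m \<in> homog B" "bs \<in> lists (homog B)" for as m bs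
    using assms(2) that unfolding ainf_inner_product_def ainf_module_morphism_def dual_grading_def by blast
  have rel: "shifted_comp \<nu> (as_module \<nu>) I as m bs =
          ksign e (\<Sum>(us, vs)\<in>splits2 as. \<Sum>uss\<in>cuts us. \<Sum>(ws, zs)\<in>splits2 bs. \<Sum>zss\<in>cuts zs.
            ksign (e * sdegs us)
              (mshifted (dual_module B (as_module \<nu>)) (map (shifted_el 0 ainf_id) uss) (mshifted_el e I vs m ws)
                         (map (shifted_el 0 ainf_id) zss)))"
    if "as \<in> lists (homog B)" "m \<in> homog B" "bs \<in> lists (homog B)" for as m bs
    using assms(2) that unfolding ainf_inner_product_def ainf_module_morphism_def by blast
  show ?thesis
  proof
    fix us ws bs :: "(int \<times> 'b) list" and m m' :: "int \<times> 'b" and d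
    assume "us \<in> lists (homog B)" "ws \<in> lists (homog B)" "m \<in> homog B" "bs \<in> lists (homog B)"
    from lin1[OF this] show "additive_on (B d) (\<lambda>x. mshifted I (us @ (d, x) # ws) m bs m')"
      by (simp add: additive_on_def homog_linear_def mshifted_def ksign_apply ksign_add)
  next
    fix "as" bs :: "(int \<times> 'b) list" and m' :: "int \<times> 'b" and d
    assume "as \<in> lists (homog B)" "bs \<in> lists (homog B)"
    from lin2[OF this] show "additive_on (B d) (\<lambda>x. mshifted I as (d, x) bs m')"
      by (simp add: additive_on_def homog_linear_def mshifted_def ksign_apply ksign_add)
  next
    fix "as" us ws :: "(int \<times> 'b) list" and m m' :: "int \<times> 'b" and d
    assume "as \<in> lists (homog B)" "m \<in> homog B" "us \<in> lists (homog B)" "ws \<in> lists (homog B)"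
    from lin3[OF this(3,4,2,1)] show "additive_on (B d) (\<lambda>x. mshifted I as m (us @ (d, x) # ws) m')"
      by (simp add: additive_on_def homog_linear_def mshifted_def ksign_apply ksign_add)
  next
    fix "as" bs :: "(int \<times> 'b) list" and m :: "int \<times> 'b" and d
    assume "as \<in> lists (homog B)" "m \<in> homog B" "bs \<in> lists (homog B)"
    from lin4[OF this] show "additive_on (B d) (\<lambda>x. mshifted I as m bs (d, x))"
      by (simp add: additive_on_def homog_linear_def mshifted_def ksign_apply ksign_add)
  next
    fix "as" bs :: "(int \<times> 'b) list" and m m' :: "int \<times> 'b"
    assume hom: "as \<in> lists (homog B)" "m \<in> homog B" "bs \<in> lists (homog B)" "m' \<in> homog B"
    let ?C = "mshifted I"
    \<comment> \<open>The module argument of the dual structure map is a value of \<open>I\<close>,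
      of shifted degree \<open>sdegs vs + sdeg m + sdegs ws + e\<close>.\<close>
    let ?T = "\<lambda>vs ws us zs. - ksign (sdegs us * (sdegs vs + sdeg m + sdegs ws + e + sdegs zs + sdeg m') +
        (sdegs vs + sdeg m + sdegs ws + e)) (?C vs m ws (shifted_el 1 \<nu> (zs @ m' # us)))"
    have dual: "mshifted (dual_module B (as_module \<nu>)) us (mshifted_el e I vs m ws) zs m' = ?T vs ws us zs"
      for us vs ws zs
      using hom(4) by (simp add: dual_module_def mshifted_munshifted mshifted_el_as_module mshifted_el_def[of e]
          sdeg_def[of "(_, _)"] sdegs_def algebra_simps)
    have T1: "?T vs ws (a @ (d, 0) # b) zs = 0"
      if "vs \<in> lists (homog B)" "ws \<in> lists (homog B)" "zs \<in> lists (homog B)"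
        "a \<in> lists (homog B)" "b \<in> lists (homog B)" for vs ws zs a d b
    proof -
      have "shifted \<nu> ((zs @ m' # a) @ (d, 0) # b) = 0"
        by (rule additive_on_zero[OF shifted_additive]) (use that hom in auto)
      moreover have "?C vs m ws (d', 0) = 0" for d'
        using lin4[OF that(1) hom(2) that(2)] additive_on_zero[of d' "\<lambda>x. mshifted I vs m ws (d', x)"]
        by (simp add: additive_on_def homog_linear_def mshifted_def ksign_apply ksign_add)
      ultimately show ?thesis by (simp add: shifted_el_def)
    qed
    have T2: "?T vs ws us (a @ (d, 0) # b) = 0"
      if "vs \<in> lists (homog B)" "ws \<in> lists (homog B)" "us \<in> lists (homog B)"
        "a \<in> lists (homog B)" "b \<in> lists (homog B)" for vs ws us a d b
    proof -
      have "shifted \<nu> (a @ (d, 0) # (b @ m' # us)) = 0"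
        by (rule additive_on_zero[OF shifted_additive]) (use that hom in auto)
      moreover have "?C vs m ws (d', 0) = 0" for d'
        using lin4[OF that(1) hom(2) that(2)] additive_on_zero[of d' "\<lambda>x. mshifted I vs m ws (d', x)"]
        by (simp add: additive_on_def homog_linear_def mshifted_def ksign_apply ksign_add)
      ultimately show ?thesis by (simp add: shifted_el_def)
    qed
    have parts: "us \<in> lists (homog B)" "vs \<in> lists (homog B)"
      if "(us, vs) \<in> splits2 xs" "xs \<in> lists (homog B)" for us vs xs
      using that by (auto simp: splits2_def)
    have "shifted_comp \<nu> (as_module \<nu>) I as m bs m' =
       (\<Sum>(us, vs)\<in>splits2 as. \<Sum>uss\<in>cuts us. \<Sum>(ws, zs)\<in>splits2 bs. \<Sum>zss\<in>cuts zs.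
            ksign (e + e * sdegs us)
              (?T vs ws (map (shifted_el 0 ainf_id) uss) (map (shifted_el 0 ainf_id) zss)))"
      unfolding rel[OF hom(1,2,3)] ksign_apply sum_fun_apply split_def dual ksign_sum ksign_ksign ..
    also have "\<dots> = (\<Sum>(us, vs)\<in>splits2 as. \<Sum>uss\<in>cuts us. \<Sum>(ws, zs)\<in>splits2 bs.
            ksign (e + e * sdegs us) (?T vs ws (map (shifted_el 0 ainf_id) uss) zs))"
    proof (intro sum.cong refl, clarify, intro sum.cong refl, clarify)
      fix us vs uss ws zs
      assume mem: "(us, vs) \<in> splits2 as" "uss \<in> cuts us" "(ws, zs) \<in> splits2 bs"
      note hom' = parts[OF mem(1) hom(1)] parts[OF mem(3) hom(3)]
      show "(\<Sum>zss\<in>cuts zs. ksign (e + e * sdegs us)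
          (?T vs ws (map (shifted_el 0 ainf_id) uss) (map (shifted_el 0 ainf_id) zss))) =
        ksign (e + e * sdegs us) (?T vs ws (map (shifted_el 0 ainf_id) uss) zs)"
      proof (rule sum_cuts_ainf_id[OF hom'(4)])
        fix a d b assume "a \<in> lists (homog B)" "b \<in> lists (homog B)"
        from T2[OF hom'(2,3) map_ainf_id_homog[OF hom'(1) mem(2) order_refl] this]
        show "ksign (e + e * sdegs us) (?T vs ws (map (shifted_el 0 ainf_id) uss) (a @ (d, 0) # b)) = 0"
          by (simp only: ksign_0)
      qed
    qed
    also have "\<dots> = (\<Sum>(us, vs)\<in>splits2 as. \<Sum>(ws, zs)\<in>splits2 bs.
            ksign (e + e * sdegs us) (?T vs ws us zs))"
    proof (intro sum.cong refl, clarify)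
      fix us vs assume mem: "(us, vs) \<in> splits2 as"
      note hom' = parts[OF mem hom(1)]
      show "(\<Sum>uss\<in>cuts us. \<Sum>(ws, zs)\<in>splits2 bs.
            ksign (e + e * sdegs us) (?T vs ws (map (shifted_el 0 ainf_id) uss) zs)) =
        (\<Sum>(ws, zs)\<in>splits2 bs. ksign (e + e * sdegs us) (?T vs ws us zs))"
      proof (rule sum_cuts_ainf_id[OF hom'(1)], rule sum.neutral, rule ballI)
        fix a d b p assume ab: "a \<in> lists (homog B)" "b \<in> lists (homog B)" and p: "p \<in> splits2 bs"
        obtain ws zs where p': "p = (ws, zs)" by (cases p)
        from T1[OF hom'(2) parts[OF p[unfolded p'] hom(3)] ab]
        show "(case p of (ws, zs) \<Rightarrow> ksign (e + e * sdegs us) (?T vs ws (a @ (d, 0) # b) zs)) = 0"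
          by (simp only: p' prod.case ksign_0)
      qed
    qed
    \<comment> \<open>The exponent \<open>e + e * sdegs us\<close> of the morphism equation meets
      the same two terms in the exponent of \<open>?T\<close>, so \<open>e\<close> drops
      out.\<close>
    also have "\<dots> = - (\<Sum>(us, vs)\<in>splits2 as. \<Sum>(ws, zs)\<in>splits2 bs.
         ksign (sdegs us * (sdegs vs + sdeg m + sdegs bs + sdeg m') + sdegs vs + sdeg m + sdegs ws)
           (?C vs m ws (shifted_el 1 \<nu> (zs @ m' # us))))"
    proof -
      have "ksign (e + e * sdegs us) (?T vs ws us zs) =
        - ksign (sdegs us * (sdegs vs + sdeg m + sdegs bs + sdeg m') + sdegs vs + sdeg m + sdegs ws)
           (?C vs m ws (shifted_el 1 \<nu> (zs @ m' # us)))"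
        if "(ws, zs) \<in> splits2 bs" for us vs ws zs
      proof -
        have "sdegs bs = sdegs ws + sdegs zs" using that by (auto simp: splits2_def)
        then show ?thesis unfolding ksign_minus ksign_ksign
          by (intro arg_cong[of _ _ uminus] ksign_parity) (simp, blast)
      qed
      then show ?thesis by (simp add: split_def sum_negf[symmetric] cong: sum.cong)
    qed
    finally show "(\<Sum>(us, vs, ws)\<in>splits3 as.
         ksign (sdegs us) (?C (us @ shifted_el 1 \<nu> vs # ws) m bs m')) +
      (\<Sum>(us, vs)\<in>splits2 as. \<Sum>(ws, zs)\<in>splits2 bs.
         ksign (sdegs us) (?C us (shifted_el 1 \<nu> (vs @ m # ws)) zs m')) +
      (\<Sum>(us, vs, ws)\<in>splits3 bs.
         ksign (sdegs as + sdeg m + sdegs us) (?C as m (us @ shifted_el 1 \<nu> vs # ws) m')) +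
      (\<Sum>(us, vs)\<in>splits2 as. \<Sum>(ws, zs)\<in>splits2 bs.
         ksign (sdegs us * (sdegs vs + sdeg m + sdegs bs + sdeg m') + sdegs vs + sdeg m + sdegs ws)
           (?C vs m ws (shifted_el 1 \<nu> (zs @ m' # us)))) = 0"
      by (simp add: shifted_comp_def sum_fun_apply ksign_apply split_def mshifted_el_as_module)
  qed
qed

section \<open>Expansion of the pullback by multilinearity\<close>

lemma pullback_eq:
  assumes "m' \<in> homog A"
  shows "mshifted (pullback A k (as_module k) I) as m bs m' =
    (\<Sum>(as1, as2)\<in>splits2 as. \<Sum>(bs1, bs2)\<in>splits2 bs.
        \<Sum>(us, vs)\<in>splits2 as2. \<Sum>uss\<in>cuts us. \<Sum>(ws, zs)\<in>splits2 bs1. \<Sum>zss\<in>cuts zs.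
          ksign (sdegs as1 * (sdegs as2 + sdeg m + sdegs bs + sdeg m'))
            (mshifted I (map (shifted_el 0 k) uss) (shifted_el 0 k (vs @ m # ws))
              (map (shifted_el 0 k) zss) (shifted_el 0 k (bs2 @ m' # as1))))"
  using assms by (simp add: pullback_def mshifted_munshifted mshifted_el_as_module)

lemma sum_set_Cons:
  assumes "finite A" "finite As"
  shows "(\<Sum>l\<in>set_Cons A As. F l) = (\<Sum>x\<in>A. \<Sum>l\<in>As. F (x # l))"
proof -
  have "set_Cons A As = (\<lambda>(x, l). x # l) ` (A \<times> As)" by (auto simp: set_Cons_def)
  moreover have "inj_on (\<lambda>(x, l). x # l) (A \<times> As)" by (auto simp: inj_on_def)
  ultimately show ?thesis by (simp add: sum.reindex split_def sum.cartesian_product)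
qed

context graded_module
begin

text \<open>Every entry is itself a sum over the cuts of its block; multilinearity turns the value
  of \<open>F\<close> into a sum over families of cuts, one for each block.\<close>

lemma sum_listset_expand:
  fixes w :: "'i \<Rightarrow> int"
  assumes add: "\<And>a b d. a \<in> lists (homog G) \<Longrightarrow> b \<in> lists (homog G) \<Longrightarrow>
      additive_on (G d) (\<lambda>x. F (a @ (d, x) # b))"
    and t: "\<And>ys zs. ys \<in> set yss \<Longrightarrow> zs \<in> cuts ys \<Longrightarrow> t zs \<in> G (weight w ys + 1)"
  shows "F (map (el w (\<lambda>ys. \<Sum>zs\<in>cuts ys. t zs)) yss) =
    (\<Sum>zsss\<in>listset (map cuts yss). F (map (\<lambda>zs. (weight w (concat zs) + 1, t zs)) zsss))"
  using assms
proof (induction yss arbitrary: F)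
  case (Cons ys yss)
  let ?y = "\<lambda>ys. \<Sum>zs\<in>cuts ys. t zs" and ?t = "\<lambda>zs. (weight w (concat zs) + 1, t zs)"
  have y: "map (el w ?y) yss \<in> lists (homog G)"
    using Cons.prems(2) by (auto simp: in_lists_conv_set el_def homog_def intro!: G_sum)
  have "F (map (el w ?y) (ys # yss)) = (\<Sum>zs\<in>cuts ys. F ((weight w ys + 1, t zs) # map (el w ?y) yss))"
    using additive_on_sum[OF Cons.prems(1)[of "[]" "map (el w ?y) yss" "weight w ys + 1"], of "cuts ys" t]
      y Cons.prems(2) by (simp add: el_def)
  also have "\<dots> = (\<Sum>zs\<in>cuts ys. F (?t zs # map (el w ?y) yss))"
    by (rule sum.cong) (auto simp: cuts_def)
  also have "\<dots> = (\<Sum>zs\<in>cuts ys. \<Sum>zsss\<in>listset (map cuts yss). F (?t zs # map ?t zsss))"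
  proof (rule sum.cong[OF refl])
    fix zs assume "zs \<in> cuts ys"
    then have "?t zs \<in> homog G" using Cons.prems(2)[of ys zs] by (auto simp: homog_def cuts_def)
    then show "F (?t zs # map (el w ?y) yss) = (\<Sum>zsss\<in>listset (map cuts yss). F (?t zs # map ?t zsss))"
      using Cons.IH[of "\<lambda>l. F (?t zs # l)"] Cons.prems(1)[of "?t zs # _"] Cons.prems(2) by auto
  qed
  also have "\<dots> = (\<Sum>zsss\<in>listset (map cuts (ys # yss)). F (map ?t zsss))"
    by (simp add: sum_set_Cons finite_cuts finite_listset_cuts)
  finally show ?case .
qed simp

end

lemma sum_swap_in_pair:
  "(\<Sum>(a, b)\<in>X. \<Sum>y\<in>Y. F a b y) = (\<Sum>y\<in>Y. \<Sum>(a, b)\<in>X. F a b y)"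
  unfolding split_def by (rule sum.swap)

lemma sum_swap_in_triple:
  "(\<Sum>(a, b, c)\<in>X. \<Sum>y\<in>Y. F a b c y) = (\<Sum>y\<in>Y. \<Sum>(a, b, c)\<in>X. F a b c y)"
  unfolding split_def by (rule sum.swap)

lemma sum_swap_pairs_flat:
  "(\<Sum>a\<in>A. \<Sum>b\<in>B. \<Sum>c\<in>C. \<Sum>d\<in>D. F a b c d) = (\<Sum>c\<in>C. \<Sum>d\<in>D. \<Sum>a\<in>A. \<Sum>b\<in>B. F a b c d)"
proof -
  have "(\<Sum>a\<in>A. \<Sum>b\<in>B. \<Sum>c\<in>C. \<Sum>d\<in>D. F a b c d) =
      (\<Sum>p\<in>A \<times> B. \<Sum>q\<in>C \<times> D. F (fst p) (snd p) (fst q) (snd q))"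
    by (simp only: sum.cartesian_product' fst_conv snd_conv)
  also have "\<dots> = (\<Sum>q\<in>C \<times> D. \<Sum>p\<in>A \<times> B. F (fst p) (snd p) (fst q) (snd q))"
    by (rule sum.swap)
  also have "\<dots> = (\<Sum>c\<in>C. \<Sum>d\<in>D. \<Sum>a\<in>A. \<Sum>b\<in>B. F a b c d)"
    by (simp only: sum.cartesian_product' fst_conv snd_conv)
  finally show ?thesis .
qed

text \<open>In the pulled back value the arguments of \<open>I\<close> are values of
  \<open>k\<close> on groups of blocks of one fine cut. Each group fills a coarse interval, and
  summing over the cuts of this interval gives \<open>y\<close> there. So the sums are regrouped
  from fine cuts with groups to coarse cuts with refinements.\<close>

lemma (in cyclic_form) cyclic_value_pullback:
  fixes w :: "'i \<Rightarrow> int" and k :: "(int \<times> 'a) list \<Rightarrow> 'b" and x :: "'i list \<Rightarrow> 'a"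
  defines "y \<equiv> \<lambda>J. \<Sum>zs\<in>cuts J. shifted k (map (el w x) zs)"
  assumes C: "C = mshifted I"
    and dist: "distinct (L @ c # R @ [n])"
    and x: "\<And>J. J \<in> Blocks \<Longrightarrow> x J \<in> A (weight w J + 1)"
    and k: "\<And>J zs. J \<in> Blocks \<Longrightarrow> zs \<in> cuts J \<Longrightarrow> shifted k (map (el w x) zs) \<in> G (weight w J + 1)"
    and closed: "\<forall>a J b. a @ J @ b \<in> Blocks \<longrightarrow> J \<noteq> [] \<longrightarrow> J \<in> Blocks"
    and word_Blocks: "L @ c # R \<in> Blocks" "R @ n # L \<in> Blocks"
  shows "cyclic_value (mshifted (pullback A k (as_module k) I)) w L c R n x = cyclic_value C w L c R n y"
proof -
  define t where "t = (\<lambda>zs. (weight w (concat zs) + 1, shifted k (map (el w x) zs)))"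
  let ?T = "weight w (L @ c # R @ [n])"
  let ?rot = "\<lambda>L1. weight w L1 * (?T - weight w L1)"
  have t: "shifted_el 0 k (map (el w x) zs) = t zs" for zs
    by (simp add: t_def shifted_el_def)
  have ts: "map (shifted_el 0 k \<circ> map (el w x)) zss = map t zss" for zss
    by (simp add: t)
  let ?H = "\<lambda>L1 as1 us vs Lb Ra ws zs bs2 R2. \<Sum>uss\<in>cuts us. \<Sum>zss\<in>cuts zs.
      ksign (?rot (L1 @ concat as1)) (C (map t uss) (t (vs @ (Lb @ c # Ra) # ws)) (map t zss)
        (t (bs2 @ (R2 @ n # L1) # as1)))"
  have Cx: "mshifted (pullback A k (as_module k) I) (map (el w x) as) m (map (el w x) bs) m' =
      (\<Sum>(as1, as2)\<in>splits2 as. \<Sum>(bs1, bs2)\<in>splits2 bs.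
        \<Sum>(us, vs)\<in>splits2 as2. \<Sum>(ws, zs)\<in>splits2 bs1. \<Sum>uss\<in>cuts us. \<Sum>zss\<in>cuts zs.
          ksign (weight w (concat as1) * (weight w (concat as2) + sdeg m + weight w (concat bs) + sdeg m'))
            (C (map t uss) (shifted_el 0 k (map (el w x) vs @ m # map (el w x) ws))
              (map t zss) (shifted_el 0 k (map (el w x) bs2 @ m' # map (el w x) as1))))"
    if "m' \<in> homog A" for "as" bs m m'
    unfolding pullback_eq[OF that] sum_splits2_map sum_cuts_map sdegs_map_el map_map ts C
    by (simp only: sum_swap_in_pair)
  have sub: "set uss \<subseteq> Blocks" "Lb @ c # Ra \<in> Blocks" "set wss \<subseteq> Blocks" "R2 @ n # L1 \<in> Blocks"
    if L: "(L1, uss, Lb) \<in> inner_cuts L" and R: "(Ra, wss, R2) \<in> inner_cuts R" for L1 uss Lb Ra wss R2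
    using inner_cuts_Blocks[OF closed word_Blocks L R] by blast+
  have "cyclic_value (mshifted (pullback A k (as_module k) I)) w L c R n x =
    (\<Sum>(L1, uss, Lb)\<in>inner_cuts L. \<Sum>(Ra, wss, R2)\<in>inner_cuts R.
      \<Sum>(as1, as2)\<in>splits2 uss. \<Sum>(bs1, bs2)\<in>splits2 wss.
        \<Sum>(us, vs)\<in>splits2 as2. \<Sum>(ws, zs)\<in>splits2 bs1. ?H L1 as1 us vs Lb Ra ws zs bs2 R2)"
    unfolding cyclic_value_def
  proof (intro sum.cong refl, clarify, intro sum.cong refl, clarify)
    fix L1 uss Lb Ra wss R2
    assume L: "(L1, uss, Lb) \<in> inner_cuts L" and R: "(Ra, wss, R2) \<in> inner_cuts R"
    have hom: "el w x (R2 @ n # L1) \<in> homog A"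
      using x[OF sub(4)[OF L R]] by (simp add: el_def homog_def)
    have eqs: "weight w L = weight w L1 + weight w (concat uss) + weight w Lb"
        "weight w R = weight w Ra + weight w (concat wss) + weight w R2"
      using L R by (auto simp: inner_cuts_def)
    \<comment> \<open>Rotating \<open>L1\<close> and then \<open>concat as1\<close> to the end
      amounts to rotating \<open>L1 @ concat as1\<close>; the exponents differ by twice the product
      of the two weights.\<close>
    have sgn: "even (?rot L1 + weight w (concat as1) * (weight w (concat as2) + sdeg (el w x (Lb @ c # Ra)) +
          weight w (concat wss) + sdeg (el w x (R2 @ n # L1)))) = even (?rot (L1 @ concat as1))"
      if "(as1, as2) \<in> splits2 uss" for as1 as2
    proof -
      have "weight w (concat uss) = weight w (concat as1) + weight w (concat as2)"
        using that by (auto simp: splits2_def)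
      then show ?thesis by (simp add: eqs) argo
    qed
    show "ksign (?rot L1) (mshifted (pullback A k (as_module k) I) (map (el w x) uss) (el w x (Lb @ c # Ra))
         (map (el w x) wss) (el w x (R2 @ n # L1))) =
      (\<Sum>(as1, as2)\<in>splits2 uss. \<Sum>(bs1, bs2)\<in>splits2 wss.
        \<Sum>(us, vs)\<in>splits2 as2. \<Sum>(ws, zs)\<in>splits2 bs1. ?H L1 as1 us vs Lb Ra ws zs bs2 R2)"
      unfolding Cx[OF hom] ksign_sum split_def ksign_ksign
    proof (intro sum.cong refl)
      fix p q r s uss' zss assume "p \<in> splits2 uss"
      then have "even (?rot L1 + weight w (concat (fst p)) * (weight w (concat (snd p)) +
          sdeg (el w x (Lb @ c # Ra)) + weight w (concat wss) + sdeg (el w x (R2 @ n # L1)))) =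
          even (?rot (L1 @ concat (fst p)))"
        by (intro sgn) simp
      from ksign_parity[OF this]
      show "ksign (?rot L1 + weight w (concat (fst p)) * (weight w (concat (snd p)) +
          sdeg (el w x (Lb @ c # Ra)) + weight w (concat wss) + sdeg (el w x (R2 @ n # L1))))
         (C (map t uss') (shifted_el 0 k (map (el w x) (snd r) @ el w x (Lb @ c # Ra) # map (el w x) (fst s)))
           (map t zss) (shifted_el 0 k (map (el w x) (snd q) @ el w x (R2 @ n # L1) # map (el w x) (fst p)))) =
        ksign (?rot (L1 @ concat (fst p))) (C (map t uss') (t (snd r @ (Lb @ c # Ra) # fst s))
          (map t zss) (t (snd q @ (R2 @ n # L1) # fst p)))"
        by (simp flip: t)
    qed
  qed
  also have "\<dots> = (\<Sum>(Z, as2, Lb)\<in>inner_cuts L. \<Sum>(Ra, bs1, Z')\<in>inner_cuts R.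
      \<Sum>(bs2, R2)\<in>prefix_cuts Z'. \<Sum>(L1, as1)\<in>suffix_cuts Z.
        \<Sum>(us, vs)\<in>splits2 as2. \<Sum>(ws, zs)\<in>splits2 bs1. ?H L1 as1 us vs Lb Ra ws zs bs2 R2)"
    by (rule sum_inner_cuts_outer)
  \<comment> \<open>The blocks \<open>bs2\<close> in front of the block of \<open>n\<close> and
    \<open>as1\<close> behind it complete this block to an arbitrary cut \<open>nn\<close> of the
    interval around \<open>n\<close>.\<close>
  also have "\<dots> = (\<Sum>(Z, as2, Lb)\<in>inner_cuts L. \<Sum>(Ra, bs1, Z')\<in>inner_cuts R.
      \<Sum>(us, vs)\<in>splits2 as2. \<Sum>(ws, zs)\<in>splits2 bs1.
      \<Sum>nn\<in>cuts (Z' @ n # Z). \<Sum>uss\<in>cuts us. \<Sum>zss\<in>cuts zs.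
      ksign (?rot Z) (C (map t uss) (t (vs @ (Lb @ c # Ra) # ws)) (map t zss) (t nn)))"
  proof (intro sum.cong refl, clarify, intro sum.cong refl, clarify)
    fix Z as2 Lb Ra bs1 Z'
    assume L: "(Z, as2, Lb) \<in> inner_cuts L" and R: "(Ra, bs1, Z') \<in> inner_cuts R"
    have n: "n \<notin> set Z'" "n \<notin> set Z" using L R dist by (auto simp: inner_cuts_def)
    let ?K = "\<lambda>Z nn. \<Sum>(us, vs)\<in>splits2 as2. \<Sum>(ws, zs)\<in>splits2 bs1. \<Sum>uss\<in>cuts us. \<Sum>zss\<in>cuts zs.
        ksign (?rot Z) (C (map t uss) (t (vs @ (Lb @ c # Ra) # ws)) (map t zss) (t nn))"
    have "(\<Sum>(bs2, R2)\<in>prefix_cuts Z'. \<Sum>(L1, as1)\<in>suffix_cuts Z.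
        \<Sum>(us, vs)\<in>splits2 as2. \<Sum>(ws, zs)\<in>splits2 bs1. ?H L1 as1 us vs Lb Ra ws zs bs2 R2) =
      (\<Sum>(bs2, R2)\<in>prefix_cuts Z'. \<Sum>(L1, as1)\<in>suffix_cuts Z. ?K Z (bs2 @ (R2 @ n # L1) # as1))"
      by (intro sum.cong refl, clarify, intro sum.cong refl, clarify) (auto simp: suffix_cuts_def)
    also have "\<dots> = (\<Sum>nn\<in>cuts (Z' @ n # Z). ?K Z nn)"
      by (rule sum_cuts_pointed[OF n, symmetric])
    finally show "(\<Sum>(bs2, R2)\<in>prefix_cuts Z'. \<Sum>(L1, as1)\<in>suffix_cuts Z.
        \<Sum>(us, vs)\<in>splits2 as2. \<Sum>(ws, zs)\<in>splits2 bs1. ?H L1 as1 us vs Lb Ra ws zs bs2 R2) =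
      (\<Sum>(us, vs)\<in>splits2 as2. \<Sum>(ws, zs)\<in>splits2 bs1.
      \<Sum>nn\<in>cuts (Z' @ n # Z). \<Sum>uss\<in>cuts us. \<Sum>zss\<in>cuts zs.
      ksign (?rot Z) (C (map t uss) (t (vs @ (Lb @ c # Ra) # ws)) (map t zss) (t nn)))"
      by (simp only: sum_swap_in_pair)
  qed
  also have "\<dots> = (\<Sum>(Z, us, X)\<in>inner_cuts L. \<Sum>(Y, zs, Z')\<in>inner_cuts R.
      \<Sum>(vs, Lb)\<in>prefix_cuts X. \<Sum>(Ra, ws)\<in>suffix_cuts Y.
      \<Sum>nn\<in>cuts (Z' @ n # Z). \<Sum>uss\<in>cuts us. \<Sum>zss\<in>cuts zs.
      ksign (?rot Z) (C (map t uss) (t (vs @ (Lb @ c # Ra) # ws)) (map t zss) (t nn)))"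
    by (rule sum_inner_cuts_middle)
  \<comment> \<open>In the same way \<open>vs\<close> and \<open>ws\<close> complete the block of
    \<open>c\<close> to a cut \<open>mm\<close> of the interval around \<open>c\<close>.\<close>
  also have "\<dots> = (\<Sum>(Z, us, X)\<in>inner_cuts L. \<Sum>(Y, zs, Z')\<in>inner_cuts R.
      \<Sum>mm\<in>cuts (X @ c # Y). \<Sum>nn\<in>cuts (Z' @ n # Z). \<Sum>uss\<in>cuts us. \<Sum>zss\<in>cuts zs.
      ksign (?rot Z) (C (map t uss) (t mm) (map t zss) (t nn)))"
  proof (intro sum.cong refl, clarify, intro sum.cong refl, clarify)
    fix Z us X Y zs Z'
    assume L: "(Z, us, X) \<in> inner_cuts L" and R: "(Y, zs, Z') \<in> inner_cuts R"
    have c: "c \<notin> set X" "c \<notin> set Y" using L R dist by (auto simp: inner_cuts_def)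
    show "(\<Sum>(vs, Lb)\<in>prefix_cuts X. \<Sum>(Ra, ws)\<in>suffix_cuts Y.
      \<Sum>nn\<in>cuts (Z' @ n # Z). \<Sum>uss\<in>cuts us. \<Sum>zss\<in>cuts zs.
      ksign (?rot Z) (C (map t uss) (t (vs @ (Lb @ c # Ra) # ws)) (map t zss) (t nn))) =
      (\<Sum>mm\<in>cuts (X @ c # Y). \<Sum>nn\<in>cuts (Z' @ n # Z). \<Sum>uss\<in>cuts us. \<Sum>zss\<in>cuts zs.
      ksign (?rot Z) (C (map t uss) (t mm) (map t zss) (t nn)))"
      by (rule sum_cuts_pointed[OF c, symmetric])
  qed
  also have "\<dots> = (\<Sum>(Z, us, X)\<in>inner_cuts L. \<Sum>uss\<in>cuts us. \<Sum>(Y, zs, Z')\<in>inner_cuts R. \<Sum>zss\<in>cuts zs.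
      \<Sum>mm\<in>cuts (X @ c # Y). \<Sum>nn\<in>cuts (Z' @ n # Z).
      ksign (?rot Z) (C (map t uss) (t mm) (map t zss) (t nn)))"
    by (subst sum_swap_pairs_flat) (simp only: sum_swap_in_triple)
  \<comment> \<open>For the algebra arguments, fine cuts with groupings are exchanged for coarse
    cuts with a cut of each block.\<close>
  also have "\<dots> = (\<Sum>(Z, us, X)\<in>inner_cuts L. \<Sum>uss\<in>listset (map cuts us).
      \<Sum>(Y, zs, Z')\<in>inner_cuts R. \<Sum>zss\<in>listset (map cuts zs).
      \<Sum>mm\<in>cuts (X @ c # Y). \<Sum>nn\<in>cuts (Z' @ n # Z).
      ksign (?rot Z) (C (map t uss) (t mm) (map t zss) (t nn)))"
    by (simp only: sum_inner_cuts_refine)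
  also have "\<dots> = (\<Sum>(Z, us, X)\<in>inner_cuts L. \<Sum>(Y, zs, Z')\<in>inner_cuts R.
      \<Sum>uss\<in>listset (map cuts us). \<Sum>zss\<in>listset (map cuts zs).
      \<Sum>mm\<in>cuts (X @ c # Y). \<Sum>nn\<in>cuts (Z' @ n # Z).
      ksign (?rot Z) (C (map t uss) (t mm) (map t zss) (t nn)))"
    by (simp only: sum_swap_in_triple)
  also have "\<dots> = cyclic_value C w L c R n y"
    unfolding cyclic_value_def
  proof (intro sum.cong refl, clarify, intro sum.cong refl, clarify)
    fix Z us X Y zs Z'
    assume L: "(Z, us, X) \<in> inner_cuts L" and R: "(Y, zs, Z') \<in> inner_cuts R"
    note sub = sub[OF L R]
    let ?M = "X @ c # Y" and ?N = "Z' @ n # Z"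
    have tG: "t zs' \<in> homog G" "snd (t zs') \<in> G (weight w J + 1)" if "J \<in> Blocks" "zs' \<in> cuts J" for J zs'
      using k[OF that] that by (auto simp: t_def homog_def cuts_def)
    have yG: "y J \<in> G (weight w J + 1)" if "J \<in> Blocks" for J
      unfolding y_def by (rule G_sum) (rule k[OF that])
    have y_el: "el w y J = (weight w J + 1, \<Sum>zs\<in>cuts J. snd (t zs))" for J
      by (simp add: el_def y_def t_def)
    have yhom: "map (el w y) Js \<in> lists (homog G)" if "set Js \<subseteq> Blocks" for Js
      using yG that by (auto simp: in_lists_conv_set el_def homog_def)
    have t_eq: "t zs' = (weight w J + 1, snd (t zs'))" if "zs' \<in> cuts J" for J zs'
      using that by (auto simp: t_def cuts_def)
    have t_hom: "map t zss \<in> lists (homog G)" if "zss \<in> listset (map cuts Js)" "set Js \<subseteq> Blocks" for zss Js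
    proof -
      have "t zs' \<in> homog G" if zs': "zs' \<in> set zss" for zs'
      proof -
        have "concat zs' \<in> set Js" "[] \<notin> set zs'"
          using \<open>zss \<in> _\<close> zs' by (auto simp: in_listset_cuts)
        then show ?thesis using tG(1)[of "concat zs'" zs'] \<open>set Js \<subseteq> Blocks\<close> by (auto simp: cuts_def)
      qed
      then show ?thesis by (auto simp: in_lists_conv_set)
    qed
    have expand: "F (map (el w y) Js) = (\<Sum>zss\<in>listset (map cuts Js). F (map t zss))"
      if "set Js \<subseteq> Blocks" and "\<And>a b d. a \<in> lists (homog G) \<Longrightarrow> b \<in> lists (homog G) \<Longrightarrow>
        additive_on (G d) (\<lambda>x. F (a @ (d, x) # b))" for F :: "_ \<Rightarrow> 'r" and Js
      unfolding y_def t_def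
      by (rule sum_listset_expand) (use that k in auto)
    have "C (map (el w y) us) (el w y ?M) (map (el w y) zs) (el w y ?N) =
      (\<Sum>uss\<in>listset (map cuts us). C (map t uss) (el w y ?M) (map (el w y) zs) (el w y ?N))"
      by (rule expand[OF sub(1)], rule C_additive1) (use yhom[of "[?M]"] yhom[of "[?N]"] yhom[of zs] sub in auto)
    also have "\<dots> = (\<Sum>uss\<in>listset (map cuts us). \<Sum>zss\<in>listset (map cuts zs).
        C (map t uss) (el w y ?M) (map t zss) (el w y ?N))"
      by (intro sum.cong refl, rule expand[OF sub(3)], rule C_additive3)
        (use yhom[of "[?M]"] yhom[of "[?N]"] sub t_hom in auto)
    also have "\<dots> = (\<Sum>uss\<in>listset (map cuts us). \<Sum>zss\<in>listset (map cuts zs).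
        \<Sum>mm\<in>cuts ?M. C (map t uss) (t mm) (map t zss) (el w y ?N))"
    proof (intro sum.cong refl)
      fix uss zss assume "uss \<in> listset (map cuts us)" "zss \<in> listset (map cuts zs)"
      then have add: "additive_on (G (weight w ?M + 1)) (\<lambda>x. C (map t uss) (weight w ?M + 1, x) (map t zss) (el w y ?N))"
        using t_hom sub yhom[of "[?N]"] by (intro C_additive2) auto
      have "C (map t uss) (el w y ?M) (map t zss) (el w y ?N) =
          (\<Sum>mm\<in>cuts ?M. C (map t uss) (weight w ?M + 1, snd (t mm)) (map t zss) (el w y ?N))"
        unfolding y_el[of ?M] by (rule additive_on_sum[OF add]) (rule tG(2)[OF sub(2)])
      then show "C (map t uss) (el w y ?M) (map t zss) (el w y ?N) =
          (\<Sum>mm\<in>cuts ?M. C (map t uss) (t mm) (map t zss) (el w y ?N))"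
        using t_eq[of _ ?M] by (metis (mono_tags, lifting) sum.cong)
    qed
    also have "\<dots> = (\<Sum>uss\<in>listset (map cuts us). \<Sum>zss\<in>listset (map cuts zs).
        \<Sum>mm\<in>cuts ?M. \<Sum>nn\<in>cuts ?N. C (map t uss) (t mm) (map t zss) (t nn))"
    proof (intro sum.cong refl)
      fix uss zss mm assume "uss \<in> listset (map cuts us)" "zss \<in> listset (map cuts zs)" "mm \<in> cuts ?M"
      then have add: "additive_on (G (weight w ?N + 1)) (\<lambda>x. C (map t uss) (t mm) (map t zss) (weight w ?N + 1, x))"
        using t_hom sub tG by (intro C_additive4) auto
      have "C (map t uss) (t mm) (map t zss) (el w y ?N) =
          (\<Sum>nn\<in>cuts ?N. C (map t uss) (t mm) (map t zss) (weight w ?N + 1, snd (t nn)))"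
        unfolding y_el[of ?N] by (rule additive_on_sum[OF add]) (rule tG(2)[OF sub(4)])
      then show "C (map t uss) (t mm) (map t zss) (el w y ?N) =
          (\<Sum>nn\<in>cuts ?N. C (map t uss) (t mm) (map t zss) (t nn))"
        using t_eq[of _ ?N] by (metis (mono_tags, lifting) sum.cong)
    qed
    finally show "(\<Sum>uss\<in>listset (map cuts us). \<Sum>zss\<in>listset (map cuts zs).
      \<Sum>mm\<in>cuts ?M. \<Sum>nn\<in>cuts ?N. ksign (?rot Z) (C (map t uss) (t mm) (map t zss) (t nn))) =
      ksign (?rot Z) (C (map (el w y) us) (el w y ?M) (map (el w y) zs) (el w y ?N))"
      by (simp only: ksign_sum)
  qed
  finally show ?thesis .
qed


section \<open>Families obtained from the transferred morphism\<close>

definition staircase :: "((int \<times> 'a) list \<Rightarrow> 'a::ab_group_add) \<Rightarrow> ('i \<Rightarrow> int) \<Rightarrow> ('i list \<Rightarrow> 'a) \<Rightarrow> 'i list \<Rightarrow> 'a" where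
  "staircase \<mu> w v J = (\<Sum>vs\<in>cuts2 J. shifted \<mu> (map (el w v) vs))"

lemma cuts_in_Blocks:
  assumes "\<forall>a J b. a @ J @ b \<in> Blocks \<longrightarrow> J \<noteq> [] \<longrightarrow> J \<in> Blocks"
    and "vs \<in> cuts J" "J \<in> Blocks" "V \<in> set vs"
  shows "V \<in> Blocks"
proof -
  obtain a b where "vs = a @ V # b" using assms(4) by (meson split_list)
  with assms(2) have "J = concat a @ V @ concat b" "V \<noteq> []" by (auto simp: cuts_def)
  with assms(1,3) show ?thesis by blast
qed

lemma staircase_cong:
  assumes "\<And>vs V. vs \<in> cuts2 J \<Longrightarrow> V \<in> set vs \<Longrightarrow> v V = v' V"
  shows "staircase \<mu> w v J = staircase \<mu> w v' J"
  unfolding staircase_def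
proof (rule sum.cong[OF refl])
  fix vs assume "vs \<in> cuts2 J"
  with assms have "map (el w v) vs = map (el w v') vs" by (auto simp: el_def)
  then show "shifted \<mu> (map (el w v) vs) = shifted \<mu> (map (el w v') vs)" by (rule arg_cong)
qed

locale transfer_data = ainf_algebra sB B \<nu>
  for sB :: "'r::comm_ring_1 \<Rightarrow> 'b::ab_group_add \<Rightarrow> 'b" and B and \<nu> +
  fixes sA :: "'r \<Rightarrow> 'a::ab_group_add \<Rightarrow> 'a" and A :: "int \<Rightarrow> 'a set" and dA :: "'a \<Rightarrow> 'a"
    and f :: "'b \<Rightarrow> 'a" and g :: "'a \<Rightarrow> 'b" and h :: "'b \<Rightarrow> 'b"
  assumes complex: "chain_complex sA A dA"
    and f_hom: "graded_hom sB B sA A 0 f"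
    and f_chain: "\<forall>(d, y)\<in>homog B. f (\<nu> [(d, y)]) = dA (f y)"
    and g_hom: "graded_hom sA A sB B 0 g"
    and g_chain: "\<forall>(d, x)\<in>homog A. g (dA x) = \<nu> [(d, g x)]"
    and h_hom: "graded_hom sB B sB B (- 1) h"
    and homotopy: "\<forall>(d, y)\<in>homog B. g (f y) - y = \<nu> [(d - 1, h y)] + h (\<nu> [(d, y)])"
begin

lemma f_zero: "f 0 = 0" and f_neg: "f (- x) = - f x"
  and f_sum: "f (sum F S) = (\<Sum>i\<in>S. f (F i))" and f_in: "x \<in> B d \<Longrightarrow> f x \<in> A d"
proof -
  interpret f: module_hom sB sA f using f_hom by (simp add: graded_hom_def)
  show "f 0 = 0" "f (- x) = - f x" "f (sum F S) = (\<Sum>i\<in>S. f (F i))"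
    by (simp_all add: f.zero f.neg f.sum)
  show "x \<in> B d \<Longrightarrow> f x \<in> A d" using f_hom by (force simp: graded_hom_def)
qed

lemma h_zero: "h 0 = 0" and h_neg: "h (- x) = - h x"
  and h_sum: "h (sum F S) = (\<Sum>i\<in>S. h (F i))" and h_in: "x \<in> B d \<Longrightarrow> h x \<in> B (d - 1)"
proof -
  interpret h: module_hom sB sB h using h_hom by (simp add: graded_hom_def)
  show "h 0 = 0" "h (- x) = - h x" "h (sum F S) = (\<Sum>i\<in>S. h (F i))"
    by (simp_all add: h.zero h.neg h.sum)
  show "x \<in> B d \<Longrightarrow> h x \<in> B (d - 1)" using h_hom unfolding graded_hom_def
    by (metis (no_types, lifting) add_uminus_conv_diff image_subset_iff)
qed

lemma g_neg: "g (- x) = - g x" and g_in: "x \<in> A d \<Longrightarrow> g x \<in> B d"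
proof -
  interpret g: module_hom sA sB g using g_hom by (simp add: graded_hom_def)
  show "g (- x) = - g x" by (simp add: g.neg)
  show "x \<in> A d \<Longrightarrow> g x \<in> B d" using g_hom by (force simp: graded_hom_def)
qed

lemma f_ksign: "f (ksign e x) = ksign e (f x)" by (simp add: ksign_def f_neg)
lemma h_ksign: "h (ksign e x) = ksign e (h x)" by (simp add: ksign_def h_neg)

lemma shifted_transfer_mu:
  assumes "2 \<le> length xs"
  shows "shifted (transfer_mu dA \<nu> f g h) xs = f (shifted_p \<nu> h (map (apsnd g) xs))"
  using assms by (simp add: shifted_def[of "transfer_mu dA \<nu> f g h"] transfer_mu_def transfer_p_def
      shifted_def[of "shifted_p \<nu> h"] f_ksign ksign_ksign comp_def) (simp add: ksign_def)

lemma shifted_transfer_k: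
  assumes "2 \<le> length xs"
  shows "shifted (transfer_k \<nu> g h) xs = h (shifted_p \<nu> h (map (apsnd g) xs))"
  using assms by (simp add: shifted_def[of "transfer_k \<nu> g h"] transfer_k_def transfer_p_def
      shifted_def[of "shifted_p \<nu> h"] h_ksign ksign_ksign comp_def) (simp add: ksign_def)

end

section \<open>The family in \<open>B\<close> induced by a family in \<open>A\<close>\<close>

locale transfer_blocks = transfer_data sB B \<nu> sA A dA f g h
  for sB :: "'r::comm_ring_1 \<Rightarrow> 'b::ab_group_add \<Rightarrow> 'b" and B and \<nu>
    and sA :: "'r \<Rightarrow> 'a::ab_group_add \<Rightarrow> 'a" and A dA f g h +
  fixes w :: "'i \<Rightarrow> int" and Blocks :: "'i list set" and x :: "'i list \<Rightarrow> 'a"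
  assumes closed: "\<forall>a J b. a @ J @ b \<in> Blocks \<longrightarrow> J \<noteq> [] \<longrightarrow> J \<in> Blocks"
    and Blocks_nonempty: "[] \<notin> Blocks"
    and x_in: "J \<in> Blocks \<Longrightarrow> x J \<in> A (weight w J + 1)"
begin

abbreviation "k \<equiv> transfer_k \<nu> g h"

definition p :: "'i list list \<Rightarrow> 'b" where
  "p zs = shifted_p \<nu> h (map (apsnd g) (map (el w x) zs))"

definition t :: "'i list list \<Rightarrow> int \<times> 'b" where
  "t zs = (weight w (concat zs) + 1, shifted k (map (el w x) zs))"

definition kx :: "'i list \<Rightarrow> 'b" where
  "kx J = (\<Sum>zs\<in>cuts J. shifted k (map (el w x) zs))"

lemma t_single: "t [J] = (weight w J + 1, g (x J))"
  by (simp add: t_def transfer_k_def el_def)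

lemma t_ge2: "2 \<le> length zs \<Longrightarrow> t zs = (weight w (concat zs) + 1, h (p zs))"
  by (simp add: t_def p_def shifted_transfer_k)

text \<open>The leaves of the recursion carry \<open>g (x J)\<close>, which is \<open>k\<close> on
  one input; larger groups carry \<open>h\<close> of \<open>p\<close>, which is \<open>k\<close> on
  several. So \<open>p\<close> is expressed by \<open>\<nu>\<close> and values of \<open>k\<close>
  alone.\<close>

lemma p_rec: "p zs = (\<Sum>yss\<in>cuts2 zs. shifted \<nu> (map t yss))"
proof -
  let ?u = "\<lambda>ys. if length ys = 1 then hd ys else (sdegs ys + 1, h (shifted_p \<nu> h ys))"
  have "p zs = (\<Sum>yss\<in>cuts2 zs. shifted \<nu> (map ?u (map (map (apsnd g \<circ> el w x)) yss)))"
    unfolding p_def map_map[of "apsnd g"] by (subst shifted_p.simps) (rule sum_cuts2_map)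
  also have "\<dots> = (\<Sum>yss\<in>cuts2 zs. shifted \<nu> (map t yss))"
  proof (rule sum.cong[OF refl])
    fix yss assume yss: "yss \<in> cuts2 zs"
    have "?u (map (apsnd g \<circ> el w x) ys) = t ys" if "ys \<in> set yss" for ys
    proof (cases "length ys = 1")
      case True
      then obtain J where "ys = [J]" by (auto simp: length_Suc_conv)
      then show ?thesis by (simp add: t_single el_def)
    next
      case False
      have "ys \<noteq> []" using that yss by (auto simp: cuts2_def cuts_def)
      with False have "2 \<le> length ys" by (cases ys; cases "tl ys") auto
      moreover have "sdegs (map (apsnd g \<circ> el w x) ys) = weight w (concat ys)"
        by (induction ys) (auto simp: sdeg_def el_def)
      ultimately show ?thesis using False by (simp add: t_ge2 p_def)
    qed
    then have "map ?u (map (map (apsnd g \<circ> el w x)) yss) = map t yss" by simp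
    then show "shifted \<nu> (map ?u (map (map (apsnd g \<circ> el w x)) yss)) = shifted \<nu> (map t yss)" by (rule arg_cong)
  qed
  finally show ?thesis .
qed

lemma sdegs_map_t: "sdegs (map t yss) = weight w (concat (concat yss))"
  by (induction yss) (auto simp: t_def sdeg_def)

text \<open>Both degrees are obtained together: \<open>p\<close> on a list uses \<open>t\<close> on
  shorter lists, and \<open>t\<close> uses \<open>p\<close> on the same list.\<close>

lemma p_t_in:
  "concat zs \<in> Blocks \<Longrightarrow> [] \<notin> set zs \<Longrightarrow>
    snd (t zs) \<in> B (weight w (concat zs) + 1) \<and> p zs \<in> B (weight w (concat zs) + 2)"
proof (induction "length zs" arbitrary: zs rule: less_induct)
  case less
  have p: "p zs \<in> B (weight w (concat zs) + 2)" unfolding p_rec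
  proof (rule G_sum)
    fix yss assume yss: "yss \<in> cuts2 zs"
    then have eq: "concat yss = zs" "[] \<notin> set yss" "yss \<noteq> []" by (auto simp: cuts2_def cuts_def)
    have "t ys \<in> homog B" if "ys \<in> set yss" for ys
    proof -
      obtain a b where "yss = a @ ys # b" using \<open>ys \<in> set yss\<close> by (meson split_list)
      then have zs: "zs = concat a @ ys @ concat b" "ys \<noteq> []" using eq by auto
      then have "concat zs = concat (concat a) @ concat ys @ concat (concat b)" "[] \<notin> set ys"
        using less.prems by auto
      moreover from \<open>[] \<notin> set ys\<close> \<open>ys \<noteq> []\<close> have "concat ys \<noteq> []" by (cases ys) auto
      ultimately have "concat ys \<in> Blocks" using closed less.prems(1) by metis
      from less.hyps[OF length_cuts2_less[OF yss that] this \<open>[] \<notin> set ys\<close>]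
      show ?thesis by (simp add: t_def homog_def)
    qed
    then have "map t yss \<in> lists (homog B)" by (auto simp: in_lists_conv_set)
    from shifted_in_G[OF this] eq show "shifted \<nu> (map t yss) \<in> B (weight w (concat zs) + 2)"
      by (simp add: sdegs_map_t)
  qed
  have "zs \<noteq> []" using less.prems Blocks_nonempty by auto
  then consider J where "zs = [J]" | "2 \<le> length zs" by (cases zs; cases "tl zs") auto
  then have "snd (t zs) \<in> B (weight w (concat zs) + 1)"
  proof cases
    case 1
    then show ?thesis using less.prems x_in[of J] by (simp add: t_single g_in)
  next
    case 2
    then show ?thesis using h_in[OF p] by (simp add: t_ge2 add_diff_eq[symmetric])
  qed
  with p show ?case by simp
qed

lemma k_in: "J \<in> Blocks \<Longrightarrow> zs \<in> cuts J \<Longrightarrow> shifted k (map (el w x) zs) \<in> B (weight w J + 1)"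
  using p_t_in[of zs] by (simp add: t_def cuts_def)

lemma kx_in: "J \<in> Blocks \<Longrightarrow> kx J \<in> B (weight w J + 1)"
  unfolding kx_def by (rule G_sum) (rule k_in)

text \<open>By \<open>p_rec\<close> the outermost operation of \<open>p\<close> groups a fine cut of
  \<open>J\<close>. The groups fill coarse intervals, and the sum over all cuts of such an interval
  is \<open>kx\<close> there.\<close>

lemma sum_p:
  assumes J: "J \<in> Blocks"
  shows "(\<Sum>zs\<in>cuts2 J. p zs) = staircase \<nu> w kx J"
proof -
  have ne: "J \<noteq> []" using J Blocks_nonempty by auto
  \<comment> \<open>Hence \<open>p [J] = 0\<close>, and the sum extends from \<open>cuts2 J\<close>
    to \<open>cuts J\<close>, the form needed for regrouping.\<close>
  have "cuts2 [J] = {}"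
    using length_le_concat by (fastforce simp: cuts2_def cuts_def)
  then have "(\<Sum>zs\<in>cuts2 J. p zs) = (\<Sum>zs\<in>cuts J. \<Sum>yss\<in>cuts2 zs. shifted \<nu> (map t yss))"
    by (simp add: sum_cuts_insert[OF ne] p_rec)
  also have "\<dots> = (\<Sum>Js\<in>cuts2 J. \<Sum>yss\<in>listset (map cuts Js). shifted \<nu> (map t yss))"
    by (rule sum_cuts2_refine)
  also have "\<dots> = staircase \<nu> w kx J"
    unfolding staircase_def
  proof (rule sum.cong[OF refl])
    fix Js assume "Js \<in> cuts2 J"
    then have Js: "V \<in> Blocks" if "V \<in> set Js" for V
      using cuts_in_Blocks[OF closed _ J that] by (simp add: cuts2_def)
    show "(\<Sum>yss\<in>listset (map cuts Js). shifted \<nu> (map t yss)) = shifted \<nu> (map (el w kx) Js)"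
      unfolding kx_def t_def
      by (rule sum_listset_expand[symmetric]) (auto intro: shifted_additive k_in Js)
  qed
  finally show ?thesis .
qed

lemma kx_rec:
  assumes J: "J \<in> Blocks"
  shows "kx J = g (x J) + h (staircase \<nu> w kx J)"
proof -
  have ne: "J \<noteq> []" using J Blocks_nonempty by auto
  have "kx J = snd (t [J]) + (\<Sum>zs\<in>cuts2 J. snd (t zs))"
    by (simp add: kx_def t_def sum_cuts_insert[OF ne])
  also have "(\<Sum>zs\<in>cuts2 J. snd (t zs)) = (\<Sum>zs\<in>cuts2 J. h (p zs))"
    by (rule sum.cong) (auto simp: cuts2_def t_ge2)
  finally show ?thesis by (simp add: t_single h_sum[symmetric] sum_p[OF J])
qed

lemma staircase_transfer_mu:
  assumes J: "J \<in> Blocks"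
  shows "staircase (transfer_mu dA \<nu> f g h) w x J = f (staircase \<nu> w kx J)"
proof -
  have "staircase (transfer_mu dA \<nu> f g h) w x J = (\<Sum>zs\<in>cuts2 J. f (p zs))"
    unfolding staircase_def p_def by (rule sum.cong) (auto simp: cuts2_def shifted_transfer_mu simp del: map_map)
  then show ?thesis by (simp add: f_sum[symmetric] sum_p[OF J])
qed

end


section \<open>Defining systems as families indexed by intervals\<close>

lemma upt_segment:
  assumes "us @ seg @ ws = [a..<b]" "seg \<noteq> []"
  shows "seg = [hd seg..<last seg + 1]" "a \<le> hd seg" "hd seg \<le> last seg" "last seg < b"
proof -
  have len: "length us + length seg \<le> b - a"
    using arg_cong[OF assms(1), of length] by simp
  with assms(2) have "a + length us + length seg \<le> b" by (cases seg) auto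
  then have "take (length seg) (drop (length us) [a..<b]) = [a + length us..<a + length us + length seg]"
    by (simp add: drop_upt take_upt)
  then have seg: "seg = [a + length us..<a + length us + length seg]"
    using assms(1) by (metis append_eq_conv_conj)
  obtain m where m: "length seg = Suc m" using assms(2) by (cases seg) auto
  then have seg': "seg = [a + length us..<a + length us + m + 1]" using seg by simp
  have "hd seg = a + length us" "last seg = a + length us + m"
    using hd_upt[of "a + length us" "a + length us + m + 1"] last_upt[of "a + length us" "a + length us + m + 1"]
    unfolding seg'[symmetric] by simp_all
  then show "seg = [hd seg..<last seg + 1]" "a \<le> hd seg" "hd seg \<le> last seg" "last seg < b"
    using seg' m len by auto
qed

text \<open>End points determine an interval of either order: it wraps around past \<open>n\<close>
  exactly when \<open>i\<close> exceeds \<open>j\<close>.\<close>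

definition arc :: "nat \<Rightarrow> nat \<Rightarrow> nat \<Rightarrow> nat list" where
  "arc n i j = (if i \<le> j then [i..<j + 1] else [i..<n + 1] @ [1..<j + 1])"

lemma index_order_eq: "index_order s t = [1..<s + 1] @ (s + 1) # [s + 2..<s + t + 2]"
  unfolding index_order_def
  using upt_add_eq_append[of 1 "s + 1" "t + 1"] upt_conv_Cons[of "s + 1" "s + t + 2"] by simp

lemma index_order'_eq: "index_order' s t = [s + 2..<s + t + 2] @ (s + t + 2) # [1..<s + 1]"
  unfolding index_order'_def using upt_Suc_append[of "s + 2" "s + t + 2"] by (simp add: numeral_eq_Suc)

lemma intervals_closed: "a @ J @ b \<in> intervals ord \<Longrightarrow> J \<noteq> [] \<Longrightarrow> J \<in> intervals ord"
  unfolding intervals_def by (auto, metis append.assoc)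

lemma arc_index_order:
  assumes "J \<in> intervals (index_order s t)"
  shows "arc (s + t + 2) (hd J) (last J) = J" "1 \<le> hd J" "hd J \<le> last J" "last J \<le> s + t + 1"
proof -
  from assms obtain us ws where "us @ J @ ws = [1..<s + t + 2]" "J \<noteq> []"
    by (auto simp: intervals_def index_order_def)
  from upt_segment[OF this]
  show "arc (s + t + 2) (hd J) (last J) = J" "1 \<le> hd J" "hd J \<le> last J" "last J \<le> s + t + 1"
    by (auto simp: arc_def)
qed

lemma arc_index_order':
  assumes "J \<in> intervals (index_order' s t)"
  shows "arc (s + t + 2) (hd J) (last J) = J"
proof -
  let ?P = "[s + 2..<s + t + 3]" and ?Q = "[1..<s + 1]"
  from assms obtain us ws where eq: "us @ J @ ws = ?P @ ?Q" and ne: "J \<noteq> []"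
    by (auto simp: intervals_def index_order'_def)
  from eq obtain zs where "us = ?P @ zs \<and> zs @ J @ ws = ?Q \<or> us @ zs = ?P \<and> J @ ws = zs @ ?Q"
    by (auto simp: append_eq_append_conv2)
  then show ?thesis
  proof (elim disjE conjE)
    assume "zs @ J @ ws = ?Q"
    from upt_segment[OF this ne] show ?thesis by (simp add: arc_def)
  next
    assume zs: "us @ zs = ?P" and J: "J @ ws = zs @ ?Q"
    from J obtain ys where "J = zs @ ys \<and> ys @ ws = ?Q \<or> J @ ys = zs \<and> ws = ys @ ?Q"
      by (auto simp: append_eq_append_conv2)
    then show ?thesis
    proof (elim disjE conjE)
      assume "J @ ys = zs"
      with zs have "us @ J @ ys = ?P" by simp
      from upt_segment[OF this ne] show ?thesis by (simp add: arc_def)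
    next
      assume Jeq: "J = zs @ ys" and ys: "ys @ ws = ?Q"
      show ?thesis
      proof (cases "zs = [] \<or> ys = []")
        case True
        then have "us @ J @ [] = ?P \<or> [] @ J @ ws = ?Q" using Jeq ys zs by auto
        then show ?thesis
          using upt_segment[of us J "[]" "s + 2" "s + t + 3"] upt_segment[of "[]" J ws 1 "s + 1"] ne
          by (auto simp: arc_def)
      next
        case False
        have "us @ zs @ [] = ?P" using zs by simp
        note z = upt_segment[OF this]
        have "[] @ ys @ ws = ?Q" using ys by simp
        note y = upt_segment[OF this]
        have "last zs = s + t + 2"
          using arg_cong[OF zs, of last] False by simp
        moreover have "hd ys = 1"
          using arg_cong[OF ys, of hd] False y(2-4) by (subst (asm) hd_upt) auto
        ultimately show ?thesis
          using False z y Jeq by (simp add: arc_def)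
      qed
    qed
  qed
qed

text \<open>The second order omits \<open>s + 1\<close> and the first omits
  \<open>s + t + 2\<close>. A common interval therefore lies strictly on one side of
  \<open>s + 1\<close>, and its end points are among those where the two triangular families are
  required to agree.\<close>

lemma arc_overlap:
  assumes J: "J \<in> intervals (index_order s t)" "J \<in> intervals (index_order' s t)"
  shows "(1 \<le> hd J \<and> hd J \<le> last J \<and> last J \<le> s) \<or> (s + 2 \<le> hd J \<and> hd J \<le> last J \<and> last J \<le> s + t + 1)"
proof -
  note b = arc_index_order[OF J(1)]
  have "set J \<subseteq> set (index_order' s t)" using J(2) by (auto simp: intervals_def)
  then have "s + 1 \<notin> set J" by (auto simp: index_order'_def)
  moreover have "J = [hd J..<last J + 1]" using b by (simp add: arc_def)
  then have "s + 1 \<in> set J" if "hd J \<le> s + 1" "s + 1 \<le> last J" using that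
    by (metis atLeastLessThan_iff less_add_one order_le_less_trans set_upt)
  ultimately show ?thesis using b by linarith
qed

definition defining_family ::
  "(int \<Rightarrow> 'a set) \<Rightarrow> ((int \<times> 'a) list \<Rightarrow> 'a::ab_group_add) \<Rightarrow> ('i \<Rightarrow> int) \<Rightarrow> 'i list set \<Rightarrow>
    ('i \<Rightarrow> 'a) \<Rightarrow> ('i list \<Rightarrow> 'a) \<Rightarrow> bool" where
  "defining_family G \<mu> w Blocks a v \<longleftrightarrow>
    (\<forall>J\<in>Blocks. v J \<in> G (weight w J + 1) \<and> \<mu> [el w v J] = - staircase \<mu> w v J) \<and>
    (\<forall>i. [i] \<in> Blocks \<longrightarrow> v [i] = a i)"

lemma staircase_product_eq:
  assumes "\<And>J. J \<in> intervals ord \<Longrightarrow> entry x J = el w v J" "J \<in> intervals ord"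
  shows "staircase_product \<mu> x J = staircase \<mu> w v J"
  unfolding staircase_product_def staircase_def
proof (rule sum.cong[OF refl])
  fix vs assume vs: "vs \<in> cuts2 J"
  have closed: "\<forall>a J b. a @ J @ b \<in> intervals ord \<longrightarrow> J \<noteq> [] \<longrightarrow> J \<in> intervals ord"
    using intervals_closed by blast
  have "entry x V = el w v V" if "V \<in> set vs" for V
    by (rule assms(1), rule cuts_in_Blocks[OF closed _ assms(2) that]) (use vs in \<open>simp add: cuts2_def\<close>)
  then have "map (entry x) vs = map (el w v) vs" by simp
  then show "shifted \<mu> (map (entry x) vs) = shifted \<mu> (map (el w v) vs)" by (rule arg_cong)
qed

lemma sdegs_weight:
  assumes "\<And>i. 1 \<le> i \<Longrightarrow> i \<le> length xs \<Longrightarrow> w i = sdeg (xs ! (i - 1))"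
  shows "j \<le> length xs \<Longrightarrow> sdegs (take j xs) = weight w [1..<j + 1]"
proof (induction j)
  case (Suc j)
  then have "sdegs (take (Suc j) xs) = sdegs (take j xs) + sdeg (xs ! j)"
    by (simp add: take_Suc_conv_app_nth)
  with Suc assms[of "Suc j"] show ?case by simp
qed simp

lemma append_eq_upt:
  assumes "xs @ ys = [a..<b]" "a \<le> b"
  shows "xs = [a..<a + length xs]" "ys = [a + length xs..<b]" "a + length xs + length ys = b"
proof -
  show len: "a + length xs + length ys = b"
    using arg_cong[OF assms(1), of length] assms(2) by simp
  have "[a..<b] = [a..<a + length xs] @ [a + length xs..<b]"
    using upt_add_eq_append[of a "a + length xs" "length ys"] len by simp
  with assms(1) have "xs @ ys = [a..<a + length xs] @ [a + length xs..<b]" by simp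
  then show "xs = [a..<a + length xs]" "ys = [a + length xs..<b]"
    by (subst (asm) append_eq_append_conv, simp, simp)+
qed

lemma upt_pointed:
  fixes c :: nat
  assumes "p \<le> c" "c \<le> q"
  shows "[p..<q + 1] = [p..<c] @ c # [c + 1..<q + 1]"
  using assms upt_add_eq_append[of p c "q + 1 - c"] upt_conv_Cons[of c "q + 1"] by simp

lemma pointed_cuts_upt:
  assumes "p \<le> c" "c \<le> q"
  shows "(uss, vs, wss) \<in> pointed_cuts c [p..<q + 1] \<longleftrightarrow>
    (\<exists>Lb Ra. vs = Lb @ c # Ra \<and> concat uss @ Lb = [p..<c] \<and> Ra @ concat wss = [c + 1..<q + 1] \<and>
      [] \<notin> set uss \<and> [] \<notin> set wss)" (is "?l \<longleftrightarrow> ?r")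
proof
  assume l: ?l
  then obtain Lb Ra where vs: "vs = Lb @ c # Ra" by (auto simp: pointed_cuts_def dest: split_list)
  have "[p..<c] @ c # [c + 1..<q + 1] = (concat uss @ Lb) @ c # (Ra @ concat wss)"
    using l by (simp only: upt_pointed[OF assms, symmetric]) (simp add: pointed_cuts_def cuts_def vs)
  then have "concat uss @ Lb = [p..<c] \<and> Ra @ concat wss = [c + 1..<q + 1]"
    by (subst (asm) append_Cons_eq_iff) auto
  moreover have "[] \<notin> set uss" "[] \<notin> set wss" using l by (auto simp: pointed_cuts_def cuts_def)
  ultimately show ?r using vs by blast
next
  assume ?r
  then obtain Lb Ra where eq: "vs = Lb @ c # Ra" "concat uss @ Lb = [p..<c]"
      "Ra @ concat wss = [c + 1..<q + 1]" "[] \<notin> set uss" "[] \<notin> set wss"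
    by blast
  have "concat (uss @ vs # wss) = (concat uss @ Lb) @ c # (Ra @ concat wss)" by (simp add: eq(1))
  also have "\<dots> = [p..<q + 1]" by (simp only: eq(2,3) upt_pointed[OF assms])
  finally show ?l using eq by (auto simp: pointed_cuts_def cuts_def)
qed

text \<open>The bounds \<open>p\<close> and \<open>q\<close> record the uncut ends,
  \<open>L1 = [1..<p]\<close> and \<open>R2 = [q + 1..<s + t + 2]\<close>, and the pointed block
  consists of \<open>Lb\<close>, \<open>s + 1\<close> and \<open>Ra\<close>. The sign for moving the
  first \<open>p - 1\<close> entries past the others is the rotation sign of
  \<open>L1\<close>.\<close>

lemma staircase_inner_product_eq:
  fixes s t :: nat
  assumes len: "length xs = s + t + 2"
    and w: "\<And>i. 1 \<le> i \<Longrightarrow> i \<le> length xs \<Longrightarrow> w i = sdeg (xs ! (i - 1))"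
    and x: "\<And>J. J \<in> intervals (index_order s t) \<Longrightarrow> entry x J = el w v J"
    and x': "\<And>J. J \<in> intervals (index_order' s t) \<Longrightarrow> entry x' J = el w v J"
  shows "staircase_inner_product I s t xs x x' =
    cyclic_value (mshifted I) w [1..<s + 1] (s + 1) [s + 2..<s + t + 2] (s + t + 2) v"
proof -
  let ?L = "[1..<s + 1]" and ?c = "s + 1" and ?R = "[s + 2..<s + t + 2]" and ?n = "s + t + 2"
  let ?G = "\<lambda>p q (uss, vs, wss). ksign (sdegs (take (p - 1) xs) * sdegs (drop (p - 1) xs))
          (mshifted I (map (entry x) uss) (entry x vs) (map (entry x) wss)
            (x' (q + 1) (if p = 1 then s + t + 2 else p - 1)))"
  let ?i = "\<lambda>((L1, uss, Lb), (Ra, wss, R2)). (length L1 + 1, s + t + 1 - length R2, (uss, Lb @ ?c # Ra, wss))"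
  let ?j = "\<lambda>(p, q, (uss, vs, wss)). (([1..<p], uss, takeWhile (\<lambda>i. i \<noteq> ?c) vs),
            (tl (dropWhile (\<lambda>i. i \<noteq> ?c) vs), wss, [q + 1..<?n]))"
  let ?h = "\<lambda>((L1, uss, Lb), (Ra, wss, R2)). ksign (weight w L1 * (weight w (?L @ ?c # ?R @ [?n]) - weight w L1))
        (mshifted I (map (el w v) uss) (el w v (Lb @ ?c # Ra)) (map (el w v) wss) (el w v (R2 @ ?n # L1)))"
  let ?S = "SIGMA p:{1..s + 1}. SIGMA q:{s + 1..s + t + 1}. pointed_cuts (s + 1) [p..<q + 1]"
  have fin: "finite (pointed_cuts (s + 1) [p..<q + 1])" for p q
  proof (rule finite_imageD)
    show "finite ((\<lambda>(uss, vs, wss). (uss, [vs], wss)) ` pointed_cuts (s + 1) [p..<q + 1])"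
    proof (rule finite_subset)
      show "(\<lambda>(uss, vs, wss). (uss, [vs], wss)) ` pointed_cuts (s + 1) [p..<q + 1] \<subseteq>
        (\<Union>full\<in>cuts [p..<q + 1]. splits3 full)"
        by (force simp: pointed_cuts_def splits3_def)
    qed (simp add: finite_cuts finite_splits3)
  qed (auto simp: inj_on_def)
  have LcR: "[1..<?n] = ?L @ ?c # ?R" using index_order_eq[of s t] by (simp add: index_order_def)
  have total: "sdegs xs = weight w (?L @ ?c # ?R @ [?n])"
  proof -
    have "[1..<?n + 1] = (?L @ ?c # ?R) @ [?n]" unfolding LcR[symmetric] by simp
    then show ?thesis using sdegs_weight[OF w, of "length xs"] len by simp
  qed
  have "staircase_inner_product I s t xs x x' = (\<Sum>(p, q, r)\<in>?S. ?G p q r)"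
    unfolding staircase_inner_product_def split_def
    by (simp only: sum.Sigma fin finite_atLeastAtMost finite_SigmaI ball_triv simp_thms split_def)
  also have "\<dots> = (\<Sum>((L1, uss, Lb), (Ra, wss, R2))\<in>inner_cuts ?L \<times> inner_cuts ?R.
      ksign (weight w L1 * (weight w (?L @ ?c # ?R @ [?n]) - weight w L1))
        (mshifted I (map (el w v) uss) (el w v (Lb @ ?c # Ra)) (map (el w v) wss) (el w v (R2 @ ?n # L1))))"
  proof (rule sum.reindex_bij_witness[of _ ?i ?j])
    fix a assume "a \<in> ?S"
    then obtain p q uss vs wss where a: "a = (p, q, (uss, vs, wss))" and pq: "1 \<le> p" "p \<le> s + 1"
        "s + 1 \<le> q" "q \<le> s + t + 1" and r: "(uss, vs, wss) \<in> pointed_cuts ?c [p..<q + 1]"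
      by auto
    from r obtain Lb Ra where vs: "vs = Lb @ ?c # Ra" and eq: "concat uss @ Lb = [p..<?c]"
        "Ra @ concat wss = [?c + 1..<q + 1]" and ne: "[] \<notin> set uss" "[] \<notin> set wss"
      unfolding pointed_cuts_upt[OF pq(2,3)] by blast
    have "?c \<notin> set (concat uss @ Lb)" unfolding eq by simp
    then have tw: "takeWhile (\<lambda>i. i \<noteq> ?c) vs = Lb" "tl (dropWhile (\<lambda>i. i \<noteq> ?c) vs) = Ra"
      unfolding vs by (auto simp: takeWhile_append dropWhile_append)
    have Leq: "[1..<p] @ concat uss @ Lb = ?L"
      unfolding eq using pq upt_add_eq_append[of 1 p "s + 1 - p"] by simp
    have Req: "Ra @ concat wss @ [q + 1..<?n] = ?R"
      unfolding append_assoc[symmetric] eq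
      using pq upt_add_eq_append[of "s + 2" "q + 1" "s + t + 1 - q"] by simp
    have mem: "([1..<p], uss, Lb) \<in> inner_cuts ?L" "(Ra, wss, [q + 1..<?n]) \<in> inner_cuts ?R"
      using Leq Req ne by (simp_all add: inner_cuts_def)
    show "?i (?j a) = a"
      using pq by (simp only: a prod.case tw) (simp add: vs)
    show "?j a \<in> inner_cuts ?L \<times> inner_cuts ?R"
      using mem by (simp only: a prod.case tw mem_Times_iff fst_conv snd_conv)
    have closedU: "entry x V = el w v V" if "us @ V @ ws = ?L @ ?c # ?R" "V \<noteq> []" for us V ws
    proof (rule x)
      have "index_order s t = us @ V @ ws" using that(1) by (simp only: index_order_eq)
      with that(2) show "V \<in> intervals (index_order s t)" unfolding intervals_def by blast
    qed
    have word: "?L @ ?c # ?R = ([1..<p] @ concat uss) @ vs @ (concat wss @ [q + 1..<?n])"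
      using Leq Req by (simp add: vs)
    have e1: "map (entry x) uss = map (el w v) uss"
    proof (rule map_cong[OF refl])
      fix V assume "V \<in> set uss"
      then obtain a b where ab: "uss = a @ V # b" by (meson split_list)
      show "entry x V = el w v V"
      proof (rule closedU)
        show "([1..<p] @ concat a) @ V @ (concat b @ vs @ concat wss @ [q + 1..<?n]) = ?L @ ?c # ?R"
          by (simp only: word ab concat_append concat.simps append_assoc)
        show "V \<noteq> []" using ne ab by auto
      qed
    qed
    have e2: "map (entry x) wss = map (el w v) wss"
    proof (rule map_cong[OF refl])
      fix V assume "V \<in> set wss"
      then obtain a b where ab: "wss = a @ V # b" by (meson split_list)
      show "entry x V = el w v V"
      proof (rule closedU)
        show "([1..<p] @ concat uss @ vs @ concat a) @ V @ (concat b @ [q + 1..<?n]) = ?L @ ?c # ?R"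
          by (simp only: word ab concat_append concat.simps append_assoc)
        show "V \<noteq> []" using ne ab by auto
      qed
    qed
    have e3: "entry x vs = el w v vs"
      by (rule closedU[OF word[symmetric]]) (simp add: vs)
    have *: "[q + 1..<?n] @ ?n # [1..<p] \<in> intervals (index_order' s t)"
    proof -
      have "index_order' s t = (Ra @ concat wss) @ ([q + 1..<?n] @ ?n # [1..<p]) @ (concat uss @ Lb)"
        unfolding index_order'_eq Leq[symmetric] Req[symmetric] by simp
      then show ?thesis unfolding intervals_def by blast
    qed
    \<comment> \<open>For \<open>p = 1\<close> the list \<open>[1..<p]\<close> is empty and the
      block ends at \<open>s + t + 2\<close>, in accordance with the case distinction.\<close>
    have e4: "x' (q + 1) (if p = 1 then s + t + 2 else p - 1) = el w v ([q + 1..<?n] @ ?n # [1..<p])"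
    proof -
      have "hd ([q + 1..<?n] @ ?n # [1..<p]) = q + 1"
        using pq by (cases "q + 1 = ?n") (simp_all add: hd_append del: upt_Suc)
      moreover have "last ([q + 1..<?n] @ ?n # [1..<p]) = (if p = 1 then s + t + 2 else p - 1)"
        using pq by (simp del: upt_Suc)
      ultimately show ?thesis using x'[OF *] by (simp only: entry_def)
    qed
    have sg: "sdegs (take (p - 1) xs) = weight w [1..<p]"
        "sdegs (drop (p - 1) xs) = weight w (?L @ ?c # ?R @ [?n]) - weight w [1..<p]"
    proof -
      show t: "sdegs (take (p - 1) xs) = weight w [1..<p]"
        using sdegs_weight[OF w, of "p - 1"] pq len by simp
      have "sdegs xs = sdegs (take (p - 1) xs) + sdegs (drop (p - 1) xs)"
        by (simp flip: sdegs_append)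
      then show "sdegs (drop (p - 1) xs) = weight w (?L @ ?c # ?R @ [?n]) - weight w [1..<p]"
        unfolding t total[symmetric] by simp
    qed
    show "?h (?j a) = (case a of (p, q, r) \<Rightarrow> ?G p q r)"
      unfolding a prod.case tw sg e1 e2 e3 e4 unfolding vs ..
  next
    fix b assume "b \<in> inner_cuts ?L \<times> inner_cuts ?R"
    then obtain L1 uss Lb Ra wss R2 where b: "b = ((L1, uss, Lb), (Ra, wss, R2))"
      and L: "L1 @ concat uss @ Lb = ?L" "[] \<notin> set uss" and R: "Ra @ concat wss @ R2 = ?R" "[] \<notin> set wss"
      by (auto simp: inner_cuts_def)
    note l = append_eq_upt[OF L(1)]
    have R': "(Ra @ concat wss) @ R2 = ?R" using R(1) by simp
    note r = append_eq_upt[OF R']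
    define p q where "p = length L1 + 1" and "q = s + t + 1 - length R2"
    have pq: "1 \<le> p" "p \<le> s + 1" "s + 1 \<le> q" "q \<le> s + t + 1"
      using l(3) r(3) by (auto simp: p_def q_def)
    have L1: "L1 = [1..<p]" "concat uss @ Lb = [p..<?c]" using l by (auto simp: p_def)
    have qe: "s + 2 + length (Ra @ concat wss) = q + 1" using r(3) by (auto simp: q_def)
    have "[?c + 1..<q + 1] = [s + 2..<q + 1]" by simp
    then have R2: "R2 = [q + 1..<?n]" "Ra @ concat wss = [?c + 1..<q + 1]"
      using r(1,2) unfolding qe by simp_all
    have "?c \<notin> set (concat uss @ Lb)" unfolding L1 by simp
    then have tw: "takeWhile (\<lambda>i. i \<noteq> ?c) (Lb @ ?c # Ra) = Lb" "tl (dropWhile (\<lambda>i. i \<noteq> ?c) (Lb @ ?c # Ra)) = Ra"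
      by (auto simp: takeWhile_append dropWhile_append)
    show "?j (?i b) = b"
      unfolding b prod.case tw p_def[symmetric] q_def[symmetric] L1(1)[symmetric] R2(1)[symmetric] ..
    have "(uss, Lb @ ?c # Ra, wss) \<in> pointed_cuts ?c [p..<q + 1]"
      unfolding pointed_cuts_upt[OF pq(2,3)] using L1 R2 L R by blast
    with pq show "?i b \<in> ?S"
      unfolding b prod.case p_def[symmetric] q_def[symmetric] by simp
  qed
  also have "\<dots> = cyclic_value (mshifted I) w ?L ?c ?R ?n v"
    by (simp add: cyclic_value_def sum.cartesian_product split_def)
  finally show ?thesis .
qed

text \<open>The recorded degree of each entry is forced by the tuple, so an entry amounts to its
  underlying element, and a defining system to one function on the intervals of both orders.\<close>

lemma massey_inner_product_set_eq:
  assumes len: "length xs = s + t + 2"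
    and w: "\<And>i. 1 \<le> i \<Longrightarrow> i \<le> length xs \<Longrightarrow> w i = sdeg (xs ! (i - 1))"
    and a: "\<And>i. 1 \<le> i \<Longrightarrow> i \<le> length xs \<Longrightarrow> a i = snd (xs ! (i - 1))"
  shows "massey_inner_product_set G \<mu> I s t xs =
    {cyclic_value (mshifted I) w [1..<s + 1] (s + 1) [s + 2..<s + t + 2] (s + t + 2) v | v.
      defining_family G \<mu> w (intervals (index_order s t) \<union> intervals (index_order' s t)) a v}"
    (is "_ = {?V v | v. ?good v}")
proof -
  let ?O = "intervals (index_order s t)" and ?O' = "intervals (index_order' s t)"
  have range: "1 \<le> i \<and> i \<le> length xs" if "J \<in> ?O \<union> ?O'" "i \<in> set J" for i J
  proof -
    have "set J \<subseteq> set (index_order s t) \<union> set (index_order' s t)"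
      using that(1) by (auto simp: intervals_def)
    with that(2) show ?thesis using len by (auto simp: index_order_def index_order'_def)
  qed
  have weight: "weight w J = (\<Sum>m\<leftarrow>J. sdeg (xs ! (m - 1)))" if "J \<in> ?O \<union> ?O'" for J
    unfolding weight_def using range[OF that] w by (intro arg_cong[of _ _ sum_list] map_cong) auto
  show ?thesis
  proof (intro set_eqI iffI)
    fix r assume "r \<in> massey_inner_product_set G \<mu> I s t xs"
    then obtain x x' where r: "r = staircase_inner_product I s t xs x x'"
      and ds: "cyclic_defining_system G \<mu> s t xs x x'"
      by (auto simp: massey_inner_product_set_def)
    have fam: "triangular_family G (index_order s t) xs x" "triangular_family G (index_order' s t) xs x'"
      and agree: "\<forall>i j. 1 \<le> i \<and> i \<le> j \<and> j \<le> s \<longrightarrow> x i j = x' i j"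
        "\<forall>i j. s + 2 \<le> i \<and> i \<le> j \<and> j \<le> s + t + 1 \<longrightarrow> x i j = x' i j"
      and eqs: "\<And>J. J \<in> ?O \<Longrightarrow> \<mu> [entry x J] = - staircase_product \<mu> x J"
        "\<And>J. J \<in> ?O' \<Longrightarrow> \<mu> [entry x' J] = - staircase_product \<mu> x' J"
      using ds by (auto simp: cyclic_defining_system_def cyclic_triangular_system_def)
    \<comment> \<open>On an interval common to both orders the two families agree by
      \<open>arc_overlap\<close>, so preferring \<open>x\<close> there loses nothing.\<close>
    define v where "v = (\<lambda>J. snd (if J \<in> ?O then entry x J else entry x' J))"
    have ex: "entry x J = el w v J" if "J \<in> ?O" for J
    proof -
      have "sdeg (entry x J) = weight w J"
        using fam(1) that weight[of J] by (simp add: triangular_family_def)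
      then show ?thesis using that by (simp add: el_def v_def sdeg_def prod_eq_iff)
    qed
    have ex': "entry x' J = el w v J" if J: "J \<in> ?O'" for J
    proof (cases "J \<in> ?O")
      case True
      have "x (hd J) (last J) = x' (hd J) (last J)" using arc_overlap[OF True J] agree by blast
      then show ?thesis using ex[OF True] by (simp add: entry_def)
    next
      case False
      have "sdeg (entry x' J) = weight w J"
        using fam(2) J weight[of J] by (simp add: triangular_family_def)
      then show ?thesis using False by (simp add: el_def v_def sdeg_def prod_eq_iff)
    qed
    have "?good v"
      unfolding defining_family_def
    proof (intro conjI ballI allI impI)
      fix J assume J: "J \<in> ?O \<union> ?O'"
      then have "el w v J \<in> homog G"
        using fam ex[of J] ex'[of J] by (auto simp: triangular_family_def)
      then show "v J \<in> G (weight w J + 1)" by (simp add: el_def homog_def)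
      show "\<mu> [el w v J] = - staircase \<mu> w v J"
        using J eqs(1)[of J] eqs(2)[of J] ex[of J] ex'[of J] staircase_product_eq[of "index_order s t" x w v J \<mu>]
          staircase_product_eq[of "index_order' s t" x' w v J \<mu>] ex ex' by auto
    next
      fix i assume i: "[i] \<in> ?O \<union> ?O'"
      then have "i \<in> set (index_order s t) \<and> [i] \<in> ?O \<or> i \<in> set (index_order' s t) \<and> [i] \<in> ?O'"
        by (auto simp: intervals_def)
      then have "el w v [i] = xs ! (i - 1)"
        using fam ex[of "[i]"] ex'[of "[i]"] by (auto simp: triangular_family_def entry_def)
      from arg_cong[OF this, of snd] show "v [i] = a i"
        using a[of i] range[OF i, of i] by (simp add: el_def)
    qed
    moreover have "r = ?V v"
      unfolding r by (rule staircase_inner_product_eq[OF len w ex ex'])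
    ultimately show "r \<in> {?V v | v. ?good v}" by blast
  next
    fix r assume "r \<in> {?V v | v. ?good v}"
    then obtain v where r: "r = ?V v" and good: "?good v" by blast
    \<comment> \<open>One function of two indices serves as both families, since \<open>arc\<close>
      recovers the interval of either order from its end points.\<close>
    define x where "x = (\<lambda>i j. el w v (arc (s + t + 2) i j))"
    have ex: "entry x J = el w v J" if "J \<in> ?O" for J
      using arc_index_order(1)[OF that] by (simp add: entry_def x_def)
    have ex': "entry x J = el w v J" if "J \<in> ?O'" for J
      using arc_index_order'[OF that] by (simp add: entry_def x_def)
    have single: "x i i = xs ! (i - 1)" if i: "[i] \<in> ?O \<union> ?O'" for i
    proof -
      have "v [i] = a i" using good i by (auto simp: defining_family_def)
      then have "el w v [i] = xs ! (i - 1)"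
        using range[OF i, of i] w[of i] a[of i] by (simp add: el_def sdeg_def prod_eq_iff)
      moreover have "arc (s + t + 2) i i = [i]" by (simp add: arc_def)
      ultimately show ?thesis by (simp add: x_def)
    qed
    have mem: "[i] \<in> intervals ord" if i: "i \<in> set ord" for i ord
    proof -
      obtain us ws where "ord = us @ [i] @ ws" using split_list[OF i] by auto
      then show ?thesis unfolding intervals_def by blast
    qed
    have hom: "el w v J \<in> homog G" if "J \<in> ?O \<union> ?O'" for J
      using good that by (auto simp: defining_family_def el_def homog_def)
    have "cyclic_defining_system G \<mu> s t xs x x"
      unfolding cyclic_defining_system_def cyclic_triangular_system_def triangular_family_def
    proof (intro conjI ballI allI impI refl)
      fix J assume J: "J \<in> ?O"
      show "entry x J \<in> homog G" "sdeg (entry x J) = (\<Sum>m\<leftarrow>J. sdeg (xs ! (m - 1)))"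
        using J hom weight by (simp_all add: ex)
      show "\<mu> [entry x J] = - staircase_product \<mu> x J"
        using J good staircase_product_eq[of "index_order s t" x w v J \<mu>] ex
        by (auto simp: defining_family_def)
    next
      fix J assume J: "J \<in> ?O'"
      show "entry x J \<in> homog G" "sdeg (entry x J) = (\<Sum>m\<leftarrow>J. sdeg (xs ! (m - 1)))"
        using J hom weight by (simp_all add: ex')
      show "\<mu> [entry x J] = - staircase_product \<mu> x J"
        using J good staircase_product_eq[of "index_order' s t" x w v J \<mu>] ex'
        by (auto simp: defining_family_def)
    next
      fix i assume "i \<in> set (index_order s t)"
      then show "x i i = xs ! (i - 1)" by (intro single) (simp add: mem)
    next
      fix i assume "i \<in> set (index_order' s t)"
      then show "x i i = xs ! (i - 1)" by (intro single) (simp add: mem)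
    qed
    moreover have "staircase_inner_product I s t xs x x = r"
      unfolding r by (rule staircase_inner_product_eq[OF len w ex ex'])
    ultimately show "r \<in> massey_inner_product_set G \<mu> I s t xs"
      unfolding massey_inner_product_set_def by blast
  qed
qed


section \<open>Comparison of the Massey inner product sets\<close>

lemma cuts2_in_Blocks:
  assumes "\<forall>a J b. a @ J @ b \<in> Blocks \<longrightarrow> J \<noteq> [] \<longrightarrow> J \<in> Blocks"
    and "vs \<in> cuts2 J" "J \<in> Blocks" "V \<in> set vs"
  shows "V \<in> Blocks"
  by (rule cuts_in_Blocks[OF assms(1) _ assms(3,4)]) (use assms(2) in \<open>simp add: cuts2_def\<close>)

lemma cyclic_value_cong:
  assumes closed: "\<forall>a J b. a @ J @ b \<in> Blocks \<longrightarrow> J \<noteq> [] \<longrightarrow> J \<in> Blocks"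
    and word_Blocks: "L @ c # R \<in> Blocks" "R @ n # L \<in> Blocks"
    and eq: "\<And>J. J \<in> Blocks \<Longrightarrow> v J = v' J"
  shows "cyclic_value C w L c R n v = cyclic_value C w L c R n v'"
  unfolding cyclic_value_def
proof (intro sum.cong refl, clarify, intro sum.cong refl, clarify)
  fix L1 uss Lb Ra wss R2
  assume "(L1, uss, Lb) \<in> inner_cuts L" "(Ra, wss, R2) \<in> inner_cuts R"
  note sub = inner_cuts_Blocks[OF closed word_Blocks this]
  have el: "el w v J = el w v' J" if "J \<in> Blocks" for J
    using eq[OF that] by (simp add: el_def)
  have maps: "map (el w v) Js = map (el w v') Js" if "set Js \<subseteq> Blocks" for Js
    using el that by auto
  show "ksign (weight w L1 * (weight w (L @ c # R @ [n]) - weight w L1))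
      (C (map (el w v) uss) (el w v (Lb @ c # Ra)) (map (el w v) wss) (el w v (R2 @ n # L1))) =
    ksign (weight w L1 * (weight w (L @ c # R @ [n]) - weight w L1))
      (C (map (el w v') uss) (el w v' (Lb @ c # Ra)) (map (el w v') wss) (el w v' (R2 @ n # L1)))"
    by (simp only: maps[OF sub(1)] maps[OF sub(3)] el[OF sub(2)] el[OF sub(4)])
qed

locale transfer_cyclic = transfer_data sB B \<nu> sA A dA f g h + cyclic_form sB B \<nu> C
  for sB :: "'r::comm_ring_1 \<Rightarrow> 'b::ab_group_add \<Rightarrow> 'b" and B and \<nu>
    and sA :: "'r \<Rightarrow> 'a::ab_group_add \<Rightarrow> 'a" and A dA f g h C +
  fixes w :: "'i \<Rightarrow> int" and Blocks :: "'i list set" and a :: "'i \<Rightarrow> 'a"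
    and L :: "'i list" and c :: 'i and R :: "'i list" and n :: 'i
  assumes closed: "\<forall>a J b. a @ J @ b \<in> Blocks \<longrightarrow> J \<noteq> [] \<longrightarrow> J \<in> Blocks"
    and Blocks_nonempty: "[] \<notin> Blocks"
    and Blocks_distinct: "J \<in> Blocks \<Longrightarrow> distinct J"
    and Blocks_finite: "finite Blocks"
    and distinct_word: "distinct (L @ c # R @ [n])"
    and word_Blocks: "L @ c # R \<in> Blocks" "R @ n # L \<in> Blocks"
    and a_in: "[i] \<in> Blocks \<Longrightarrow> a i \<in> A (w i + 1)"
    and a_cycle: "[i] \<in> Blocks \<Longrightarrow> dA (a i) = 0"
begin

abbreviation "good_A \<equiv> defining_family A (transfer_mu dA \<nu> f g h) w Blocks a"
abbreviation "good_B \<equiv> defining_family B \<nu> w Blocks (\<lambda>i. g (a i))"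
abbreviation "St \<equiv> staircase \<nu> w"
abbreviation "Value \<equiv> cyclic_value C w L c R n"

text \<open>
  On the blocks in \<open>S\<close> the family \<open>y\<close> is the one induced by \<open>x\<close>, and \<open>x\<close> satisfies the equations of a
  defining system for the transferred structure.
\<close>

definition linked :: "'i list set \<Rightarrow> ('i list \<Rightarrow> 'a) \<Rightarrow> ('i list \<Rightarrow> 'b) \<Rightarrow> bool" where
  "linked S x y \<longleftrightarrow> (\<forall>J\<in>S. x J \<in> A (weight w J + 1) \<and> (\<forall>i. J = [i] \<longrightarrow> x J = a i) \<and>
     y J = g (x J) + h (St y J) \<and> dA (x J) = - f (St y J))"

lemma staircase_single: "staircase \<mu> w' v [i] = 0"
proof -
  have "cuts2 [i] = {}" using length_le_concat by (fastforce simp: cuts2_def cuts_def)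
  then show ?thesis by (simp add: staircase_def)
qed

lemma nonempty: "J \<in> Blocks \<Longrightarrow> J \<noteq> []"
  using Blocks_nonempty by auto

text \<open>The trivial cut of \<open>J\<close> contributes the differential, all other cuts the
  staircase product.\<close>

lemma mc_iff:
  assumes "J \<noteq> []"
  shows "(\<Sum>vs\<in>cuts J. shifted \<nu> (map (el w y) vs)) = 0 \<longleftrightarrow> \<nu> [el w y J] = - St y J"
  by (simp add: sum_cuts_insert[OF assms] staircase_def add_eq_0_iff2)

lemma St_in:
  assumes "\<And>J. J \<in> Blocks \<Longrightarrow> y J \<in> B (weight w J + 1)" "J \<in> Blocks"
  shows "St y J \<in> B (weight w J + 2)"
  unfolding staircase_def
proof (rule G_sum)
  fix vs assume "vs \<in> cuts2 J"
  then have vs: "vs \<in> cuts J" "vs \<noteq> []" "concat vs = J" by (auto simp: cuts2_def cuts_def)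
  have "map (el w y) vs \<in> lists (homog B)"
    using assms(1) cuts_in_Blocks[OF closed vs(1) assms(2)]
    by (auto simp: in_lists_conv_set el_def homog_def)
  from shifted_in_G[OF this] vs show "shifted \<nu> (map (el w y) vs) \<in> B (weight w J + 2)" by simp
qed

lemma transfer_blocks_axiom:
  assumes "\<And>J. J \<in> Blocks \<Longrightarrow> x J \<in> A (weight w J + 1)"
  shows "transfer_blocks sB B \<nu> sA A dA f g h w Blocks x"
  by unfold_locales (use closed Blocks_nonempty assms in auto)

lemma Value_kx:
  assumes C: "C = mshifted I" and x: "\<And>J. J \<in> Blocks \<Longrightarrow> x J \<in> A (weight w J + 1)"
  defines "K \<equiv> transfer_k \<nu> g h"
  shows "cyclic_value (mshifted (pullback A K (as_module K) I)) w L c R n x =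
    Value (transfer_blocks.kx \<nu> g h w x)"
proof -
  interpret transfer_blocks sB B \<nu> sA A dA f g h w Blocks x by (rule transfer_blocks_axiom[OF x])
  have kx: "kx = (\<lambda>J. \<Sum>zs\<in>cuts J. shifted K (map (el w x) zs))"
    by (rule ext) (simp add: kx_def K_def)
  show ?thesis
    unfolding kx
    by (rule cyclic_value_pullback[OF C distinct_word _ _ closed word_Blocks]) (use x k_in in \<open>auto simp: K_def\<close>)
qed

text \<open>Let \<open>S\<close> be the staircase product at \<open>J\<close> and apply the
  differential to \<open>g (x J) + h S\<close>. The first summand gives \<open>- g (f S)\<close>, by
  the equation for \<open>x\<close>; the second gives \<open>g (f S) - S\<close> minus
  \<open>h\<close> of the differential of \<open>S\<close>, by the homotopy identity. The total is
  \<open>- S\<close> as soon as \<open>S\<close> is closed.\<close>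

lemma kx_good:
  assumes "good_A x"
  shows "good_B (transfer_blocks.kx \<nu> g h w x)"
proof -
  have x: "x J \<in> A (weight w J + 1)" "transfer_mu dA \<nu> f g h [el w x J] = - staircase (transfer_mu dA \<nu> f g h) w x J"
    if "J \<in> Blocks" for J
    using assms that by (auto simp: defining_family_def)
  interpret transfer_blocks sB B \<nu> sA A dA f g h w Blocks x by (rule transfer_blocks_axiom[OF x(1)])
  have dx: "dA (x J) = - f (St kx J)" if "J \<in> Blocks" for J
    using x(2)[OF that] staircase_transfer_mu[OF that] by (simp add: transfer_mu_def el_def)
  have d: "\<nu> [el w kx J] = - St kx J" if "J \<in> Blocks" for J
    using that
  proof (induction "length J" arbitrary: J rule: less_induct)
    case less
    let ?d = "weight w J + 2" and ?S = "St kx J"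
    have S: "?S \<in> B ?d" by (rule St_in[OF kx_in less.prems])
    \<comment> \<open>Closedness of \<open>S\<close> uses the Maurer--Cartan equation on proper
      subintervals, whence the induction on length.\<close>
    have "\<nu> [(?d, ?S)] = 0"
      unfolding staircase_def
    proof (rule obstruction_closed[OF nonempty[OF less.prems]])
      fix a V b assume J: "J = a @ V @ b" "V \<noteq> []"
      then have V: "V \<in> Blocks" using closed less.prems by blast
      then show "kx V \<in> B (weight w V + 1)" by (rule kx_in)
      assume "V \<noteq> J"
      with J have "length V < length J" by auto
      from less.hyps[OF this V] show "(\<Sum>vs\<in>cuts V. shifted \<nu> (map (el w kx) vs)) = 0"
        by (simp add: mc_iff[OF J(2)])
    qed
    moreover have "g (f ?S) - ?S = \<nu> [(?d - 1, h ?S)] + h (\<nu> [(?d, ?S)])"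
      using homotopy S by (auto simp: homog_def)
    moreover have "h ?S \<in> B (weight w J + 1)" using h_in[OF S] by (simp add: add.commute)
    then have "\<nu> [(weight w J + 1, g (x J) + h ?S)] = \<nu> [(weight w J + 1, g (x J))] + \<nu> [(weight w J + 1, h ?S)]"
      using shifted_additive[of "[]" "[]" "weight w J + 1"] g_in[OF x(1)[OF less.prems]]
      by (simp add: additive_on_def)
    moreover have "\<nu> [(weight w J + 1, g (x J))] = g (dA (x J))"
      using g_chain x(1)[OF less.prems] by (auto simp: homog_def)
    ultimately show ?case
      using kx_rec[OF less.prems] dx[OF less.prems] by (simp add: el_def h_zero g_neg algebra_simps)
  qed
  show ?thesis
    unfolding defining_family_def
  proof (intro conjI ballI allI impI)
    fix i assume i: "[i] \<in> Blocks"
    then have "x [i] = a i" using assms by (simp add: defining_family_def)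
    with kx_rec[OF i] show "kx [i] = g (a i)" by (simp add: staircase_single h_zero)
  qed (simp_all add: kx_in d)
qed

text \<open>\<open>S\<close> is closed under subintervals and omits \<open>seg\<close>, so none of
  its members contains \<open>seg\<close> and their values persist. The one-letter intervals belong
  to \<open>S\<close>, which keeps the prescribed entries fixed. Minimality of \<open>seg\<close>
  puts all its proper subintervals in \<open>S\<close>, so the staircase product at
  \<open>seg\<close> persists as well.\<close>

lemma linked_step:
  assumes good: "good_B y" and lin: "linked S x y"
    and S: "S \<subseteq> Blocks" "\<forall>a J b. a @ J @ b \<in> S \<longrightarrow> J \<noteq> [] \<longrightarrow> J \<in> S" "\<forall>i. [i] \<in> Blocks \<longrightarrow> [i] \<in> S"
    and seg: "seg \<in> Blocks" "seg \<notin> S" and min: "\<And>J. J \<in> Blocks \<Longrightarrow> length J < length seg \<Longrightarrow> J \<in> S"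
  obtains x' y' where "good_B y'" "linked (insert seg S) x' y'" "Value y' = Value y"
proof -
  have y: "y J \<in> B (weight w J + 1)" "\<nu> [el w y J] = - St y J" if "J \<in> Blocks" for J
    using good that by (auto simp: defining_family_def)
  define z where "z = h (y seg)"
  have z: "z \<in> B (weight w seg)"
    using h_in[OF y(1)[OF seg(1)]] by (simp add: z_def)
  interpret pert: cyclic_perturbation sB B \<nu> w Blocks y seg z C L c R n
  proof
    show "(\<Sum>vs\<in>cuts J. shifted \<nu> (map (el w y) vs)) = 0" if "J \<in> Blocks" for J
      using y(2)[OF that] by (simp add: mc_iff[OF nonempty[OF that]])
  qed (use closed Blocks_nonempty nonempty[OF seg(1)] Blocks_distinct distinct_word word_Blocks y z in blast)+
  let ?y = pert.v' and ?x = "x(seg := f (y seg))"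
  have D0: "pert.Dz J = 0" if "J \<in> S" for J
  proof (rule pert.Dz_eq_0)
    fix a b show "J \<noteq> a @ seg @ b"
      using that S(2) seg(2) nonempty[OF seg(1)] by blast
  qed
  have yS: "?y J = y J" if "J \<in> S" for J
    using D0[OF that] by (simp add: pert.v'_def)
  have StS: "St ?y J = St y J" if "J \<in> S" for J
  proof (rule staircase_cong)
    fix vs V assume "vs \<in> cuts2 J" "V \<in> set vs"
    then have "V \<in> S" by (rule cuts2_in_Blocks[OF S(2) _ that])
    then show "?y V = y V" by (rule yS)
  qed
  have Stseg: "St ?y seg = St y seg"
  proof (rule staircase_cong)
    fix vs V assume vs: "vs \<in> cuts2 seg" "V \<in> set vs"
    then have "V \<in> Blocks" by (rule cuts2_in_Blocks[OF closed _ seg(1)])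
    with length_cuts2_less[OF vs] show "?y V = y V" by (intro yS min)
  qed
  \<comment> \<open>Among the cuts of \<open>seg\<close> only the trivial one contains the block
    \<open>seg\<close>, the others consisting of shorter words.\<close>
  have Dseg: "pert.Dz seg = \<nu> [(weight w seg, z)]"
  proof -
    have "pert.mark 0 vs (shifted \<nu> (map pert.vz vs)) = 0" if "vs \<in> cuts2 seg" for vs
      using length_cuts2_less[OF that, of seg] by (auto simp: pert.mark_def)
    moreover have "pert.mark 0 [seg] (shifted \<nu> (map pert.vz [seg])) = \<nu> [(weight w seg, z)]"
      by (simp add: pert.mark_def pert.before_def pert.vz_def ksign_def)
    ultimately show ?thesis
      unfolding pert.Dz_def by (simp add: sum_cuts_insert[OF nonempty[OF seg(1)]])
  qed
  have good': "good_B ?y"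
    unfolding defining_family_def
  proof (intro conjI ballI allI impI)
    fix J assume J: "J \<in> Blocks"
    show "?y J \<in> B (weight w J + 1)" by (rule pert.v'_in_G[OF J])
    show "\<nu> [el w ?y J] = - St ?y J"
      using pert.mc_v'[OF J] by (simp add: mc_iff[OF nonempty[OF J]])
  next
    fix i assume i: "[i] \<in> Blocks"
    then show "?y [i] = g (a i)" using yS[of "[i]"] S(3) good by (simp add: defining_family_def)
  qed
  have "linked (insert seg S) ?x ?y"
    unfolding linked_def
  proof (intro ballI)
    fix J assume "J \<in> insert seg S"
    then consider "J = seg" | "J \<in> S" "J \<noteq> seg" using seg(2) by blast
    then show "?x J \<in> A (weight w J + 1) \<and> (\<forall>i. J = [i] \<longrightarrow> ?x J = a i) \<and>
      ?y J = g (?x J) + h (St ?y J) \<and> dA (?x J) = - f (St ?y J)"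
    proof cases
      case 1
      have ns: "\<forall>i. seg \<noteq> [i]" using seg S(3) by blast
      have fA: "f (y seg) \<in> A (weight w seg + 1)" by (rule f_in[OF y(1)[OF seg(1)]])
      have "g (f (y seg)) - y seg = \<nu> [(weight w seg + 1 - 1, h (y seg))] + h (\<nu> [(weight w seg + 1, y seg)])"
        using homotopy y(1)[OF seg(1)] by (auto simp: homog_def)
      then have gf: "g (f (y seg)) - y seg = \<nu> [(weight w seg, h (y seg))] - h (St y seg)"
        using y(2)[OF seg(1)] by (simp add: el_def h_neg)
      have "?y seg = y seg + \<nu> [(weight w seg, h (y seg))]"
        by (simp add: pert.v'_def Dseg) (simp add: z_def)
      also have "\<dots> = g (f (y seg)) + h (St y seg)" using gf by (simp add: algebra_simps)
      finally have y': "?y seg = g (f (y seg)) + h (St y seg)" .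
      \<comment> \<open>The equation for \<open>x\<close> at \<open>seg\<close> is the image under
        \<open>f\<close> of the Maurer--Cartan equation of \<open>y\<close> at
        \<open>seg\<close>.\<close>
      have "f (\<nu> [(weight w seg + 1, y seg)]) = dA (f (y seg))"
        using f_chain y(1)[OF seg(1)] by (auto simp: homog_def)
      then have d: "dA (f (y seg)) = - f (St y seg)"
        using y(2)[OF seg(1)] by (simp add: el_def f_neg)
      show ?thesis unfolding 1 Stseg using ns fA y' d by simp
    next
      case 2
      with lin show ?thesis by (simp add: linked_def yS StS)
    qed
  qed
  with good' pert.cyclic_value_perturbation that show thesis by blast
qed

text \<open>Induction on the number of blocks outside \<open>S\<close>. Choosing \<open>seg\<close>
  of minimal length keeps \<open>S\<close> closed under subintervals when \<open>seg\<close> is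
  added.\<close>

lemma linked_all:
  assumes "good_B y" "linked S x y"
    and "S \<subseteq> Blocks" "\<forall>a J b. a @ J @ b \<in> S \<longrightarrow> J \<noteq> [] \<longrightarrow> J \<in> S" "\<forall>i. [i] \<in> Blocks \<longrightarrow> [i] \<in> S"
  shows "\<exists>x' y'. good_B y' \<and> linked Blocks x' y' \<and> Value y' = Value y"
  using assms
proof (induction "card (Blocks - S)" arbitrary: S x y rule: less_induct)
  case less
  show ?case
  proof (cases "S = Blocks")
    case True
    with less.prems show ?thesis by blast
  next
    case False
    then have "\<exists>J. J \<in> Blocks - S" using less.prems(3) by blast
    then obtain seg where seg: "seg \<in> Blocks - S" "\<And>J. J \<in> Blocks - S \<Longrightarrow> length seg \<le> length J"
      by (metis ex_has_least_nat[of "\<lambda>J. J \<in> Blocks - S" _ length])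
    have min: "J \<in> S" if "J \<in> Blocks" "length J < length seg" for J
      using seg(2)[of J] that by fastforce
    from linked_step[OF less.prems _ _ min] seg(1) obtain x' y' where
      xy: "good_B y'" "linked (insert seg S) x' y'" "Value y' = Value y" by blast
    have "card (Blocks - insert seg S) < card (Blocks - S)"
      using seg(1) Blocks_finite by (intro psubset_card_mono) auto
    moreover have "\<forall>a J b. a @ J @ b \<in> insert seg S \<longrightarrow> J \<noteq> [] \<longrightarrow> J \<in> insert seg S"
    proof (intro allI impI)
      fix a J b assume J: "a @ J @ b \<in> insert seg S" "J \<noteq> []"
      show "J \<in> insert seg S"
      proof (cases "a @ J @ b = seg \<and> J \<noteq> seg")
        case True
        then have "length J < length seg" by auto
        moreover have "J \<in> Blocks" using True seg(1) closed J(2) by blast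
        ultimately show ?thesis using min by blast
      next
        case False
        with J less.prems(4) show ?thesis by blast
      qed
    qed
    ultimately show ?thesis
      using less.hyps[of "insert seg S" y' x'] xy less.prems(3,5) seg(1) by auto
  qed
qed

text \<open>One-letter intervals are linked through \<open>a\<close> itself: their staircase product
  is empty, \<open>y [i] = g (a i)\<close>, and \<open>dA (a i) = 0\<close> by
  \<open>a_cycle\<close>. Once all blocks are linked, the family in \<open>B\<close> equals the one
  induced by \<open>x\<close>, since the recursion determines its solution by induction on
  length.\<close>

lemma good_A_of_good_B:
  assumes "good_B y"
  obtains x where "good_A x" "Value (transfer_blocks.kx \<nu> g h w x) = Value y"
proof -
  let ?S = "{J \<in> Blocks. length J = 1}"
  have lin: "linked ?S (\<lambda>J. a (hd J)) y"
    unfolding linked_def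
  proof
    fix J assume "J \<in> ?S"
    then obtain i where J: "J = [i]" "[i] \<in> Blocks" by (auto simp: length_Suc_conv)
    then have "y [i] = g (a i)" using assms unfolding defining_family_def by blast
    then show "a (hd J) \<in> A (weight w J + 1) \<and> (\<forall>i. J = [i] \<longrightarrow> a (hd J) = a i) \<and>
        y J = g (a (hd J)) + h (St y J) \<and> dA (a (hd J)) = - f (St y J)"
      using a_in[OF J(2)] a_cycle[OF J(2)] unfolding J(1)
      by (simp add: staircase_single f_zero h_zero)
  qed
  have sub: "\<forall>a J b. a @ J @ b \<in> ?S \<longrightarrow> J \<noteq> [] \<longrightarrow> J \<in> ?S"
  proof (intro allI impI)
    fix a' J b assume J: "a' @ J @ b \<in> ?S" "J \<noteq> []"
    then have "length J = 1" by (cases J) auto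
    with J closed show "J \<in> ?S" by blast
  qed
  from linked_all[OF assms lin _ sub] obtain x y'
    where xy: "good_B y'" "linked Blocks x y'" "Value y' = Value y"
    by auto
  have x: "x J \<in> A (weight w J + 1)" "y' J = g (x J) + h (St y' J)" "dA (x J) = - f (St y' J)"
    if "J \<in> Blocks" for J
    using xy(2) that by (auto simp: linked_def)
  interpret transfer_blocks sB B \<nu> sA A dA f g h w Blocks x by (rule transfer_blocks_axiom[OF x(1)])
  have kx_eq: "kx J = y' J" if "J \<in> Blocks" for J
    using that
  proof (induction "length J" arbitrary: J rule: less_induct)
    case less
    have "St kx J = St y' J"
    proof (rule staircase_cong)
      fix vs V assume vs: "vs \<in> cuts2 J" "V \<in> set vs"
      then have "V \<in> Blocks" by (rule cuts2_in_Blocks[OF closed _ less.prems])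
      then show "kx V = y' V" by (rule less.hyps[OF length_cuts2_less[OF vs]])
    qed
    then show ?case using kx_rec[OF less.prems] x(2)[OF less.prems] by simp
  qed
  have "Value kx = Value y'"
    by (rule cyclic_value_cong[OF closed word_Blocks kx_eq])
  moreover have "good_A x"
    unfolding defining_family_def
  proof (intro conjI ballI allI impI)
    fix J assume J: "J \<in> Blocks"
    show "x J \<in> A (weight w J + 1)" by (rule x(1)[OF J])
    have "St kx J = St y' J"
    proof (rule staircase_cong)
      fix vs V assume "vs \<in> cuts2 J" "V \<in> set vs"
      then have "V \<in> Blocks" by (rule cuts2_in_Blocks[OF closed _ J])
      then show "kx V = y' V" by (rule kx_eq)
    qed
    then show "transfer_mu dA \<nu> f g h [el w x J] = - staircase (transfer_mu dA \<nu> f g h) w x J"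
      using staircase_transfer_mu[OF J] x(3)[OF J] by (simp add: transfer_mu_def el_def)
  next
    fix i assume "[i] \<in> Blocks"
    then show "x [i] = a i" using xy(2) by (simp add: linked_def)
  qed
  ultimately show thesis using that xy(3) by simp
qed

lemma value_sets_eq:
  assumes "C = mshifted I"
  defines "k \<equiv> transfer_k \<nu> g h"
  shows "{cyclic_value (mshifted (pullback A k (as_module k) I)) w L c R n x | x. good_A x} =
    {Value y | y. good_B y}"
proof -
  have val: "cyclic_value (mshifted (pullback A k (as_module k) I)) w L c R n x =
      Value (transfer_blocks.kx \<nu> g h w x)" if "good_A x" for x
    unfolding k_def by (rule Value_kx[OF assms(1)]) (use that in \<open>simp add: defining_family_def\<close>)
  show ?thesis
  proof (intro subset_antisym subsetI)
    fix r assume "r \<in> {cyclic_value (mshifted (pullback A k (as_module k) I)) w L c R n x | x. good_A x}"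
    then show "r \<in> {Value y | y. good_B y}" using val kx_good by auto
  next
    fix r assume "r \<in> {Value y | y. good_B y}"
    then obtain y where "r = Value y" "good_B y" by blast
    moreover from this(2) obtain x where "good_A x" "Value (transfer_blocks.kx \<nu> g h w x) = Value y"
      by (rule good_A_of_good_B)
    ultimately show "r \<in> {cyclic_value (mshifted (pullback A k (as_module k) I)) w L c R n x | x. good_A x}"
      using val by force
  qed
qed

end

text \<open>The hypothesis \<open>cycles\<close> serves the inclusion of the second set in the
  first. A one-letter entry of a defining system over \<open>A\<close> is prescribed and has to be a
  cycle, which does not follow from its image under \<open>g\<close> being one, as the case of a
  zero module \<open>B\<close> shows.\<close>

theorem theorem4p19:
  fixes sA :: "'r::comm_ring_1 \<Rightarrow> 'a::ab_group_add \<Rightarrow> 'a" and A :: "int \<Rightarrow> 'a set"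
    and dA :: "'a \<Rightarrow> 'a"
    and sB :: "'r \<Rightarrow> 'b::ab_group_add \<Rightarrow> 'b" and B :: "int \<Rightarrow> 'b set"
    and \<nu> :: "(int \<times> 'b) list \<Rightarrow> 'b"
    and f :: "'b \<Rightarrow> 'a" and g :: "'a \<Rightarrow> 'b" and h :: "'b \<Rightarrow> 'b"
    and e :: int and I :: "('b, 'b, int \<times> 'b \<Rightarrow> 'r) mod_maps"
    and s t :: nat and xs :: "(int \<times> 'a) list"
  assumes "chain_complex sA A dA"
    and "ainf_algebra sB B \<nu>"
    and "graded_hom sB B sA A 0 f"
    and "\<forall>(d, y)\<in>homog B. f (\<nu> [(d, y)]) = dA (f y)"
    and "graded_hom sA A sB B 0 g"
    and "\<forall>(d, x)\<in>homog A. g (dA x) = \<nu> [(d, g x)]"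
    and "graded_hom sB B sB B (- 1) h"
    and "\<forall>(d, y)\<in>homog B. g (f y) - y = \<nu> [(d - 1, h y)] + h (\<nu> [(d, y)])"
    and "ainf_inner_product sB B \<nu> sB B (as_module \<nu>) e I"
    and "s + t \<ge> 1"
    and "length xs = s + t + 2"
    and "xs \<in> lists (homog A)"
    and cycles: "\<forall>(d, x)\<in>set xs. dA x = 0"
  shows "massey_inner_product_set A (transfer_mu dA \<nu> f g h)
           (pullback A (transfer_k \<nu> g h) (as_module (transfer_k \<nu> g h)) I) s t xs
         = massey_inner_product_set B \<nu> I s t (map (apsnd g) xs)"
proof -
  let ?w = "\<lambda>i. sdeg (xs ! (i - 1))" and ?a = "\<lambda>i. snd (xs ! (i - 1))"
  let ?Blocks = "intervals (index_order s t) \<union> intervals (index_order' s t)"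
  let ?L = "[1..<s + 1]" and ?c = "s + 1" and ?R = "[s + 2..<s + t + 2]" and ?n = "s + t + 2"
  have elem: "xs ! (i - 1) \<in> homog A \<and> xs ! (i - 1) \<in> set xs" if "[i] \<in> ?Blocks" for i
  proof -
    have "i \<in> set (index_order s t) \<union> set (index_order' s t)"
      using that by (auto simp: intervals_def)
    then have "i - 1 < length xs"
      using assms(11) by (auto simp: index_order_def index_order'_def)
    with assms(12) show ?thesis by (auto simp: in_lists_conv_set)
  qed
  interpret transfer_data sB B \<nu> sA A dA f g h
    using assms by (simp add: transfer_data_def transfer_data_axioms_def)
  interpret cyclic_form sB B \<nu> "mshifted I"
    using assms by (intro inner_product_cyclic_form)
  interpret transfer_cyclic sB B \<nu> sA A dA f g h "mshifted I" ?w ?Blocks ?a ?L ?c ?R ?n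
  proof
    show "\<forall>a J b. a @ J @ b \<in> ?Blocks \<longrightarrow> J \<noteq> [] \<longrightarrow> J \<in> ?Blocks"
      using intervals_closed by blast
    show "[] \<notin> ?Blocks" by (simp add: intervals_def)
    show "distinct J" if "J \<in> ?Blocks" for J
    proof -
      have "distinct (index_order s t)" "distinct (index_order' s t)"
        by (auto simp: index_order_def index_order'_def)
      with that show ?thesis by (auto simp: intervals_def)
    qed
    show "finite ?Blocks"
    proof -
      have "finite (intervals ord)" for ord
      proof (rule finite_subset)
        show "intervals ord \<subseteq> (\<lambda>(a, J, b). J) ` splits3 ord"
          by (force simp: intervals_def splits3_def)
      qed (simp add: finite_splits3)
      then show ?thesis by simp
    qed
    show "distinct (?L @ ?c # ?R @ [?n])" by auto
    have "ord \<in> intervals ord" if "ord \<noteq> []" for ord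
      using that unfolding intervals_def by (auto intro: exI[of _ "[]"])
    then show "?L @ ?c # ?R \<in> ?Blocks" "?R @ ?n # ?L \<in> ?Blocks"
      by (metis UnI1 index_order_eq Nil_is_append_conv list.distinct(1),
          metis UnI2 index_order'_eq Nil_is_append_conv list.distinct(1))
    show "?a i \<in> A (?w i + 1)" if "[i] \<in> ?Blocks" for i
      using elem[OF that] by (auto simp: homog_def sdeg_def)
    show "dA (?a i) = 0" if "[i] \<in> ?Blocks" for i
      using elem[OF that] cycles by (auto simp: case_prod_unfold)
  qed
  have "massey_inner_product_set B \<nu> I s t (map (apsnd g) xs) =
    {cyclic_value (mshifted I) ?w ?L ?c ?R ?n y | y. defining_family B \<nu> ?w ?Blocks (\<lambda>i. g (?a i)) y}"
    by (rule massey_inner_product_set_eq) (use assms(11) in \<open>auto simp: sdeg_def\<close>)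
  moreover have "massey_inner_product_set A (transfer_mu dA \<nu> f g h)
      (pullback A (transfer_k \<nu> g h) (as_module (transfer_k \<nu> g h)) I) s t xs =
    {cyclic_value (mshifted (pullback A (transfer_k \<nu> g h) (as_module (transfer_k \<nu> g h)) I)) ?w ?L ?c ?R ?n x | x.
      defining_family A (transfer_mu dA \<nu> f g h) ?w ?Blocks ?a x}"
    by (rule massey_inner_product_set_eq) (use assms(11) in auto)
  ultimately show ?thesis using value_sets_eq[OF refl] by simp
qed

end
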